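(* Let $p_1,p_2\ge2$, $p=p_1p_2$, and let $h$ be either the symmetric square root map or the Cholesky factor map on $\mathcal{S}_{p_1,p_2}^{++}$. (1) The Kronecker map $k:\mathcal{S}_p^{++}\to\mathcal{S}_{p_1,p_2}^{++}$ is smooth. Consequently $f:\Sigma\in\mathcal{S}_p^{++}\mapsto(k(\Sigma),c(\Sigma))\in\mathcal{S}_{p_1,p_2}^{++}\times\mathcal{C}_{p_1,p_2}^{++}$ is smooth for either choice of $h$. Therefore $\mathcal{S}_p^{++}$ is diffeomorphic to $\mathcal{S}_{p_1,p_2}^{++}\times\mathcal{C}_{p_1,p_2}^{++}$, as the inverse $g:(K,C)\mapsto h(K)Ch(K)^\top$ of $f$ is also smooth. (2) Let $\Sigma\in\mathcal{S}_p^{++}$, $k(\Sigma)=\Sigma_2\otimes\Sigma_1$ with $|\Sigma_1|=1$, $C=c(\Sigma)$, and $V\in T_\Sigma\mathcal{S}_p^{++}\equiv\mathcal{S}_p$. Let $\Sigma_i^{1/2}\in\mathcal{S}_{p_i}^{++}$ be the symmetric square roots, $K^{1/2}=\Sigma_2^{1/2}\otimes\Sigma_1^{1/2}$, and $\tilde V=K^{-1/2}VK^{-1/2}$. Let $T=\{(U_1,U_2)\in\mathcal{S}_{p_1}\times\mathcal{S}_{p_2}:\mathrm{tr}(\Sigma_1^{-1}U_1)=0\}$ and define the linear operator $\mathcal{R}_C:T\to T$ by $$\mathcal{R}_C(U_1,U_2)=\Big(U_1+\tfrac1{p_2}\Sigma_1^{1/2}M_1\Sigma_1^{1/2}-\tfrac1{p_2}\mathrm{tr}(\Sigma_2^{-1/2}U_2\Sigma_2^{-1/2})\Sigma_1,\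 U_2+\tfrac1{p_1}\Sigma_2^{1/2}M_2\Sigma_2^{1/2}\Big),$$ where $M_1\in\mathcal{S}_{p_1}$ and $M_2\in\mathcal{S}_{p_2}$ are given by $M_1=\sum_{i,j=1}^{p_2}(\Sigma_2^{-1/2}U_2\Sigma_2^{-1/2})_{ij}C_{[j,i]}$ and $(M_2)_{ij}=\mathrm{tr}(C_{[i,j]}\Sigma_1^{-1/2}U_1\Sigma_1^{-1/2})$. Then $\mathcal{R}_C$ is a bijection, and $$dk(\Sigma)[V]=U_2\otimes\Sigma_1+\Sigma_2\otimes U_1,$$ where $(U_1,U_2)\in T$ is the unique solution of $\mathcal{R}_C(U_1,U_2)=(N_1,N_2)$ with $$N_1=\tfrac1{p_2}\Sigma_1^{1/2}\big[\mathrm{tr}_1(\tilde V)-\tfrac{\mathrm{tr}(\tilde V)}{p_1}I_{p_1}\big]\Sigma_1^{1/2},\qquad N_2=\tfrac1{p_1}\Sigma_2^{1/2}\mathrm{tr}_2(\tilde V)\Sigma_2^{1/2}.$$ Also $$dc(\Sigma)[V]=h(k(\Sigma))^{-1}Vh(k(\Sigma))^{-\top}-h(k(\Sigma))^{-1}\big(dh(k(\Sigma))[dk(\Sigma)[V]]\big)C-C\big(dh(k(\Sigma))[dk(\Sigma)[V]]\big)^\top h(k(\Sigma))^{-\top},$$ and consequently $df(\Sigma)[V]=(dk(\Sigma)[V],dc(\Sigma)[V])$. (3) In particular, if $C=I_p$, i.e. $\Sigma=k(\Sigma)=\Sigma_2\otimes\Sigma_1$, then $\mathcal{R}_C$ reduces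 to the identity operator, so $(U_1,U_2)=(N_1,N_2)$, and $$dk(\Sigma)[V]=\tfrac1{p_1}\big(\Sigma_2^{1/2}\mathrm{tr}_2(\tilde V)\Sigma_2^{1/2}\big)\otimes\Sigma_1+\tfrac1{p_2}\Sigma_2\otimes\big(\Sigma_1^{1/2}\mathrm{tr}_1(\tilde V)\Sigma_1^{1/2}\big)-\tfrac{\mathrm{tr}(\tilde V)}{p}\Sigma,$$ $$dc(\Sigma)[V]=h(k(\Sigma))^{-1}Vh(k(\Sigma))^{-\top}-\tilde R-\tilde R^\top,$$ where, if $h$ is the Cholesky factor map, $\tilde R=\big(I_{p_2}\otimes L_1^{-1}U_1L_1^{-\top}+L_2^{-1}U_2L_2^{-\top}\otimes I_{p_1}\big)_{\frac12}$, and, if $h$ is the symmetric square root map, $\tilde R=(\Gamma_2\otimes\Gamma_1)(\Lambda_2^{-1/2}\otimes\Lambda_1^{-1/2})\big[\Lambda^{-}\circ(\Lambda_2\otimes\Gamma_1^\top U_1\Gamma_1+\Gamma_2^\top U_2\Gamma_2\otimes\Lambda_1)\big](\Gamma_2\otimes\Gamma_1)^\top$.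
   Context: $\mathcal{S}_q$, $\mathcal{S}_q^{++}$: real symmetric, resp. symmetric positive definite, $q\times q$ matrices. $\mathcal{S}_{p_1,p_2}^{++}=\{\Sigma_2\otimes\Sigma_1:\Sigma_i\in\mathcal{S}_{p_i}^{++}\}$, a smooth manifold with tangent space $\{U_2\otimes\Sigma_1+\Sigma_2\otimes U_1:U_i\in\mathcal{S}_{p_i}\}$ at $\Sigma_2\otimes\Sigma_1$. The space $T$ is the tangent space at $(\Sigma_1,\Sigma_2)$ of $\{\Sigma_1\in\mathcal{S}_{p_1}^{++}:|\Sigma_1|=1\}\times\mathcal{S}_{p_2}^{++}$. For $M\in\mathcal{S}_p$, $M_{[i,j]}\in\mathbb{R}^{p_1\times p_1}$ ($1\le i,j\le p_2$) are its blocks; $\mathrm{tr}_1(M)=\sum_iM_{[i,i]}$, and $\mathrm{tr}_2(M)$ is the $p_2\times p_2$ matrix with entries $\mathrm{tr}(M_{[i,j]})$. Kronecker map: $k(\Sigma)$ is the unique minimizer of $\mathrm{tr}(\Sigma(K_2\otimes K_1)^{-1})+p_1\log|K_2|+p_2\log|K_1|$ over $K_2\otimes K_1\in\mathcal{S}_{p_1,p_2}^{++}$. $\mathcal{C}_{p_1,p_2}^{++}=\{C\in\mathcal{S}_p^{++}:k(C)=I_p\}=\{C\in\mathcal{S}_p^{++}:\mathrm{tr}_1(C)=p_2I_{p_1},\mathrm{tr}_2(C)=p_1I_{p_2}\}$, an embedded submanifold of $\mathcal{S}_p^{++}$. The map $h$ sends $K\in\mathcal{S}_{p_1,p_2}^{++}$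 to its symmetric positive definite square root, or to its lower triangular Cholesky factor with positive diagonal ($h(K)h(K)^\top=K$); $dh$ is its differential. Core map: $c(\Sigma)=h(k(\Sigma))^{-1}\Sigma h(k(\Sigma))^{-\top}$. $L_i$ is the Cholesky factor of $\Sigma_i$; $\Sigma_i=\Gamma_i\Lambda_i\Gamma_i^\top$ is an eigendecomposition ($\Gamma_i$ orthogonal, $\Lambda_i$ diagonal); $\lambda_i\in\mathbb{R}^{p_i}$ is the vector of diagonal entries of $\Lambda_i^{1/2}$; $\Lambda^{-}$ is the entrywise inverse of $\Lambda=\mathbf{1}_{p_2}\lambda_2^\top\otimes\mathbf{1}_{p_1}\lambda_1^\top+\lambda_2\mathbf{1}_{p_2}^\top\otimes\lambda_1\mathbf{1}_{p_1}^\top$; $\circ$ is the Hadamard product. For symmetric $M$, $(M)_{\frac12}$ is the strictly lower triangular part of $M$ plus half its diagonal part.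
   Formalization: In (2), when h is the Cholesky map, the equation determining dk(Σ)[V] uses the operator R with the symmetric-root core K^{-1/2}ΣK^{-1/2} in place of C=c(Σ), since it is false with the Cholesky core; bijectivity of R_C is shown for both cores. *)

theory Defs
  imports "HOL-Analysis.Analysis"
begin

definition sym_mats :: "(real^'n^'n) set"
  where "sym_mats = {A. transpose A = A}"

definition spd_mats :: "(real^'n^'n) set"
  where "spd_mats = {A. transpose A = A \<and> (\<forall>x. x \<noteq> 0 \<longrightarrow> x \<bullet> (A *v x) > 0)}"

definition sym_sqrt :: "real^'n^'n \<Rightarrow> real^'n^'n"
  where "sym_sqrt A = (THE B. B \<in> spd_mats \<and> B ** B = A)"

text \<open>
  Lower triangular matrices and Cholesky factors depend on how the index type is ordered.
  The strict order is an explicit parameter, because the order instance for pairs that comes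
  with HOL-Analysis is componentwise, not lexicographic.
\<close>

definition lower_triangular :: "('n \<Rightarrow> 'n \<Rightarrow> bool) \<Rightarrow> real^'n^'n \<Rightarrow> bool"
  where "lower_triangular lt L \<longleftrightarrow> (\<forall>i j. lt i j \<longrightarrow> L $ i $ j = 0)"

definition cholesky :: "('n \<Rightarrow> 'n \<Rightarrow> bool) \<Rightarrow> real^'n^'n \<Rightarrow> real^'n^'n"
  where "cholesky lt A =
    (THE L. lower_triangular lt L \<and> (\<forall>i. L $ i $ i > 0) \<and> L ** transpose L = A)"

definition lex_less :: "'b::linorder \<times> 'a::linorder \<Rightarrow> 'b \<times> 'a \<Rightarrow> bool"
  where "lex_less i j \<longleftrightarrow> fst i < fst j \<or> (fst i = fst j \<and> snd i < snd j)"

definition half_part :: "('n \<Rightarrow> 'n \<Rightarrow> bool) \<Rightarrow> real^'n^'n \<Rightarrow> real^'n^'n"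
  where "half_part lt M =
    (\<chi> i j. if lt j i then M $ i $ j else if i = j then M $ i $ j / 2 else 0)"

definition eigendecomposition :: "real^'n^'n \<Rightarrow> real^'n^'n \<Rightarrow> real^'n^'n \<Rightarrow> bool"
  where "eigendecomposition A \<Gamma> \<Lambda> \<longleftrightarrow>
    orthogonal_matrix \<Gamma> \<and> (\<forall>i j. i \<noteq> j \<longrightarrow> \<Lambda> $ i $ j = 0) \<and> A = \<Gamma> ** \<Lambda> ** transpose \<Gamma>"

definition diag_vec :: "real^'n^'n \<Rightarrow> real^'n"
  where "diag_vec A = (\<chi> i. A $ i $ i)"

definition outer :: "real^'n \<Rightarrow> real^'m \<Rightarrow> real^'m^'n"
  where "outer u v = (\<chi> i j. u $ i * v $ j)"

definition hadamard :: "real^'n^'m \<Rightarrow> real^'n^'m \<Rightarrow> real^'n^'m"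
  where "hadamard A B = (\<chi> i j. A $ i $ j * B $ i $ j)"

definition entrywise_inverse :: "real^'n^'m \<Rightarrow> real^'n^'m"
  where "entrywise_inverse A = (\<chi> i j. inverse (A $ i $ j))"

text \<open>
  With \<open>p\<^sub>1 = CARD('a)\<close> and \<open>p\<^sub>2 = CARD('b)\<close>, a matrix of size \<open>p = p\<^sub>1 p\<^sub>2\<close> is indexed by
  \<open>'b \<times> 'a\<close>: the first component selects the block, the second one the position inside
  the block. Under \<open>lex_less\<close> this is the usual layout of a Kronecker product.
\<close>

definition kron :: "real^'b^'b \<Rightarrow> real^'a^'a \<Rightarrow> real^('b::finite \<times> 'a::finite)^('b \<times> 'a)"
  where "kron A B = (\<chi> i j. A $ fst i $ fst j * B $ snd i $ snd j)"

definition block :: "real^('b::finite \<times> 'a::finite)^('b \<times> 'a) \<Rightarrow> 'b \<Rightarrow> 'b \<Rightarrow> real^'a^'a"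
  where "block M i j = (\<chi> k l. M $ (i, k) $ (j, l))"

definition tr1 :: "real^('b::finite \<times> 'a::finite)^('b \<times> 'a) \<Rightarrow> real^'a^'a"
  where "tr1 M = (\<Sum>i\<in>UNIV. block M i i)"

definition tr2 :: "real^('b::finite \<times> 'a::finite)^('b \<times> 'a) \<Rightarrow> real^'b^'b"
  where "tr2 M = (\<chi> i j. trace (block M i j))"

definition kron_spd :: "(real^('b::finite \<times> 'a::finite)^('b \<times> 'a)) set"
  where "kron_spd = {kron \<Sigma>2 \<Sigma>1 | \<Sigma>2 \<Sigma>1. \<Sigma>2 \<in> spd_mats \<and> \<Sigma>1 \<in> spd_mats}"

definition kron_objective ::
    "real^('b::finite \<times> 'a::finite)^('b \<times> 'a) \<Rightarrow> real^'b^'b \<Rightarrow> real^'a^'a \<Rightarrow> real"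
  where "kron_objective \<Sigma> K2 K1 =
    trace (\<Sigma> ** matrix_inv (kron K2 K1))
      + real CARD('a) * ln (det K2) + real CARD('b) * ln (det K1)"

text \<open>
  The minimizer is unique as a matrix \<open>kron K2 K1\<close>; the pair \<open>(K2, K1)\<close> is determined only
  up to reciprocal positive scaling.
\<close>

definition kron_map ::
    "real^('b::finite \<times> 'a::finite)^('b \<times> 'a) \<Rightarrow> real^('b \<times> 'a)^('b \<times> 'a)"
  where "kron_map \<Sigma> =
    (THE K. \<exists>K2\<in>spd_mats. \<exists>K1\<in>spd_mats. K = kron K2 K1 \<and>
       (\<forall>K2'\<in>spd_mats. \<forall>K1'\<in>spd_mats. kron_objective \<Sigma> K2 K1 \<le> kron_objective \<Sigma> K2' K1'))"

definition core_mats :: "(real^('b::finite \<times> 'a::finite)^('b \<times> 'a)) set"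
  where "core_mats = {C \<in> spd_mats. kron_map C = mat 1}"

definition core_map ::
    "(real^('b::finite \<times> 'a::finite)^('b \<times> 'a) \<Rightarrow> real^('b \<times> 'a)^('b \<times> 'a))
      \<Rightarrow> real^('b \<times> 'a)^('b \<times> 'a) \<Rightarrow> real^('b \<times> 'a)^('b \<times> 'a)"
  where "core_map h \<Sigma> =
    matrix_inv (h (kron_map \<Sigma>)) ** \<Sigma> ** transpose (matrix_inv (h (kron_map \<Sigma>)))"

definition tangent_pairs :: "real^'a^'a \<Rightarrow> ((real^'a^'a) \<times> (real^'b^'b)) set"
  where "tangent_pairs \<Sigma>1 =
    {(U1, U2). U1 \<in> sym_mats \<and> U2 \<in> sym_mats \<and> trace (matrix_inv \<Sigma>1 ** U1) = 0}"

text \<open>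
  \<open>R_op\<close> is built from the symmetric square roots of the factors. Accordingly the equation
  characterizing the differential of \<open>kron_map\<close> at \<open>\<Sigma>\<close> holds with \<open>C = core_map sym_sqrt \<Sigma>\<close>;
  the Cholesky core is an orthogonal conjugate of this matrix and in general does not satisfy it.
\<close>

definition R_op ::
    "real^'a^'a \<Rightarrow> real^'b^'b \<Rightarrow> real^('b::finite \<times> 'a::finite)^('b \<times> 'a)
      \<Rightarrow> (real^'a^'a) \<times> (real^'b^'b) \<Rightarrow> (real^'a^'a) \<times> (real^'b^'b)"
  where "R_op \<Sigma>1 \<Sigma>2 C = (\<lambda>(U1, U2).
    let H1 = sym_sqrt \<Sigma>1; H2 = sym_sqrt \<Sigma>2;
        A1 = matrix_inv H1 ** U1 ** matrix_inv H1;
        A2 = matrix_inv H2 ** U2 ** matrix_inv H2;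
        M1 = (\<Sum>i\<in>UNIV. \<Sum>j\<in>UNIV. (A2 $ i $ j) *\<^sub>R block C j i);
        M2 = (\<chi> i j. trace (block C i j ** A1))
    in (U1 + (1 / real CARD('b)) *\<^sub>R (H1 ** M1 ** H1)
           - ((1 / real CARD('b)) * trace A2) *\<^sub>R \<Sigma>1,
        U2 + (1 / real CARD('a)) *\<^sub>R (H2 ** M2 ** H2)))"

text \<open>
  On an open set of a finite-dimensional space, \<open>Ck_on n\<close> is continuous differentiability
  of order \<open>n\<close>.
\<close>

primrec Ck_on :: "nat \<Rightarrow> 'v::euclidean_space set \<Rightarrow> ('v \<Rightarrow> 'w::euclidean_space) \<Rightarrow> bool"
  where
    "Ck_on 0 S f \<longleftrightarrow> continuous_on S f"
  | "Ck_on (Suc n) S f \<longleftrightarrow>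
      (\<forall>x\<in>S. f differentiable (at x)) \<and>
      (\<forall>v. Ck_on n S (\<lambda>x. frechet_derivative f (at x) v))"

text \<open>
  A map on a subset of a Euclidean space is smooth if it has, locally around each point
  of the subset, a smooth extension to an open set of the ambient space. For an embedded
  submanifold this is smoothness in charts.
\<close>

definition smooth_map_on :: "'v::euclidean_space set \<Rightarrow> ('v \<Rightarrow> 'w::euclidean_space) \<Rightarrow> bool"
  where "smooth_map_on M f \<longleftrightarrow>
    (\<forall>x\<in>M. \<exists>U F. open U \<and> x \<in> U \<and> (\<forall>n. Ck_on n U F) \<and> (\<forall>y\<in>U \<inter> M. F y = f y))"

definition diffeomorphism ::
    "'v::euclidean_space set \<Rightarrow> 'w::euclidean_space set \<Rightarrow> ('v \<Rightarrow> 'w) \<Rightarrow> ('w \<Rightarrow> 'v) \<Rightarrow> bool"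
  where "diffeomorphism M N f g \<longleftrightarrow>
    f ` M \<subseteq> N \<and> g ` N \<subseteq> M \<and> (\<forall>x\<in>M. g (f x) = x) \<and> (\<forall>y\<in>N. f (g y) = y) \<and>
    smooth_map_on M f \<and> smooth_map_on N g"

text \<open>
  The differential of \<open>f\<close> at a point \<open>x\<close> of an embedded submanifold \<open>M\<close>. If \<open>f\<close> is
  differentiable within \<open>M\<close>, any two derivatives within \<open>M\<close> agree on the tangent space of
  \<open>M\<close> at \<open>x\<close>, so the value is determined for tangent vectors \<open>v\<close>, and for those only.
\<close>

definition differential ::
    "'v::euclidean_space set \<Rightarrow> ('v \<Rightarrow> 'w::euclidean_space) \<Rightarrow> 'v \<Rightarrow> 'v \<Rightarrow> 'w"
  where "differential M f x v = frechet_derivative f (at x within M) v"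

end

theory Submission
  imports Defs
begin

text \<open>
  With the factors diagonalized, the Kronecker objective becomes a positive combination of
  exponentials minus a linear function. This shows that a stationary point is the unique
  minimizer; existence comes from compactness after optimizing over the overall scale. Hence the
  Kronecker map is equivariant under \<open>\<Sigma> \<mapsto> A \<Sigma> A\<^sup>T\<close> for Kronecker products \<open>A\<close>, and \<open>C\<close> is a core
  matrix iff \<open>tr1 C\<close> and \<open>tr2 C\<close> are the right multiples of the identity. By equivariance,
  smoothness and the derivative need only be found at a core matrix \<open>C\<close>. There the implicit
  function theorem applies to the stationarity equations: pairing a solution \<open>(E1, E2)\<close> of the
  linearized equations with itself gives \<open>trace (C X X) = 0\<close> for \<open>X = E2 \<otimes> I + I \<otimes> E1\<close>, so \<open>X = 0\<close>.
  The same computation makes the operator \<open>R_op\<close> injective.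

  In the last part of the theorem the differential of \<open>h\<close> is never computed: if the core is the
  identity, only the symmetric combination of \<open>dh\<close> with its transpose enters, and this is
  the derivative of \<open>h(K) h(K)\<^sup>T = K\<close>.
\<close>

section \<open>Calculus of \<open>C\<^sup>k\<close> maps\<close>

text \<open>\<open>Ck_on\<close> differentiates on open sets of the full matrix space, whereas
  positive definite matrices are open only among the symmetric ones. The defining equations are
  therefore extended to all square matrices: a linear projection onto the symmetric or lower
  triangular part is inserted, and the complementary part of the unknown is added. The extended
  equation splits into the original one and a constraint placing the unknown in the right subspace,
  and it has as many equations as unknowns, as the inverse and implicit function theorems demand.
  For the same reason a derivative within \<open>spd_mats\<close> is not unique; straight lines that
  stay in the set pin it down on symmetric directions.

  The equation for the differential of \<open>kron_map\<close> uses the symmetric root whichever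
  \<open>h\<close> is chosen, so \<open>R_op\<close> is treated for an arbitrary core matrix. Up to
  the explicit formulas at an identity core, \<open>h\<close> enters only through smoothness,
  \<open>h(K) h(K)^T = K\<close> and the fact that \<open>h(K)\<close> is again a Kronecker product;
  for the Cholesky factor the last property comes from the lexicographic order.\<close>

lemma Ck_on_cong:
  assumes "open S" "\<And>x. x \<in> S \<Longrightarrow> f x = g x"
  shows "Ck_on n S f \<longleftrightarrow> Ck_on n S g"
  using assms(2)
proof (induction n arbitrary: f g)
  case 0
  then show ?case by (simp cong: continuous_on_cong)
next
  case (Suc n)
  have D: "(f has_derivative D) (at x) \<longleftrightarrow> (g has_derivative D) (at x)" if "x \<in> S" for x D
    using has_derivative_transform_within_open[OF _ assms(1) that] Suc.prems by metis
  have "frechet_derivative f (at x) = frechet_derivative g (at x)" if "x \<in> S" for x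
    unfolding frechet_derivative_def using D[OF that] by simp
  then show ?case
    using Suc.IH[of "\<lambda>x. frechet_derivative f (at x) v" "\<lambda>x. frechet_derivative g (at x) v" for v]
    by (simp add: differentiable_def D cong: ball_cong)
qed

text \<open>Trades \<open>frechet_derivative\<close> for an arbitrary family of derivatives, the
  form in which differentiation rules deliver them.\<close>

lemma Ck_on_Suc_iff:
  assumes "open S"
  shows "Ck_on (Suc n) S f \<longleftrightarrow>
    (\<exists>f'. (\<forall>x\<in>S. (f has_derivative f' x) (at x)) \<and> (\<forall>v. Ck_on n S (\<lambda>x. f' x v)))"
proof
  assume "Ck_on (Suc n) S f"
  then show "\<exists>f'. (\<forall>x\<in>S. (f has_derivative f' x) (at x)) \<and> (\<forall>v. Ck_on n S (\<lambda>x. f' x v))"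
    by (intro exI[of _ "\<lambda>x. frechet_derivative f (at x)"]) (simp add: frechet_derivative_works[symmetric])
next
  assume "\<exists>f'. (\<forall>x\<in>S. (f has_derivative f' x) (at x)) \<and> (\<forall>v. Ck_on n S (\<lambda>x. f' x v))"
  then obtain f' where f': "\<And>x. x \<in> S \<Longrightarrow> (f has_derivative f' x) (at x)"
    and C: "\<And>v. Ck_on n S (\<lambda>x. f' x v)" by auto
  have "Ck_on n S (\<lambda>x. frechet_derivative f (at x) v)" for v
    using C[of v] by (rule Ck_on_cong[THEN iffD1, OF assms, rotated]) (simp add: frechet_derivative_at[OF f', symmetric])
  then show "Ck_on (Suc n) S f" using f' by (auto simp: differentiable_def)
qed

lemma Ck_on_SucI:
  assumes "open S" "\<And>x. x \<in> S \<Longrightarrow> (f has_derivative f' x) (at x)" "\<And>v. Ck_on n S (\<lambda>x. f' x v)"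
  shows "Ck_on (Suc n) S f"
  unfolding Ck_on_Suc_iff[OF assms(1)] using assms by blast

lemma Ck_on_SucE:
  assumes "Ck_on (Suc n) S f" "open S"
  obtains f' where "\<And>x. x \<in> S \<Longrightarrow> (f has_derivative f' x) (at x)" "\<And>v. Ck_on n S (\<lambda>x. f' x v)"
  using assms(1) unfolding Ck_on_Suc_iff[OF assms(2)] using that by blast

lemma Ck_on_continuous_on:
  assumes "Ck_on n S f"
  shows "continuous_on S f"
  using assms by (cases n) (auto intro!: continuous_at_imp_continuous_on differentiable_imp_continuous_within)

lemma Ck_on_Suc_imp:
  "Ck_on (Suc n) S f \<Longrightarrow> Ck_on n S f"
proof (induction n arbitrary: f)
  case 0
  then show ?case using Ck_on_continuous_on[of "Suc 0" S f] by simp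
qed simp

lemma Ck_on_subset:
  assumes "Ck_on n S f" "T \<subseteq> S"
  shows "Ck_on n T f"
  using assms(1)
proof (induction n arbitrary: f)
  case 0
  then show ?case using assms(2) continuous_on_subset by auto
qed (use assms(2) in auto)

lemma Ck_on_const: "open S \<Longrightarrow> Ck_on n S (\<lambda>x. c)"
proof (induction n arbitrary: c)
  case (Suc n)
  show ?case
    by (rule Ck_on_SucI[where f' = "\<lambda>x v. 0"]) (use Suc in auto)
qed simp

lemma Ck_on_bounded_linear:
  assumes "open S" "bounded_linear f"
  shows "Ck_on n S f"
proof (cases n)
  case 0
  then show ?thesis using assms by (simp add: linear_continuous_on)
next
  case (Suc k)
  show ?thesis unfolding Suc
    by (rule Ck_on_SucI[OF assms(1), where f' = "\<lambda>x. f"])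
      (use assms Ck_on_const in \<open>auto intro: bounded_linear_imp_has_derivative\<close>)
qed

lemma Ck_on_Pair:
  assumes "open S" "Ck_on n S f" "Ck_on n S g"
  shows "Ck_on n S (\<lambda>x. (f x, g x))"
  using assms(2,3)
proof (induction n arbitrary: f g)
  case 0
  then show ?case by (auto intro!: continuous_intros)
next
  case (Suc n)
  obtain f' where f': "\<And>x. x \<in> S \<Longrightarrow> (f has_derivative f' x) (at x)" "\<And>v. Ck_on n S (\<lambda>x. f' x v)"
    using Suc.prems(1) assms(1) by (rule Ck_on_SucE) blast
  obtain g' where g': "\<And>x. x \<in> S \<Longrightarrow> (g has_derivative g' x) (at x)" "\<And>v. Ck_on n S (\<lambda>x. g' x v)"
    using Suc.prems(2) assms(1) by (rule Ck_on_SucE) blast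
  show ?case
    by (rule Ck_on_SucI[OF assms(1), where f' = "\<lambda>x v. (f' x v, g' x v)"])
       (use f' g' Suc.IH in \<open>auto intro!: has_derivative_Pair\<close>)
qed

lemma Ck_on_add:
  assumes "open S" "Ck_on n S f" "Ck_on n S g"
  shows "Ck_on n S (\<lambda>x. f x + g x)"
  using assms(2,3)
proof (induction n arbitrary: f g)
  case 0
  then show ?case by (auto intro!: continuous_intros)
next
  case (Suc n)
  obtain f' where f': "\<And>x. x \<in> S \<Longrightarrow> (f has_derivative f' x) (at x)" "\<And>v. Ck_on n S (\<lambda>x. f' x v)"
    using Suc.prems(1) assms(1) by (rule Ck_on_SucE) blast
  obtain g' where g': "\<And>x. x \<in> S \<Longrightarrow> (g has_derivative g' x) (at x)" "\<And>v. Ck_on n S (\<lambda>x. g' x v)"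
    using Suc.prems(2) assms(1) by (rule Ck_on_SucE) blast
  show ?case
    by (rule Ck_on_SucI[OF assms(1), where f' = "\<lambda>x v. f' x v + g' x v"])
       (use f' g' Suc.IH in \<open>auto intro!: has_derivative_add\<close>)
qed

lemma Ck_on_sum:
  assumes "open S" "\<And>i. i \<in> I \<Longrightarrow> Ck_on n S (f i)"
  shows "Ck_on n S (\<lambda>x. \<Sum>i\<in>I. f i x)"
  using assms(2)
  by (induction I rule: infinite_finite_induct) (auto intro!: Ck_on_add Ck_on_const assms(1))

lemma Ck_on_bilinear:
  assumes "open S" "bounded_bilinear prd" "Ck_on n S f" "Ck_on n S g"
  shows "Ck_on n S (\<lambda>x. prd (f x) (g x))"
  using assms(3,4)
proof (induction n arbitrary: f g)
  case 0
  then show ?case using bounded_bilinear.continuous_on[OF assms(2)] by auto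
next
  case (Suc n)
  obtain f' where f': "\<And>x. x \<in> S \<Longrightarrow> (f has_derivative f' x) (at x)" "\<And>v. Ck_on n S (\<lambda>x. f' x v)"
    using Suc.prems(1) assms(1) by (rule Ck_on_SucE) blast
  obtain g' where g': "\<And>x. x \<in> S \<Longrightarrow> (g has_derivative g' x) (at x)" "\<And>v. Ck_on n S (\<lambda>x. g' x v)"
    using Suc.prems(2) assms(1) by (rule Ck_on_SucE) blast
  show ?case
  proof (rule Ck_on_SucI[OF assms(1)])
    show "((\<lambda>x. prd (f x) (g x)) has_derivative (\<lambda>v. prd (f x) (g' x v) + prd (f' x v) (g x))) (at x)"
      if "x \<in> S" for x
      using bounded_bilinear.FDERIV[OF assms(2) f'(1)[OF that] g'(1)[OF that]] .
    show "Ck_on n S (\<lambda>x. prd (f x) (g' x v) + prd (f' x v) (g x))" for v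
      by (intro Ck_on_add Suc.IH assms(1) f' g' Suc.prems[THEN Ck_on_Suc_imp])
  qed
qed

text \<open>A fixed direction \<open>v\<close> does not stay fixed under the chain rule:
  \<open>g'\<close> is evaluated in the moving direction \<open>f' x v\<close>. Expanding that
  direction in the basis leaves only derivatives of \<open>g\<close> along fixed vectors, to which
  the induction hypothesis applies.\<close>

lemma Ck_on_compose:
  fixes f :: "'a::euclidean_space \<Rightarrow> 'b::euclidean_space" and g :: "'b \<Rightarrow> 'c::euclidean_space"
  assumes "open S" "open T" "Ck_on n S f" "Ck_on n T g" "f ` S \<subseteq> T"
  shows "Ck_on n S (\<lambda>x. g (f x))"
  using assms(3,4)
proof (induction n arbitrary: g)
  case 0
  then show ?case using continuous_on_compose2[of T g S f] assms(5) by auto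
next
  case (Suc n)
  obtain f' where f': "\<And>x. x \<in> S \<Longrightarrow> (f has_derivative f' x) (at x)" "\<And>v. Ck_on n S (\<lambda>x. f' x v)"
    using Suc.prems(1) assms(1) by (rule Ck_on_SucE) blast
  obtain g' where g': "\<And>x. x \<in> T \<Longrightarrow> (g has_derivative g' x) (at x)" "\<And>v. Ck_on n T (\<lambda>x. g' x v)"
    using Suc.prems(2) assms(2) by (rule Ck_on_SucE) blast
  have fT: "f x \<in> T" if "x \<in> S" for x using assms(5) that by auto
  show ?case
  proof (rule Ck_on_SucI[OF assms(1)])
    show "((\<lambda>x. g (f x)) has_derivative (\<lambda>v. g' (f x) (f' x v))) (at x)" if "x \<in> S" for x
      by (rule has_derivative_compose[OF f'(1) g'(1)]) (use that fT in auto)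
    have *: "g' (f x) (f' x v) = (\<Sum>b\<in>Basis. (f' x v \<bullet> b) *\<^sub>R g' (f x) b)" if "x \<in> S" for x v
    proof -
      have "linear (g' (f x))" using g'(1)[OF fT[OF that]] has_derivative_linear by blast
      then have "g' (f x) (\<Sum>b\<in>Basis. (f' x v \<bullet> b) *\<^sub>R b) = (\<Sum>b\<in>Basis. (f' x v \<bullet> b) *\<^sub>R g' (f x) b)"
        by (simp add: linear_sum linear_scale)
      then show ?thesis by (simp add: euclidean_representation)
    qed
    have "Ck_on n S (\<lambda>x. \<Sum>b\<in>Basis. (f' x v \<bullet> b) *\<^sub>R g' (f x) b)" for v
      by (intro Ck_on_sum Ck_on_bilinear[OF _ bounded_bilinear_scaleR]
          Ck_on_bilinear[OF _ bounded_bilinear_inner] assms f' Ck_on_const Suc.IH g' Suc.prems(1)[THEN Ck_on_Suc_imp])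
    then show "Ck_on n S (\<lambda>x. g' (f x) (f' x v))" for v
      using Ck_on_cong[OF assms(1), of "\<lambda>x. g' (f x) (f' x v)" "\<lambda>x. \<Sum>b\<in>Basis. (f' x v \<bullet> b) *\<^sub>R g' (f x) b" n] * by simp
  qed
qed

lemma Ck_on_linear_comp:
  assumes "open S" "bounded_linear L" "Ck_on n S f"
  shows "Ck_on n S (\<lambda>x. L (f x))"
  using Ck_on_compose[OF assms(1) open_UNIV assms(3) Ck_on_bounded_linear[OF open_UNIV assms(2)]] by simp

section \<open>Linear equations with smoothly varying coefficients\<close>

lemma has_derivative_scaleR_vanishing:
  fixes f :: "'a::real_normed_vector \<Rightarrow> real" and g :: "'a \<Rightarrow> 'b::real_normed_vector"
  assumes f: "(f \<longlongrightarrow> 0) (at x)" and g: "(g has_derivative g') (at x)" "g x = 0"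
  shows "((\<lambda>y. f y *\<^sub>R g y) has_derivative (\<lambda>v. 0)) (at x)"
proof -
  obtain K where K: "\<And>v. norm (g' v) \<le> norm v * K"
    using bounded_linear.bounded[OF has_derivative_bounded_linear[OF g(1)]] by blast
  have r: "((\<lambda>y. norm (g y - g x - g' (y - x)) / norm (y - x)) \<longlongrightarrow> 0) (at x)"
    using g(1) unfolding has_derivative_iff_norm by blast
  have "((\<lambda>y. \<bar>f y\<bar> * (K + norm (g y - g x - g' (y - x)) / norm (y - x))) \<longlongrightarrow> 0 * (K + 0)) (at x)"
    by (intro tendsto_intros r tendsto_rabs_zero f)
  then have lim: "((\<lambda>y. \<bar>f y\<bar> * (K + norm (g y - g x - g' (y - x)) / norm (y - x))) \<longlongrightarrow> 0) (at x)"
    by simp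
  \<comment> \<open>The difference quotient of \<open>g\<close> stays bounded, so a factor
    \<open>f\<close> that merely tends to 0, without being differentiable, still makes the
    derivative vanish.\<close>
  have "norm (g y) / norm (y - x) \<le> K + norm (g y - g x - g' (y - x)) / norm (y - x)" if "y \<noteq> x" for y
  proof -
    have "norm (g y) \<le> norm (g y - g' (y - x)) + norm (g' (y - x))"
      using norm_triangle_sub[of "g y" "g' (y - x)"] by (simp add: algebra_simps)
    also have "\<dots> \<le> norm (g y - g' (y - x)) + norm (y - x) * K" using K by simp
    finally show ?thesis using that g(2) by (simp add: field_simps)
  qed
  then have "\<forall>\<^sub>F y in at x. norm (norm (f y *\<^sub>R g y - f x *\<^sub>R g x - 0) / norm (y - x))
      \<le> \<bar>f y\<bar> * (K + norm (g y - g x - g' (y - x)) / norm (y - x))"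
    unfolding eventually_at_filter using g(2)
    by (auto intro!: always_eventually simp flip: times_divide_eq_right intro: mult_left_mono)
  then show ?thesis unfolding has_derivative_iff_norm
    using tendsto_0_le[OF lim, where K=1] by (simp add: Lim_null_comparison[OF _ lim])
qed

lemma linear_eq_sum_Basis:
  assumes "linear f"
  shows "f x = (\<Sum>b\<in>Basis. (x \<bullet> b) *\<^sub>R f b)"
proof -
  have "f (\<Sum>b\<in>Basis. (x \<bullet> b) *\<^sub>R b) = (\<Sum>b\<in>Basis. (x \<bullet> b) *\<^sub>R f b)"
    using assms by (simp add: linear_sum linear_scale)
  then show ?thesis by (simp add: euclidean_representation)
qed

text \<open>Injectivity at \<open>x0\<close> gives a lower bound \<open>c\<close> for
  \<open>A x0\<close>, and near \<open>x0\<close> the coefficients move by less than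
  \<open>c / 2\<close>. The error \<open>w x - w x0\<close> is then controlled by the residual
  \<open>b x - A x (w x0)\<close>, which tends to 0; no inverse of \<open>A x\<close> is
  formed.\<close>

lemma isCont_linear_solution:
  fixes A :: "'x::euclidean_space \<Rightarrow> 'y::euclidean_space \<Rightarrow> 'z::euclidean_space"
  assumes S: "open S" "x0 \<in> S"
    and lin: "\<And>x. x \<in> S \<Longrightarrow> linear (A x)" and inj: "inj (A x0)"
    and A: "\<And>e. continuous_on S (\<lambda>x. A x e)" and b: "continuous_on S b"
    and w: "\<And>x. x \<in> S \<Longrightarrow> A x (w x) = b x"
  shows "isCont w x0"
proof -
  obtain c where c: "c > 0" "\<And>e. c * norm e \<le> norm (A x0 e)"
    using linear_inj_bounded_below_pos[OF lin[OF S(2)] inj] by metis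
  define \<delta> where "\<delta> x = (\<Sum>b\<in>Basis. norm (A x b - A x0 b))" for x
  have at: "(f \<longlongrightarrow> f x0) (at x0)" if "continuous_on S f" for f :: "'x \<Rightarrow> 'z"
    using that S by (meson continuous_on_eq_continuous_at isCont_def)
  have "(\<delta> \<longlongrightarrow> (\<Sum>b\<in>Basis. norm (A x0 (b::'y) - A x0 b))) (at x0)"
    unfolding \<delta>_def by (intro tendsto_intros at A)
  then have "(\<delta> \<longlongrightarrow> 0) (at x0)" by simp
  then have ev\<delta>: "\<forall>\<^sub>F x in at x0. \<delta> x < c / 2"
    using c(1) order_tendstoD(2) half_gt_zero by blast
  have evS: "\<forall>\<^sub>F x in at x0. x \<in> S" using S eventually_at_in_open' by blast
  have \<delta>: "norm (A x e - A x0 e) \<le> \<delta> x * norm e" if "x \<in> S" for x e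
  proof -
    have "linear (\<lambda>e. A x e - A x0 e)" using lin that S(2) by (intro linear_compose_sub)
    from linear_eq_sum_Basis[OF this, of e]
    have "norm (A x e - A x0 e) = norm (\<Sum>b\<in>Basis. (e \<bullet> b) *\<^sub>R (A x b - A x0 b))" by simp
    also have "\<dots> \<le> (\<Sum>b\<in>Basis. norm e * norm (A x b - A x0 b))"
      by (rule sum_norm_le) (simp add: Basis_le_norm mult_right_mono)
    finally show ?thesis unfolding \<delta>_def by (simp add: sum_distrib_left mult.commute)
  qed
  have "((\<lambda>x. (2 / c) * norm (b x - A x (w x0))) \<longlongrightarrow> (2/c) * norm (b x0 - A x0 (w x0))) (at x0)"
    by (intro tendsto_intros at A b)
  then have lim: "((\<lambda>x. (2 / c) * norm (b x - A x (w x0))) \<longlongrightarrow> 0) (at x0)"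
    using w S by simp
  have "\<forall>\<^sub>F x in at x0. norm (w x - w x0) \<le> (2 / c) * norm (b x - A x (w x0))"
    using ev\<delta> evS
  proof eventually_elim
    case (elim x)
    let ?e = "w x - w x0"
    have Ae: "A x ?e = b x - A x (w x0)" using w lin elim by (simp add: linear_diff)
    have "c * norm ?e \<le> norm (A x0 ?e)" using c by simp
    also have "\<dots> \<le> norm (A x ?e) + norm (A x ?e - A x0 ?e)"
      using norm_triangle_sub[of "A x0 ?e" "A x ?e"] by (simp add: norm_minus_commute)
    also have "\<dots> \<le> norm (A x ?e) + (c / 2) * norm ?e"
      using \<delta>[OF elim(2), of ?e] elim(1) mult_right_mono[of "\<delta> x" "c / 2" "norm ?e"] by simp
    finally have "c * norm ?e \<le> 2 * norm (A x ?e)" by simp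
    then show ?case using c Ae by (simp add: field_simps)
  qed
  then have "((\<lambda>x. w x - w x0) \<longlongrightarrow> 0) (at x0)" by (rule Lim_null_comparison[OF _ lim])
  then show ?thesis unfolding isCont_def by (simp add: LIM_zero_cancel)
qed

text \<open>Differentiating the equation shows that \<open>w' x v\<close> solves a system with the
  same coefficients, whose right-hand side is built from \<open>w\<close> and first derivatives of
  the data; so the order can be raised by induction. Matrix inversion and the derivative of an
  inverse function are both instances.\<close>

lemma Ck_on_linear_solution:
  fixes A :: "'x::euclidean_space \<Rightarrow> 'y::euclidean_space \<Rightarrow> 'z::euclidean_space"
  assumes S: "open S"
    and lin: "\<And>x. x \<in> S \<Longrightarrow> linear (A x)" and inj: "\<And>x. x \<in> S \<Longrightarrow> inj (A x)"
    and A: "\<And>e. Ck_on n S (\<lambda>x. A x e)" and b: "Ck_on n S b"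
    and w: "\<And>x. x \<in> S \<Longrightarrow> A x (w x) = b x"
  shows "Ck_on n S w"
  using A b w
proof (induction n arbitrary: b w)
  case 0
  have "isCont w x0" if "x0 \<in> S" for x0
    by (rule isCont_linear_solution[OF S that lin inj, where b = b]) (use 0 that in auto)
  then show ?case by (simp add: S continuous_on_eq_continuous_at)
next
  case (Suc n)
  have Cw: "Ck_on n S w" by (rule Suc.IH[where b = b]) (use Suc.prems Ck_on_Suc_imp in blast)+
  have "\<exists>A'. (\<forall>x\<in>S. ((\<lambda>x. A x e) has_derivative A' x) (at x)) \<and> (\<forall>v. Ck_on n S (\<lambda>x. A' x v))" for e
    using Suc.prems(1)[of e] Ck_on_Suc_iff[OF S] by blast
  then obtain A' where A': "\<And>x e. x \<in> S \<Longrightarrow> ((\<lambda>x. A x e) has_derivative A' e x) (at x)"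
    "\<And>v e. Ck_on n S (\<lambda>x. A' e x v)"
    by metis
  obtain b' where b': "\<And>x. x \<in> S \<Longrightarrow> (b has_derivative b' x) (at x)" "\<And>v. Ck_on n S (\<lambda>x. b' x v)"
    using Suc.prems(2) S by (rule Ck_on_SucE) blast
  have "w differentiable (at x0)" if x0: "x0 \<in> S" for x0
  proof -
    obtain L where L: "linear L" "\<And>e. L (A x0 e) = e"
      using linear_injective_left_inverse[OF lin[OF x0] inj[OF x0]] by (auto simp: o_def fun_eq_iff)
    note bL = L(1)[unfolded linear_conv_bounded_linear]
    define e where "e x = w x - w x0" for x
    have "isCont w x0"
      by (rule isCont_linear_solution[OF S x0 lin inj, where b = b])
        (use Suc.prems Ck_on_continuous_on x0 in blast)+
    then have e0: "(e \<longlongrightarrow> 0) (at x0)" unfolding e_def isCont_def by (simp add: LIM_zero)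
    \<comment> \<open>Applying the left inverse \<open>L\<close> of \<open>A x0\<close> expresses
      the increment \<open>e\<close> through itself. The terms containing \<open>e\<close> are
      products of two factors vanishing at \<open>x0\<close>, hence have derivative 0 although only
      continuity of \<open>e\<close> is known so far.\<close>
    have ex: "L (b x - A x (w x0)) - (\<Sum>i\<in>Basis. (e x \<bullet> i) *\<^sub>R L (A x i - A x0 i)) = e x" if "x \<in> S" for x
    proof -
      have l: "linear (\<lambda>z. L (A x z - A x0 z))"
        using linear_compose[OF linear_compose_sub[OF lin[OF that] lin[OF x0]] L(1)] by (simp add: o_def)
      have "(\<Sum>i\<in>Basis. (e x \<bullet> i) *\<^sub>R L (A x i - A x0 i)) = L (A x (e x) - A x0 (e x))"
        using linear_eq_sum_Basis[OF l, of "e x"] by simp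
      also have "\<dots> = L (b x - A x (w x0)) - e x"
        using L Suc.prems(3)[OF that] lin[OF that] by (simp add: e_def linear_diff)
      finally show ?thesis by simp
    qed
    have "((\<lambda>x. (e x \<bullet> i) *\<^sub>R L (A x i - A x0 i)) has_derivative (\<lambda>v. 0)) (at x0)" for i
    proof (rule has_derivative_scaleR_vanishing)
      show "((\<lambda>x. e x \<bullet> i) \<longlongrightarrow> 0) (at x0)" using tendsto_inner[OF e0 tendsto_const[of i]] by simp
      show "((\<lambda>x. L (A x i - A x0 i)) has_derivative (\<lambda>v. L (A' i x0 v - 0))) (at x0)"
        by (rule bounded_linear.has_derivative[OF bL]) (intro has_derivative_diff has_derivative_const A' x0)
    qed (simp add: linear_0 L(1))
    then have "((\<lambda>x. L (b x - A x (w x0)) - (\<Sum>i\<in>Basis. (e x \<bullet> i) *\<^sub>R L (A x i - A x0 i)))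
       has_derivative (\<lambda>v. L (b' x0 v - A' (w x0) x0 v) - (\<Sum>i\<in>(Basis::'y set). 0))) (at x0)"
      by (intro has_derivative_diff has_derivative_sum bounded_linear.has_derivative[OF bL] b' A' x0)
    then have "(e has_derivative (\<lambda>v. L (b' x0 v - A' (w x0) x0 v) - (\<Sum>i\<in>(Basis::'y set). 0))) (at x0)"
      by (rule has_derivative_transform_within_open[OF _ S x0 ex])
    then have "((\<lambda>x. e x + w x0) has_derivative (\<lambda>v. (L (b' x0 v - A' (w x0) x0 v) - (\<Sum>i\<in>(Basis::'y set). 0)) + 0)) (at x0)"
      by (intro has_derivative_add has_derivative_const)
    then show ?thesis unfolding e_def differentiable_def by auto
  qed
  then have "\<forall>x\<in>S. \<exists>w'. (w has_derivative w') (at x)" unfolding differentiable_def by blast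
  then obtain w' where w': "\<And>x. x \<in> S \<Longrightarrow> (w has_derivative w' x) (at x)" by metis
  show ?case
  proof (rule Ck_on_SucI[OF S w'])
    fix v
    \<comment> \<open>The right-hand side left over when \<open>A x (w x) = b x\<close> is
      differentiated in direction \<open>v\<close>.\<close>
    define r where "r x = b' x v - (\<Sum>i\<in>Basis. (w x \<bullet> i) *\<^sub>R A' i x v)" for x
    show "Ck_on n S (\<lambda>x. w' x v)"
    proof (rule Suc.IH[where b = r])
      have "Ck_on n S (\<lambda>x. b' x v + (- 1) *\<^sub>R (\<Sum>i\<in>Basis. (w x \<bullet> i) *\<^sub>R A' i x v))"
        by (intro Ck_on_add Ck_on_sum Ck_on_bilinear[OF _ bounded_bilinear_scaleR]
          Ck_on_bilinear[OF _ bounded_bilinear_inner] S b' A' Ck_on_const Cw)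
      then show "Ck_on n S r" unfolding r_def by simp
      show "Ck_on n S (\<lambda>x. A x e)" for e using Suc.prems(1) Ck_on_Suc_imp by blast
      fix x assume x: "x \<in> S"
      have eq: "(\<Sum>i\<in>Basis. (w x \<bullet> i) *\<^sub>R A x i) = b x" if "x \<in> S" for x
        using linear_eq_sum_Basis[OF lin[OF that], of "w x"] Suc.prems(3)[OF that] by simp
      have "((\<lambda>x. \<Sum>i\<in>Basis. (w x \<bullet> i) *\<^sub>R A x i) has_derivative
          (\<lambda>v. \<Sum>i\<in>Basis. (w x \<bullet> i) *\<^sub>R A' i x v + (w' x v \<bullet> i) *\<^sub>R A x i)) (at x)"
        by (intro has_derivative_sum has_derivative_scaleR has_derivative_inner_left w' A' x)
      then have "(b has_derivative
          (\<lambda>v. \<Sum>i\<in>Basis. (w x \<bullet> i) *\<^sub>R A' i x v + (w' x v \<bullet> i) *\<^sub>R A x i)) (at x)"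
        by (rule has_derivative_transform_within_open[OF _ S x eq])
      then have "b' x = (\<lambda>v. \<Sum>i\<in>Basis. (w x \<bullet> i) *\<^sub>R A' i x v + (w' x v \<bullet> i) *\<^sub>R A x i)"
        using b'(1)[OF x] has_derivative_unique by blast
      then show "A x (w' x v) = r x"
        using linear_eq_sum_Basis[OF lin[OF x], of "w' x v"] by (simp add: r_def sum.distrib)
    qed
  qed
qed

section \<open>Inverse and implicit functions\<close>

lemma inverse_function_smooth:
  fixes f :: "'x::euclidean_space \<Rightarrow> 'x"
  assumes W: "open W" "x0 \<in> W" and f: "\<And>n. Ck_on n W f"
    and inj: "\<And>v. frechet_derivative f (at x0) v = 0 \<Longrightarrow> v = 0"
  obtains V g where "open V" "f x0 \<in> V" "g (f x0) = x0" "g ` V \<subseteq> W" "\<And>y. y \<in> V \<Longrightarrow> f (g y) = y"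
    "\<And>n. Ck_on n V g"
proof -
  define f' where "f' x = frechet_derivative f (at x)" for x
  have f': "(f has_derivative f' x) (at x)" if "x \<in> W" for x
    using f[of 1] that by (simp add: f'_def frechet_derivative_works)
  have Cf': "Ck_on n W (\<lambda>x. f' x v)" for n v using f[of "Suc n"] by (simp add: f'_def)
  have bl: "bounded_linear (f' x)" if "x \<in> W" for x using f'[OF that] has_derivative_bounded_linear by blast
  \<comment> \<open>The C^1 inverse function theorem expects the derivative as a continuous map into
    bounded linear functions; continuity there can be checked vector by vector.\<close>
  define F where "F x = Blinfun (f' x)" for x
  have F: "blinfun_apply (F x) = f' x" if "x \<in> W" for x
    using bl[OF that] by (simp add: F_def bounded_linear_Blinfun_apply)
  have lin0: "linear (f' x0)" using bl[OF W(2)] by (rule bounded_linear.linear)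
  have "inj (f' x0)" using inj lin0 unfolding f'_def by (simp add: linear_injective_0)
  then obtain L where L: "linear L" "\<And>v. L (f' x0 v) = v"
    using linear_injective_left_inverse[OF lin0] by (auto simp: o_def fun_eq_iff)
  have LF: "Blinfun L o\<^sub>L F x0 = id_blinfun"
    by (rule blinfun_eqI) (use L W F in \<open>simp add: bounded_linear_Blinfun_apply linear_conv_bounded_linear\<close>)
  have cF: "continuous_on W F"
  proof (rule continuous_on_blinfun_componentwise)
    fix i :: 'x
    have "continuous_on W (\<lambda>x. f' x i)" using Cf'[of 0 i] by simp
    then show "continuous_on W (\<lambda>x. blinfun_apply (F x) i)" using F by (simp cong: continuous_on_cong)
  qed
  obtain U V g g' where U: "open U" "U \<subseteq> W" "x0 \<in> U" and V: "open V" "f x0 \<in> V" and hom: "homeomorphism U V f g"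
    and g': "\<And>y. y \<in> V \<Longrightarrow> (g has_derivative (g' y)) (at y)"
      "\<And>y. y \<in> V \<Longrightarrow> g' y = inv (blinfun_apply (F (g y)))"
      "\<And>y. y \<in> V \<Longrightarrow> bij (blinfun_apply (F (g y)))"
    using inverse_function_theorem[OF W(1) _ cF W(2) LF, of f] f' F by metis
  have gW: "g y \<in> W" if "y \<in> V" for y using hom U that by (auto simp: homeomorphism_def)
  \<comment> \<open>The derivative of \<open>g\<close> at \<open>y\<close> in direction
    \<open>v\<close> solves \<open>f' (g y) w = v\<close>, whose coefficients are as smooth as
    \<open>g\<close> itself, so each pass through the linear solution lemma gains one order.\<close>
  have "Ck_on n V g" for n
  proof (induction n)
    case 0
    then show ?case using hom by (simp add: homeomorphism_def)
  next
    case (Suc n)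
    show ?case
    proof (rule Ck_on_SucI[OF V(1) g'(1)])
      fix v
      show "Ck_on n V (\<lambda>y. g' y v)"
      proof (rule Ck_on_linear_solution[OF V(1), where A = "\<lambda>y. f' (g y)" and b = "\<lambda>y. v"])
        show "linear (f' (g y))" if "y \<in> V" for y using bl gW that bounded_linear.linear by blast
        show "inj (f' (g y))" if "y \<in> V" for y using g'(3)[OF that] F gW that bij_is_inj by metis
        show "Ck_on n V (\<lambda>y. f' (g y) e)" for e
          by (rule Ck_on_compose[OF V(1) W(1) Suc Cf']) (use gW in auto)
        show "f' (g y) (g' y v) = v" if "y \<in> V" for y
          using g'(2,3)[OF that] F[OF gW[OF that]] by (simp add: bij_is_surj surj_f_inv_f)
      qed (rule Ck_on_const[OF V(1)])
    qed
  qed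
  then show ?thesis
    using that[of V g] V gW hom U by (auto simp: homeomorphism_def)
qed

text \<open>The inverse function theorem for \<open>(x, y) \<mapsto> (x, G (x, y))\<close>, with the
  solution read off along the points \<open>(x, 0)\<close>. A kernel vector of the derivative of
  this map has first component 0, so injectivity in the second argument suffices.\<close>

lemma implicit_function_smooth:
  fixes G :: "'x::euclidean_space \<times> 'y::euclidean_space \<Rightarrow> 'y"
  assumes W: "open W" "(x0, y0) \<in> W" and G: "\<And>n. Ck_on n W G" and G0: "G (x0, y0) = 0"
    and inj: "\<And>e. frechet_derivative G (at (x0, y0)) (0, e) = 0 \<Longrightarrow> e = 0"
  obtains U g where "open U" "x0 \<in> U" "g x0 = y0" "\<And>n. Ck_on n U g"
    "\<And>x. x \<in> U \<Longrightarrow> (x, g x) \<in> W \<and> G (x, g x) = 0"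
proof -
  define \<Phi> where "\<Phi> p = (fst p, G p)" for p
  have C\<Phi>: "Ck_on n W \<Phi>" for n
    unfolding \<Phi>_def by (intro Ck_on_Pair W G Ck_on_bounded_linear bounded_linear_fst)
  have "(G has_derivative frechet_derivative G (at (x0, y0))) (at (x0, y0))"
    using G[of 1] W by (simp add: frechet_derivative_works)
  then have "(\<Phi> has_derivative (\<lambda>v. (fst v, frechet_derivative G (at (x0, y0)) v))) (at (x0, y0))"
    unfolding \<Phi>_def by (intro has_derivative_Pair has_derivative_fst has_derivative_ident)
  then have d\<Phi>: "frechet_derivative \<Phi> (at (x0, y0)) = (\<lambda>v. (fst v, frechet_derivative G (at (x0, y0)) v))"
    using frechet_derivative_at by metis
  obtain V g where V: "open V" "\<Phi> (x0, y0) \<in> V" "g (\<Phi> (x0, y0)) = (x0, y0)" "g ` V \<subseteq> W"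
    "\<And>y. y \<in> V \<Longrightarrow> \<Phi> (g y) = y" "\<And>n. Ck_on n V g"
  proof (rule inverse_function_smooth[OF W C\<Phi>])
    fix v assume "frechet_derivative \<Phi> (at (x0, y0)) v = 0"
    then show "v = 0" using inj[of "snd v"] by (cases v) (auto simp: d\<Phi> zero_prod_def)
  qed blast
  let ?i = "\<lambda>x::'x. (x, 0::'y)"
  define U where "U = ?i -` V"
  have bi: "bounded_linear ?i" by (intro bounded_linear_Pair bounded_linear_ident bounded_linear_zero)
  have U: "open U" unfolding U_def
    by (rule open_vimage[OF V(1)]) (intro continuous_intros)
  have "Ck_on n U (\<lambda>x. snd (g (?i x)))" for n
    by (rule Ck_on_linear_comp[OF U bounded_linear_snd],
        rule Ck_on_compose[OF U V(1) Ck_on_bounded_linear[OF U bi] V(6)]) (auto simp: U_def)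
  moreover have "(x, snd (g (x, 0))) \<in> W \<and> G (x, snd (g (x, 0))) = 0" if "x \<in> U" for x
  proof -
    have "(x, 0) \<in> V" using that U_def by auto
    then have "\<Phi> (g (x, 0)) = (x, 0)" "g (x, 0) \<in> W" using V by auto
    then show ?thesis by (cases "g (x, 0)") (auto simp: \<Phi>_def)
  qed
  moreover have "x0 \<in> U" "snd (g (x0, 0)) = y0" using V G0 by (auto simp: U_def \<Phi>_def)
  ultimately show ?thesis using that[of U "\<lambda>x. snd (g (?i x))"] U by simp
qed

section \<open>Matrix algebra\<close>

lemma bounded_bilinear_matrix_mult:
  "bounded_bilinear ((**) :: real^'m^'n \<Rightarrow> real^'k^'m \<Rightarrow> real^'k^'n)"
  unfolding bilinear_conv_bounded_bilinear[symmetric] bilinear_def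
  by (intro conjI allI linearI)
     (simp_all add: matrix_matrix_mult_def vec_eq_iff algebra_simps sum.distrib sum_distrib_left)

interpretation matrix_mult: bounded_bilinear "(**) :: real^'m^'n \<Rightarrow> real^'k^'m \<Rightarrow> real^'k^'n"
  by (rule bounded_bilinear_matrix_mult)

lemma bounded_linear_transpose: "bounded_linear (transpose :: real^'n^'m \<Rightarrow> real^'m^'n)"
  unfolding linear_conv_bounded_linear[symmetric]
  by (intro linearI) (simp_all add: transpose_def vec_eq_iff)

lemma bounded_linear_trace: "bounded_linear (trace :: real^'n^'n \<Rightarrow> real)"
  unfolding linear_conv_bounded_linear[symmetric]
  by (intro linearI) (simp_all add: trace_def sum.distrib sum_distrib_left)

lemmas linear_transpose = bounded_linear.linear[OF bounded_linear_transpose]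
lemmas transpose_add = linear_add[OF linear_transpose]
lemmas transpose_diff = linear_diff[OF linear_transpose]
lemmas transpose_zero = linear_0[OF linear_transpose]
lemmas linear_trace = bounded_linear.linear[OF bounded_linear_trace]
lemmas trace_scaleR = linear_scale[OF linear_trace]
lemmas trace_zero = linear_0[OF linear_trace]
lemma trace_transpose: "trace (transpose A) = trace A"
  by (simp add: trace_def transpose_def)

lemma trace_mult_eq: "trace ((A::real^'n^'m) ** B) = (\<Sum>i\<in>UNIV. \<Sum>j\<in>UNIV. A $ i $ j * B $ j $ i)"
  by (simp add: trace_def matrix_matrix_mult_def)

lemma trace_mult_rotate: "trace ((A::real^'n^'m) ** B ** (C::real^'m^'k)) = trace (C ** A ** B)"
  using trace_mul_sym[of "A ** B" C] by (simp add: matrix_mul_assoc)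

lemma trace_mult_transpose: "trace ((A::real^'n^'m) ** transpose A) = A \<bullet> A"
  by (simp add: trace_mult_eq transpose_def inner_vec_def)

lemma trace_mult_transpose_eq_0_iff: "trace ((A::real^'n^'m) ** transpose A) = 0 \<longleftrightarrow> A = 0"
  by (simp add: trace_mult_transpose)

text \<open>Tested on \<open>transpose (A - A')\<close>, the pairing is the squared norm of the
  difference. Contractions against Kronecker products, which are characterized by their trace
  pairings, are identified through this lemma.\<close>

lemma trace_form_nondegenerate:
  fixes A :: "real^'n^'m"
  assumes "\<And>B. trace (A ** B) = trace (A' ** B)"
  shows "A = A'"
proof -
  have "trace ((A - A') ** transpose (A - A')) = 0"
    using assms[of "transpose (A - A')"] by (simp add: matrix_mult.diff_left trace_sub)
  then show ?thesis by (simp add: trace_mult_transpose_eq_0_iff)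
qed

lemma matrix_inv_right: "invertible A \<Longrightarrow> A ** matrix_inv A = mat 1"
  unfolding matrix_inv_def invertible_def by (rule someI2_ex) auto

lemma matrix_inv_left: "invertible A \<Longrightarrow> matrix_inv A ** A = mat 1"
  unfolding matrix_inv_def invertible_def by (rule someI2_ex) auto

lemma matrix_inv_eqI: "(A::real^'n^'n) ** B = mat 1 \<Longrightarrow> matrix_inv A = B"
  by (metis invertible_right_inverse matrix_inv_left matrix_mul_assoc matrix_mul_lid matrix_mul_rid)

lemma matrix_inv_right_cancel:
  "invertible (A::real^'n^'n) \<Longrightarrow> B ** A ** matrix_inv A = B"
  "invertible (A::real^'n^'n) \<Longrightarrow> B ** matrix_inv A ** A = B"
  by (simp_all add: matrix_mul_assoc[symmetric] matrix_inv_left matrix_inv_right)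

lemma invertible_matrix_inv: "invertible (A::real^'n^'n) \<Longrightarrow> invertible (matrix_inv A)"
  using invertible_right_inverse matrix_inv_left by blast

lemma matrix_inv_matrix_inv: "invertible (A::real^'n^'n) \<Longrightarrow> matrix_inv (matrix_inv A) = A"
  by (simp add: matrix_inv_eqI matrix_inv_left)

lemma matrix_inv_mult:
  assumes "invertible (A::real^'n^'n)" "invertible (B::real^'n^'n)"
  shows "matrix_inv (A ** B) = matrix_inv B ** matrix_inv A"
  by (rule matrix_inv_eqI) (simp add: assms matrix_mul_assoc matrix_inv_right matrix_inv_right_cancel)

lemma matrix_inv_transpose:
  assumes "invertible (A::real^'n^'n)"
  shows "matrix_inv (transpose A) = transpose (matrix_inv A)"
  by (rule matrix_inv_eqI) (simp add: assms matrix_inv_left matrix_transpose_mul[symmetric])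

lemma matrix_inv_mat_1: "matrix_inv (mat 1 :: real^'n^'n) = mat 1"
  by (simp add: matrix_inv_eqI)

lemma transpose_matrix_inv_sym:
  "invertible (A::real^'n^'n) \<Longrightarrow> transpose A = A \<Longrightarrow> transpose (matrix_inv A) = matrix_inv A"
  by (metis matrix_inv_transpose)

lemma orthogonal_matrix_mult_transpose:
  "orthogonal_matrix (Q::real^'n^'n) \<Longrightarrow> Q ** transpose Q = mat 1"
  "orthogonal_matrix (Q::real^'n^'n) \<Longrightarrow> transpose Q ** Q = mat 1"
  by (auto simp: orthogonal_matrix_def)

lemma orthogonal_matrix_invertible: "orthogonal_matrix (Q::real^'n^'n) \<Longrightarrow> invertible Q"
  unfolding orthogonal_matrix_def invertible_def by blast

lemma dot_mult_transpose: "x \<bullet> ((A::real^'n^'m) *v y) = (transpose A *v x) \<bullet> y"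
  by (simp add: dot_lmul_matrix)

section \<open>The spectral theorem\<close>

text \<open>The eigenvector maximizes the quadratic form on the unit sphere of \<open>W\<close>. If
  the residual \<open>z\<close> were nonzero, a small step from \<open>x\<close> along
  \<open>z\<close> would raise the Rayleigh quotient: the gain is of first order in the step, the
  loss of second order.\<close>

lemma eigenvector_in_invariant_subspace:
  fixes A :: "real^'n^'n"
  assumes sym: "transpose A = A" and W: "subspace W" "W \<noteq> {0}" "\<And>x. x \<in> W \<Longrightarrow> A *v x \<in> W"
  obtains x c where "x \<in> W" "norm x = 1" "A *v x = c *\<^sub>R x"
proof -
  let ?f = "\<lambda>x. x \<bullet> (A *v x)"
  obtain w where w: "w \<in> W" "w \<noteq> 0" using W subspace_0 by blast
  have "w /\<^sub>R norm w \<in> sphere 0 1 \<inter> W" using w W(1) by (simp add: subspace_scale)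
  then have ne: "sphere 0 1 \<inter> W \<noteq> {}" by blast
  have cp: "compact (sphere 0 1 \<inter> W)" using closed_subspace[OF W(1)] by (simp add: compact_Int_closed)
  have "continuous_on (sphere 0 1 \<inter> W) ?f" by (intro continuous_intros matrix_vector_mult_linear_continuous_on)
  then obtain x where x: "x \<in> W" "norm x = 1" and mx: "\<And>y. y \<in> W \<Longrightarrow> norm y = 1 \<Longrightarrow> ?f y \<le> ?f x"
    using continuous_attains_sup[OF cp ne, of ?f] by auto
  define m where "m = ?f x"
  have le: "?f y \<le> m * (y \<bullet> y)" if "y \<in> W" for y
  proof (cases "y = 0")
    case False
    have "?f (y /\<^sub>R norm y) \<le> m" using mx[of "y /\<^sub>R norm y"] that W(1) False
      by (simp add: m_def subspace_scale)
    then have "?f y / (norm y)\<^sup>2 \<le> m"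
      by (simp add: matrix_vector_mult_scaleR divide_inverse power2_eq_square mult_ac)
    then show ?thesis using False by (simp add: pos_divide_le_eq dot_square_norm)
  qed simp
  define z where "z = A *v x - m *\<^sub>R x"
  have zW: "z \<in> W" unfolding z_def using W x by (intro subspace_diff subspace_scale) auto
  have xx: "x \<bullet> x = 1" using x(2) by (simp add: norm_eq_1)
  have xz: "x \<bullet> z = 0" by (simp add: z_def inner_diff_right m_def xx)
  have zA: "z \<bullet> (A *v x) = z \<bullet> z"
  proof -
    have "A *v x = z + m *\<^sub>R x" by (simp add: z_def)
    then show ?thesis using xz by (simp add: inner_add_right inner_commute)
  qed
  have xA: "x \<bullet> (A *v z) = z \<bullet> z" using zA dot_mult_transpose[of x A z] sym by (simp add: inner_commute)
  define D where "D = m * (z \<bullet> z) - ?f z"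
  have ineq: "2 * t * (z \<bullet> z) \<le> t\<^sup>2 * D" for t
  proof -
    have 1: "?f (x + t *\<^sub>R z) = m + 2 * t * (z \<bullet> z) + t\<^sup>2 * ?f z"
      by (simp add: matrix_vector_right_distrib matrix_vector_mult_scaleR inner_add_left inner_add_right
          zA xA m_def power2_eq_square algebra_simps)
    have 2: "(x + t *\<^sub>R z) \<bullet> (x + t *\<^sub>R z) = 1 + t\<^sup>2 * (z \<bullet> z)"
      using xz by (simp add: inner_add_left inner_add_right xx inner_commute power2_eq_square algebra_simps)
    have "?f (x + t *\<^sub>R z) \<le> m * ((x + t *\<^sub>R z) \<bullet> (x + t *\<^sub>R z))"
      using le W(1) x(1) zW by (simp add: subspace_add subspace_scale)
    then have "m + 2 * t * (z \<bullet> z) + t\<^sup>2 * ?f z \<le> m * (1 + t\<^sup>2 * (z \<bullet> z))"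
      unfolding 1 2 .
    then show ?thesis unfolding D_def by (simp add: algebra_simps)
  qed
  have "z \<bullet> z = 0"
  proof (rule ccontr)
    assume "z \<bullet> z \<noteq> 0"
    then have pos: "z \<bullet> z > 0" by (simp add: order.not_eq_order_implies_strict)
    \<comment> \<open>A step with \<open>t * (\<bar>D\<bar> + 1) = z \<bullet> z\<close>, small
      enough for the linear term to win.\<close>
    define t where "t = (z \<bullet> z) / (\<bar>D\<bar> + 1)"
    have t: "t > 0" using pos by (simp add: t_def)
    have "2 * (z \<bullet> z) \<le> t * D" using ineq[of t] t by (simp add: power2_eq_square)
    also have "\<dots> \<le> t * (\<bar>D\<bar> + 1)" using t by (intro mult_left_mono) auto
    also have "\<dots> = z \<bullet> z" by (simp add: t_def)
    finally show False using pos by simp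
  qed
  then have "A *v x = m *\<^sub>R x" by (simp add: z_def)
  then show ?thesis using that x by blast
qed

text \<open>The vectors orthogonal to the eigenvectors found so far form a subspace that is
  invariant by symmetry of \<open>A\<close>, and it is nonzero while fewer than
  \<open>CARD('n)\<close> have been found.\<close>

lemma orthonormal_eigenvectors:
  fixes A :: "real^'n^'n"
  assumes sym: "transpose A = A" and "k \<le> CARD('n)"
  shows "\<exists>B. finite B \<and> card B = k \<and> pairwise orthogonal B \<and>
    (\<forall>x\<in>B. norm x = 1 \<and> (\<exists>c. A *v x = c *\<^sub>R x))"
  using assms(2)
proof (induction k)
  case 0
  then show ?case by (intro exI[of _ "{}"]) auto
next
  case (Suc k)
  then obtain B where B: "finite B" "card B = k" "pairwise orthogonal B"
    "\<And>x. x \<in> B \<Longrightarrow> norm x = 1" "\<And>x. x \<in> B \<Longrightarrow> \<exists>c. A *v x = c *\<^sub>R x" by auto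
  define W where "W = {y. \<forall>x\<in>B. orthogonal x y}"
  have W: "subspace W" unfolding W_def subspace_def
    by (auto simp: orthogonal_def inner_add_right)
  have "dim B < DIM(real^'n)" using dim_le_card'[OF B(1)] B(2) Suc.prems by simp
  then have "dim (span B) < DIM(real^'n)" by simp
  then obtain y where "y \<noteq> 0" "\<And>x. x \<in> span B \<Longrightarrow> orthogonal y x"
    using orthogonal_to_subspace_exists[of B] by (metis dim_span)
  then have "y \<in> W" "y \<noteq> 0" by (auto simp: W_def orthogonal_commute span_base)
  then have "W \<noteq> {0}" by blast
  moreover have "A *v y \<in> W" if "y \<in> W" for y
  proof -
    have "x \<bullet> (A *v y) = 0" if x: "x \<in> B" for x
    proof -
      obtain c where "A *v x = c *\<^sub>R x" using B(5) x by blast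
      then show ?thesis using \<open>y \<in> W\<close> x dot_mult_transpose[of x A y] unfolding sym
        by (auto simp: W_def orthogonal_def)
    qed
    then show ?thesis by (simp add: W_def orthogonal_def)
  qed
  ultimately obtain x c where x: "x \<in> W" "norm x = 1" "A *v x = c *\<^sub>R x"
    using eigenvector_in_invariant_subspace[OF sym W] by blast
  have "x \<notin> B" using x by (auto simp: W_def orthogonal_def norm_eq_1)
  then show ?case using B x
    by (intro exI[of _ "insert x B"]) (auto simp: W_def pairwise_insert orthogonal_commute)
qed

section \<open>Diagonal matrices and diagonalization\<close>

definition diag_mat :: "('n \<Rightarrow> real) \<Rightarrow> real^'n^'n"
  where "diag_mat d = (\<chi> i j. if i = j then d i else 0)"

lemma diag_mat_nth: "diag_mat d $ i $ j = (if i = j then d i else 0)"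
  by (simp add: diag_mat_def)

lemma mult_diag_mat_nth: "(A ** diag_mat d) $ i $ j = A $ i $ j * d j"
  by (simp add: matrix_matrix_mult_def diag_mat_nth if_distrib cong: if_cong)

lemma diag_mat_mult_nth: "(diag_mat d ** A) $ i $ j = d i * A $ i $ j"
proof -
  have "(if i = k then d i else 0) * A $ k $ j = (if i = k then d i * A $ k $ j else 0)" for k by simp
  then show ?thesis by (simp add: matrix_matrix_mult_def diag_mat_nth)
qed

lemma diag_mat_vec_nth: "(diag_mat d *v x) $ i = d i * x $ i"
proof -
  have "(if i = k then d i else 0) * x $ k = (if i = k then d i * x $ k else 0)" for k by simp
  then show ?thesis by (simp add: matrix_vector_mult_def diag_mat_nth)
qed

lemma diag_mat_mult: "diag_mat d ** diag_mat e = diag_mat (\<lambda>i. d i * e i)"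
  by (simp add: vec_eq_iff mult_diag_mat_nth) (simp add: diag_mat_nth)

lemma transpose_diag_mat: "transpose (diag_mat d) = diag_mat d"
  by (simp add: vec_eq_iff transpose_def diag_mat_nth)

lemma diag_mat_1: "diag_mat (\<lambda>i. 1) = mat 1"
  by (simp add: vec_eq_iff diag_mat_nth mat_def)

lemma det_diag_mat: "det (diag_mat d) = (\<Prod>i\<in>UNIV. d i)"
  by (subst det_diagonal) (simp_all add: diag_mat_nth)

lemma matrix_inv_diag_mat: "(\<And>i. d i \<noteq> 0) \<Longrightarrow> matrix_inv (diag_mat d) = diag_mat (\<lambda>i. inverse (d i))"
  by (rule matrix_inv_eqI) (simp add: diag_mat_mult diag_mat_1)

lemma diagonal_eq_diag_mat: "(\<forall>i j. i \<noteq> j \<longrightarrow> A $ i $ j = 0) \<Longrightarrow> A = diag_mat (\<lambda>i. A $ i $ i)"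
  by (simp add: vec_eq_iff diag_mat_nth)

theorem spectral_theorem:
  fixes A :: "real^'n^'n"
  assumes sym: "transpose A = A"
  obtains Q d where "orthogonal_matrix Q" "A = Q ** diag_mat d ** transpose Q"
proof -
  obtain B where B: "finite B" "card B = CARD('n)" "pairwise orthogonal B"
    "\<And>x. x \<in> B \<Longrightarrow> norm x = 1" "\<And>x. x \<in> B \<Longrightarrow> \<exists>c. A *v x = c *\<^sub>R x"
    using orthonormal_eigenvectors[OF sym order.refl] by blast
  obtain f :: "'n \<Rightarrow> real^'n" where f: "bij_betw f UNIV B"
    using finite_same_card_bij[of "UNIV :: 'n set" B] B by auto
  have fB: "f i \<in> B" for i using f by (auto simp: bij_betw_def)
  have "\<forall>i. \<exists>c. A *v f i = c *\<^sub>R f i" using B(5) fB by blast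
  from choice[OF this] obtain d where d: "\<And>i. A *v f i = d i *\<^sub>R f i" by blast
  define Q where "Q = (\<chi> i j. f j $ i)"
  have col: "column j Q = f j" for j by (simp add: Q_def column_def vec_eq_iff)
  have "orthogonal (f i) (f j)" if ij: "i \<noteq> j" for i j
  proof -
    have "f i \<noteq> f j" using f ij by (auto simp: bij_betw_def inj_on_def)
    then show ?thesis using B(3) fB by (simp add: pairwise_def)
  qed
  then have Q: "orthogonal_matrix Q"
    unfolding orthogonal_matrix_orthonormal_columns col by (simp add: B(4) fB)
  have "A ** Q = Q ** diag_mat d"
  proof (simp add: vec_eq_iff mult_diag_mat_nth, intro allI)
    fix i j
    have "(A ** Q) $ i $ j = (A *v f j) $ i"
      by (simp add: matrix_matrix_mult_def matrix_vector_mult_def Q_def)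
    then show "(A ** Q) $ i $ j = Q $ i $ j * d j" by (simp add: d Q_def)
  qed
  then have "A ** (Q ** transpose Q) = Q ** diag_mat d ** transpose Q" by (simp add: matrix_mul_assoc)
  then show ?thesis using that[OF Q] orthogonal_matrix_mult_transpose(1)[OF Q] by simp
qed

section \<open>Symmetric positive definite matrices and square roots\<close>

lemma spd_sym: "A \<in> spd_mats \<Longrightarrow> transpose A = A"
  by (simp add: spd_mats_def)

lemma spd_pos: "A \<in> spd_mats \<Longrightarrow> x \<noteq> 0 \<Longrightarrow> x \<bullet> (A *v x) > 0"
  by (simp add: spd_mats_def)

lemma spd_invertible:
  assumes "A \<in> spd_mats"
  shows "invertible A"
proof -
  have "x = 0" if "A *v x = 0" for x using spd_pos[OF assms, of x] that by force
  then show ?thesis by (metis invertible_left_inverse matrix_left_invertible_ker)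
qed

lemma spd_mat_1: "mat 1 \<in> spd_mats"
  by (simp add: spd_mats_def)

lemma spd_congruence:
  assumes "A \<in> spd_mats" "invertible (B :: real^'n^'n)"
  shows "B ** A ** transpose B \<in> spd_mats"
proof -
  have "x \<bullet> ((B ** A ** transpose B) *v x) > 0" if "x \<noteq> 0" for x
  proof -
    have "transpose B *v x \<noteq> 0"
      using transpose_invertible[OF assms(2)] that
      by (metis invertible_left_inverse matrix_left_invertible_ker)
    from spd_pos[OF assms(1) this] show ?thesis
      by (simp only: matrix_vector_mul_assoc[symmetric] dot_mult_transpose[of x B])
  qed
  then show ?thesis using spd_sym[OF assms(1)]
    by (simp add: spd_mats_def matrix_transpose_mul matrix_mul_assoc)
qed

lemma spd_gram:
  assumes "invertible (B :: real^'n^'n)"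
  shows "B ** transpose B \<in> spd_mats"
  using spd_congruence[OF spd_mat_1 assms] by simp

lemma spd_matrix_inv:
  assumes "A \<in> spd_mats"
  shows "matrix_inv A \<in> spd_mats"
proof -
  have "matrix_inv A ** A ** transpose (matrix_inv A) \<in> spd_mats"
    by (intro spd_congruence assms invertible_matrix_inv spd_invertible)
  moreover have "transpose (matrix_inv A) = matrix_inv A"
    by (intro transpose_matrix_inv_sym spd_invertible spd_sym assms)
  ultimately show ?thesis by (simp add: matrix_inv_left spd_invertible assms)
qed

lemma spd_diag_pos:
  assumes "A \<in> spd_mats"
  shows "A $ i $ i > 0"
proof -
  have "axis i 1 \<bullet> (A *v axis i 1) = A $ i $ i"
    by (simp add: matrix_vector_mult_basis column_def inner_axis')
  then show ?thesis using spd_pos[OF assms, of "axis i 1"] by (simp add: axis_eq_0_iff)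
qed

lemma diag_mat_spd_iff: "diag_mat d \<in> spd_mats \<longleftrightarrow> (\<forall>i. d i > 0)"
proof
  assume "diag_mat d \<in> spd_mats"
  then show "\<forall>i. d i > 0" using spd_diag_pos[of "diag_mat d"] by (simp add: diag_mat_nth)
next
  assume d: "\<forall>i. d i > 0"
  have "x \<bullet> (diag_mat d *v x) > 0" if x: "x \<noteq> 0" for x
  proof -
    have "x \<bullet> (diag_mat d *v x) = (\<Sum>i\<in>UNIV. d i * (x $ i)\<^sup>2)"
      by (simp add: inner_vec_def diag_mat_vec_nth power2_eq_square mult_ac)
    also obtain k where "x $ k \<noteq> 0" using x by (auto simp: vec_eq_iff)
    then have "(\<Sum>i\<in>UNIV. d i * (x $ i)\<^sup>2) > 0"
      using d by (intro sum_pos2[of _ k]) (auto simp: less_imp_le)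
    finally show ?thesis .
  qed
  then show "diag_mat d \<in> spd_mats" by (simp add: spd_mats_def transpose_diag_mat)
qed

lemma spd_spectral:
  fixes A :: "real^'n^'n"
  assumes "A \<in> spd_mats"
  obtains Q d where "orthogonal_matrix Q" "\<And>i. d i > 0" "A = Q ** diag_mat d ** transpose Q"
proof -
  obtain Q d where Q: "orthogonal_matrix Q" and A: "A = Q ** diag_mat d ** transpose Q"
    by (rule spectral_theorem[OF spd_sym[OF assms]]) blast
  have "transpose Q ** A ** transpose (transpose Q) \<in> spd_mats"
    by (intro spd_congruence assms transpose_invertible orthogonal_matrix_invertible Q)
  moreover have "transpose Q ** A ** transpose (transpose Q) = (transpose Q ** Q) ** diag_mat d ** (transpose Q ** Q)"
    by (simp add: A matrix_mul_assoc)
  ultimately have "diag_mat d \<in> spd_mats" by (simp add: orthogonal_matrix_mult_transpose[OF Q])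
  then show ?thesis using that[of Q d] Q A unfolding diag_mat_spd_iff by blast
qed

lemma det_orthogonal_conj:
  "orthogonal_matrix (Q::real^'n^'n) \<Longrightarrow> det (Q ** A ** transpose Q) = det A"
  using arg_cong[OF orthogonal_matrix_mult_transpose(1), of Q det] by (simp add: det_mul)

lemma spd_det_pos:
  assumes "A \<in> spd_mats"
  shows "det A > 0"
proof -
  obtain Q d where "orthogonal_matrix Q" "\<And>i. d i > 0" "A = Q ** diag_mat d ** transpose Q"
    by (rule spd_spectral[OF assms]) blast
  then show ?thesis by (simp add: det_orthogonal_conj det_diag_mat prod_pos)
qed

lemma trace_congruence_eq_sum:
  "trace (transpose (X::real^'n^'m) ** A ** X) = (\<Sum>j\<in>UNIV. column j X \<bullet> (A *v column j X))"
proof -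
  have "(transpose X ** (A ** X)) $ j $ j = column j X \<bullet> (A *v column j X)" for j
    by (simp add: matrix_matrix_mult_def transpose_def inner_vec_def matrix_vector_mult_def column_def)
  then show ?thesis by (simp add: trace_def matrix_mul_assoc[symmetric])
qed

lemma trace_congruence_nonneg:
  assumes "A \<in> spd_mats"
  shows "trace (transpose X ** A ** X) \<ge> 0"
  unfolding trace_congruence_eq_sum using spd_pos[OF assms]
  by (intro sum_nonneg) (metis inner_zero_left less_imp_le order.refl)

lemma trace_congruence_pos:
  assumes "A \<in> spd_mats" "X \<noteq> 0"
  shows "trace (transpose X ** A ** X) > 0"
proof -
  obtain j where "column j X \<noteq> 0" using assms(2) by (auto simp: vec_eq_iff column_def)
  then show ?thesis unfolding trace_congruence_eq_sum using spd_pos[OF assms(1)]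
    by (intro sum_pos2[of _ j]) (auto, metis inner_zero_left less_imp_le order.refl)
qed

text \<open>Multiplying by \<open>transpose D\<close> and taking traces gives a term from
  \<open>B\<close> that is positive for nonzero \<open>D\<close>, plus a nonnegative one from
  \<open>C\<close>. Serves both uniqueness of square roots and injectivity of the derivative of
  squaring.\<close>

lemma sylvester_injective:
  assumes "B \<in> spd_mats" "C \<in> spd_mats" "B ** D + D ** C = 0"
  shows "D = 0"
proof (rule ccontr)
  assume "D \<noteq> 0"
  then have "trace (transpose D ** B ** D) > 0" by (rule trace_congruence_pos[OF assms(1)])
  moreover have "trace (transpose D ** D ** C) \<ge> 0"
    using trace_congruence_nonneg[OF assms(2), of "transpose D"] trace_mult_rotate[of D C "transpose D"]
    by simp
  moreover have "transpose D ** (B ** D + D ** C) = 0" by (simp add: assms(3))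
  then have "trace (transpose D ** B ** D) + trace (transpose D ** D ** C) = 0"
    by (simp add: matrix_add_ldistrib matrix_mul_assoc trace_add[symmetric] trace_zero)
  ultimately show False by simp
qed

text \<open>Since \<open>B ** B - C ** C = B ** (B - C) + (B - C) ** C\<close>, the difference
  solves a homogeneous Sylvester equation.\<close>

lemma spd_square_unique:
  assumes "B \<in> spd_mats" "C \<in> spd_mats" "B ** B = C ** C"
  shows "B = C"
  using sylvester_injective[OF assms(1,2), of "B - C"] assms(3)
  by (simp add: matrix_mult.diff_left matrix_mult.diff_right)

lemma sym_sqrt_eqI:
  assumes "B \<in> spd_mats" "B ** B = A"
  shows "sym_sqrt A = B"
  unfolding sym_sqrt_def using assms spd_square_unique by (intro the_equality) auto

lemma orthogonal_conj_mult:
  assumes "orthogonal_matrix (Q::real^'n^'n)"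
  shows "(Q ** A ** transpose Q) ** (Q ** B ** transpose Q) = Q ** (A ** B) ** transpose Q"
proof -
  have "(Q ** A ** transpose Q) ** (Q ** B ** transpose Q) = Q ** A ** (transpose Q ** Q) ** B ** transpose Q"
    by (simp only: matrix_mul_assoc)
  then show ?thesis by (simp add: orthogonal_matrix_mult_transpose[OF assms] matrix_mul_assoc)
qed

lemma sym_sqrt_spectral:
  assumes Q: "orthogonal_matrix (Q::real^'n^'n)" and d: "\<And>i. d i > 0"
  shows "Q ** diag_mat (\<lambda>i. sqrt (d i)) ** transpose Q \<in> spd_mats"
    "sym_sqrt (Q ** diag_mat d ** transpose Q) = Q ** diag_mat (\<lambda>i. sqrt (d i)) ** transpose Q"
proof -
  show 1: "Q ** diag_mat (\<lambda>i. sqrt (d i)) ** transpose Q \<in> spd_mats"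
    by (intro spd_congruence orthogonal_matrix_invertible Q) (simp add: diag_mat_spd_iff d)
  show "sym_sqrt (Q ** diag_mat d ** transpose Q) = Q ** diag_mat (\<lambda>i. sqrt (d i)) ** transpose Q"
    by (rule sym_sqrt_eqI[OF 1]) (simp add: orthogonal_conj_mult[OF Q] diag_mat_mult d less_imp_le)
qed

lemma sym_sqrt_diag_mat:
  assumes "\<And>i. d i > 0"
  shows "sym_sqrt (diag_mat d) = diag_mat (\<lambda>i. sqrt (d i))"
  using sym_sqrt_spectral(2)[OF orthogonal_matrix_id assms] by simp

lemma sym_sqrt_spd: "A \<in> spd_mats \<Longrightarrow> sym_sqrt A \<in> spd_mats"
  by (erule spd_spectral) (simp add: sym_sqrt_spectral)

lemma sym_sqrt_square:
  assumes "A \<in> spd_mats"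
  shows "sym_sqrt A ** sym_sqrt A = A"
proof -
  obtain Q d where "orthogonal_matrix Q" "\<And>i. d i > 0" "A = Q ** diag_mat d ** transpose Q"
    by (rule spd_spectral[OF assms]) blast
  then show ?thesis by (simp add: sym_sqrt_spectral orthogonal_conj_mult diag_mat_mult less_imp_le)
qed

section \<open>Cholesky factors\<close>

text \<open>Instantiated with the orders of the two factor index types and with the lexicographic
  order on pairs.\<close>

locale strict_total_order =
  fixes lt :: "'n::finite \<Rightarrow> 'n \<Rightarrow> bool"
  assumes irrefl: "\<not> lt i i"
    and trans: "lt i j \<Longrightarrow> lt j k \<Longrightarrow> lt i k"
    and total: "i \<noteq> j \<Longrightarrow> lt i j \<or> lt j i"
begin

lemma wf_lt: "wf {(i, j). lt i j}"
proof (rule finite_acyclic_wf)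
  have "trans {(i, j). lt i j}" using trans by (auto intro: transI)
  then show "acyclic {(i, j). lt i j}" using irrefl by (simp add: acyclic_def trancl_id)
qed simp

lemma exists_min:
  assumes "I \<noteq> {}"
  obtains m where "m \<in> I" "\<And>i. i \<in> I \<Longrightarrow> i \<noteq> m \<Longrightarrow> lt m i"
proof -
  obtain x where "x \<in> I" using assms by blast
  then obtain m where m: "m \<in> I" "\<And>y. lt y m \<Longrightarrow> y \<notin> I" using wfE_min[OF wf_lt, of x I] by auto
  then show ?thesis using that total by blast
qed

abbreviation "lower \<equiv> lower_triangular lt"

lemma lower_mult:
  assumes "lower A" "lower B"
  shows "lower (A ** B)" "(A ** B) $ i $ i = A $ i $ i * B $ i $ i"
proof -
  have zero: "A $ i $ k * B $ k $ j = 0" if "lt i k \<or> lt k j" for i j k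
    using that assms by (auto simp: lower_triangular_def)
  show "lower (A ** B)" unfolding lower_triangular_def
  proof (intro allI impI)
    fix i j assume ij: "lt i j"
    have "A $ i $ k * B $ k $ j = 0" for k
      using zero[of i k j] ij total[of i k] trans[of k i j] by auto
    then show "(A ** B) $ i $ j = 0"
      by (simp only: matrix_matrix_mult_def vec_lambda_beta sum.neutral_const)
  qed
  have e: "A $ i $ k * B $ k $ i = (if k = i then A $ i $ i * B $ i $ i else 0)" for k
    using zero[of i k i] total[of i k] by auto
  have "(\<Sum>k\<in>UNIV. A $ i $ k * B $ k $ i) = (\<Sum>k\<in>UNIV. if k = i then A $ i $ i * B $ i $ i else 0)"
    by (rule sum.cong[OF refl e])
  then have "(\<Sum>k\<in>UNIV. A $ i $ k * B $ k $ i) = A $ i $ i * B $ i $ i" by simp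
  then show "(A ** B) $ i $ i = A $ i $ i * B $ i $ i" by (simp add: matrix_matrix_mult_def)
qed

text \<open>Forward substitution. The set \<open>I\<close> is closed downwards, so the substitution
  may stop early: for a column of the inverse matrix the right-hand side is a unit vector, which
  vanishes at all indices preceding its own.\<close>

lemma lower_solution_zero:
  assumes L: "lower L" "\<And>i. L $ i $ i \<noteq> 0"
    and I: "\<And>j k. j \<in> I \<Longrightarrow> lt k j \<Longrightarrow> k \<in> I" "\<And>j. j \<in> I \<Longrightarrow> (L *v x) $ j = 0"
  shows "j \<in> I \<Longrightarrow> x $ j = 0"
proof (induction j rule: wf_induct_rule[OF wf_lt])
  case (1 j)
  have e: "L $ j $ k * x $ k = (if k = j then L $ j $ j * x $ j else 0)" for k
    using 1 I(1)[of j k] total[of k j] L(1) by (auto simp: lower_triangular_def)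
  have "(\<Sum>k\<in>UNIV. L $ j $ k * x $ k) = (\<Sum>k\<in>UNIV. if k = j then L $ j $ j * x $ j else 0)"
    by (rule sum.cong[OF refl e])
  then have "(\<Sum>k\<in>UNIV. L $ j $ k * x $ k) = L $ j $ j * x $ j" by simp
  then have "(L *v x) $ j = L $ j $ j * x $ j" by (simp add: matrix_vector_mult_def)
  then show ?case using I(2)[OF 1(2)] L(2)[of j] by simp
qed

lemma lower_invertible:
  assumes "lower L" "\<And>i. L $ i $ i \<noteq> 0"
  shows "invertible L"
proof -
  have "x = 0" if "L *v x = 0" for x
    using lower_solution_zero[OF assms, of UNIV x] that by (simp add: vec_eq_iff)
  then show ?thesis by (metis invertible_left_inverse matrix_left_invertible_ker)
qed

lemma lower_matrix_inv:
  assumes L: "lower L" "\<And>i. L $ i $ i \<noteq> 0"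
  shows "lower (matrix_inv L)" "matrix_inv L $ i $ i = 1 / L $ i $ i"
proof -
  have inv: "L ** matrix_inv L = mat 1" by (rule matrix_inv_right[OF lower_invertible[OF assms]])
  show l: "lower (matrix_inv L)" unfolding lower_triangular_def
  proof (intro allI impI)
    fix i j assume ij: "lt i j"
    have "(\<chi> k. matrix_inv L $ k $ j) $ i = 0"
    proof (rule lower_solution_zero[OF L, where I = "{k. lt k j}"])
      fix m assume "m \<in> {k. lt k j}"
      then have "m \<noteq> j" using irrefl by auto
      have "(L *v (\<chi> k. matrix_inv L $ k $ j)) $ m = (L ** matrix_inv L) $ m $ j"
        by (simp add: matrix_matrix_mult_def matrix_vector_mult_def)
      then show "(L *v (\<chi> k. matrix_inv L $ k $ j)) $ m = 0" using \<open>m \<noteq> j\<close> by (simp add: inv mat_def)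
    qed (use ij trans in auto)
    then show "matrix_inv L $ i $ j = 0" by simp
  qed
  have "L $ i $ i * matrix_inv L $ i $ i = 1" using lower_mult(2)[OF L(1) l, of i] by (simp add: inv mat_def)
  then show "matrix_inv L $ i $ i = 1 / L $ i $ i" using L(2)[of i] by (simp add: field_simps)
qed

lemma lower_skew_zero:
  assumes "lower P" "P + transpose P = 0"
  shows "P = 0"
proof -
  have s: "P $ i $ j = - P $ j $ i" for i j
    using arg_cong[OF assms(2), of "\<lambda>M. M $ i $ j"] by (simp add: transpose_def)
  have "P $ i $ j = 0" for i j
  proof -
    consider "i = j" | "lt i j" | "lt j i" using total by blast
    then show ?thesis
      by cases (use assms(1) s[of i j] in \<open>simp_all add: lower_triangular_def\<close>)
  qed
  then show ?thesis by (simp add: vec_eq_iff)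
qed

text \<open>\<open>P = M^{-1} L\<close> is lower triangular and, by equality of the Gram matrices,
  orthogonal. Its transpose is then its inverse \<open>L^{-1} M\<close>, again lower triangular, so
  \<open>P\<close> is diagonal with positive entries of square 1.\<close>

lemma cholesky_unique:
  assumes L: "lower L" "\<And>i. L $ i $ i > 0" and M: "lower M" "\<And>i. M $ i $ i > 0"
    and eq: "L ** transpose L = M ** transpose M"
  shows "L = M"
proof -
  have L0: "L $ i $ i \<noteq> 0" and M0: "M $ i $ i \<noteq> 0" for i using L(2)[of i] M(2)[of i] by auto
  note iL = lower_invertible[OF L(1) L0] and iM = lower_invertible[OF M(1) M0]
  define P where "P = matrix_inv M ** L"
  define R where "R = matrix_inv L ** M"
  have P: "lower P" "P $ i $ i > 0" for i
    unfolding P_def using lower_mult[OF lower_matrix_inv(1)[OF M(1) M0] L(1)] lower_matrix_inv(2)[OF M(1) M0]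
      L(2) M(2) by simp_all
  have R: "lower R" unfolding R_def by (rule lower_mult(1)[OF lower_matrix_inv(1)[OF L(1) L0] M(1)])
  have "P ** transpose P = matrix_inv M ** (L ** transpose L) ** transpose (matrix_inv M)"
    by (simp add: P_def matrix_transpose_mul matrix_mul_assoc)
  also have "\<dots> = (matrix_inv M ** M) ** transpose (matrix_inv M ** M)"
    unfolding eq by (simp add: matrix_transpose_mul matrix_mul_assoc)
  finally have PP: "P ** transpose P = mat 1" by (simp add: matrix_inv_left[OF iM])
  have "R ** P = matrix_inv L ** (M ** matrix_inv M) ** L" by (simp add: R_def P_def matrix_mul_assoc)
  then have RP: "R ** P = mat 1" by (simp add: matrix_inv_left[OF iL] matrix_inv_right[OF iM])
  have "transpose P = R ** P ** transpose P" by (simp add: RP)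
  also have "\<dots> = R" by (simp add: matrix_mul_assoc[symmetric] PP)
  finally have tP: "lower (transpose P)" using R by simp
  have off: "P $ i $ j = 0" if "i \<noteq> j" for i j
    using total[OF that] P(1) tP by (auto simp: lower_triangular_def transpose_def)
  have "P $ i $ i = 1" for i
  proof -
    have e: "P $ i $ k * P $ i $ k = (if k = i then P $ i $ i * P $ i $ i else 0)" for k
      using off[of i k] by auto
    have "(\<Sum>k\<in>UNIV. P $ i $ k * P $ i $ k) = (\<Sum>k\<in>UNIV. if k = i then P $ i $ i * P $ i $ i else 0)"
    by (rule sum.cong[OF refl e])
  then have "(\<Sum>k\<in>UNIV. P $ i $ k * P $ i $ k) = P $ i $ i * P $ i $ i" by simp
    then have "(P ** transpose P) $ i $ i = P $ i $ i * P $ i $ i"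
      by (simp add: matrix_matrix_mult_def transpose_def)
    then have "(P $ i $ i)\<^sup>2 = 1" by (simp add: PP mat_def power2_eq_square)
    then show ?thesis using P(2)[of i] by (simp add: power2_eq_1_iff)
  qed
  then have "P = mat 1" using off by (simp add: vec_eq_iff mat_def)
  then have "M ** P = M" by simp
  then show ?thesis by (simp add: P_def matrix_mul_assoc matrix_inv_right[OF iM])
qed

text \<open>Elimination of the least index of \<open>I\<close>: the recursive call is on the Schur complement.\<close>

lemma cholesky_exists_on:
  fixes a :: "'n \<Rightarrow> 'n \<Rightarrow> real"
  assumes "\<And>i j. a i j = a j i"
    and "\<And>x. (\<exists>i\<in>I. x i \<noteq> 0) \<Longrightarrow> (\<Sum>i\<in>I. \<Sum>j\<in>I. x i * a i j * x j) > 0"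
  shows "\<exists>l. (\<forall>i j. lt i j \<longrightarrow> l i j = 0) \<and> (\<forall>i j. j \<notin> I \<longrightarrow> l i j = 0) \<and> (\<forall>i\<in>I. l i i > 0) \<and>
     (\<forall>i\<in>I. \<forall>j\<in>I. (\<Sum>k\<in>UNIV. l i k * l j k) = (a i j :: real))"
  using finite[of I] assms
proof (induction I arbitrary: a rule: finite_psubset_induct)
  case (psubset I)
  show ?case
  proof (cases "I = {}")
    case True
    then show ?thesis by (intro exI[of _ "\<lambda>i j. 0"]) auto
  next
    case False
    then obtain m where m: "m \<in> I" "\<And>i. i \<in> I \<Longrightarrow> i \<noteq> m \<Longrightarrow> lt m i" using exists_min by blast
    define J where "J = I - {m}"
    have J: "J \<subset> I" "finite J" "m \<notin> J" and I: "I = insert m J" using m(1) by (auto simp: J_def)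
    define b where "b i j = a i j - a i m * a m j / a m m" for i j
    have sum_I: "(\<Sum>i\<in>I. \<Sum>j\<in>I. x i * a i j * x j) =
        a m m * (x m)\<^sup>2 + 2 * x m * (\<Sum>j\<in>J. a m j * x j) + (\<Sum>i\<in>J. \<Sum>j\<in>J. x i * a i j * x j)" for x
    proof -
      have "(\<Sum>i\<in>J. x i * a i m * x m) = x m * (\<Sum>j\<in>J. a m j * x j)"
        using psubset.prems(1) by (simp add: sum_distrib_left mult_ac)
      moreover have "(\<Sum>j\<in>J. x m * a m j * x j) = x m * (\<Sum>j\<in>J. a m j * x j)"
        by (simp add: sum_distrib_left mult_ac)
      ultimately show ?thesis unfolding I using J(2,3)
        by (simp add: sum.distrib power2_eq_square algebra_simps)
    qed
    have amm: "a m m > 0"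
    proof -
      have "(\<Sum>i\<in>I. \<Sum>j\<in>I. (if i = m then 1 else 0) * a i j * (if j = m then 1 else 0)) > 0"
        by (rule psubset.prems(2)) (use m(1) in auto)
      also have "(\<Sum>i\<in>I. \<Sum>j\<in>I. (if i = m then 1 else 0) * a i j * (if j = m then 1 else 0)) = a m m"
        using J(3) unfolding sum_I by (simp add: sum.neutral)
      finally show ?thesis .
    qed
    have "\<exists>l. (\<forall>i j. lt i j \<longrightarrow> l i j = 0) \<and> (\<forall>i j. j \<notin> J \<longrightarrow> l i j = 0) \<and> (\<forall>i\<in>J. l i i > 0) \<and>
      (\<forall>i\<in>J. \<forall>j\<in>J. (\<Sum>k\<in>UNIV. l i k * l j k) = b i j)"
    proof (rule psubset.IH[OF J(1)])
      show "b i j = b j i" for i j using psubset.prems(1) by (simp add: b_def mult.commute)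
      fix x :: "'n \<Rightarrow> real" assume x: "\<exists>i\<in>J. x i \<noteq> 0"
      define s where "s = (\<Sum>j\<in>J. a m j * x j)"
      \<comment> \<open>The coordinate \<open>- s / a m m\<close> minimizes the quadratic form over
        the entry at \<open>m\<close>; the minimum is the form of the Schur complement
        \<open>b\<close>.\<close>
      define y where "y i = (if i = m then - s / a m m else x i)" for i
      have yJ: "y i = x i" if "i \<in> J" for i using that J(3) by (auto simp: y_def)
      have "(\<Sum>i\<in>J. \<Sum>j\<in>J. x i * (a i m * a m j / a m m) * x j) = (\<Sum>i\<in>J. \<Sum>j\<in>J. (a m i * x i) * (a m j * x j)) / a m m"
        using psubset.prems(1) by (simp add: sum_divide_distrib mult_ac)
      also have "\<dots> = s\<^sup>2 / a m m" by (simp add: s_def power2_eq_square sum_product)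
      finally have "(\<Sum>i\<in>J. \<Sum>j\<in>J. x i * b i j * x j) = (\<Sum>i\<in>J. \<Sum>j\<in>J. x i * a i j * x j) - s\<^sup>2 / a m m"
        unfolding b_def by (simp add: algebra_simps sum_subtractf)
      also have "\<dots> = (\<Sum>i\<in>I. \<Sum>j\<in>I. y i * a i j * y j)"
        unfolding sum_I using amm by (simp add: yJ s_def[symmetric]) (simp add: y_def power2_eq_square field_simps)
      also have "\<exists>i\<in>I. y i \<noteq> 0" using x yJ J(1) by force
      then have "(\<Sum>i\<in>I. \<Sum>j\<in>I. y i * a i j * y j) > 0" by (rule psubset.prems(2))
      finally show "(\<Sum>i\<in>J. \<Sum>j\<in>J. x i * b i j * x j) > 0" .
    qed
    then obtain l where "\<forall>i j. lt i j \<longrightarrow> l i j = 0" "\<forall>i j. j \<notin> J \<longrightarrow> l i j = 0" "\<forall>i\<in>J. l i i > 0"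
      "\<forall>i\<in>J. \<forall>j\<in>J. (\<Sum>k\<in>UNIV. l i k * l j k) = b i j" by blast
    then have l: "\<And>i j. lt i j \<Longrightarrow> l i j = 0" "\<And>i j. j \<notin> J \<Longrightarrow> l i j = 0" "\<And>i. i \<in> J \<Longrightarrow> l i i > 0"
      "\<And>i j. i \<in> J \<Longrightarrow> j \<in> J \<Longrightarrow> (\<Sum>k\<in>UNIV. l i k * l j k) = b i j" by blast+
    \<comment> \<open>Column \<open>m\<close> is new; subtracting its outer product from
      \<open>a\<close> is what produced \<open>b\<close>.\<close>
    define r where "r i j = (if j = m then (if i \<in> I then a i m / sqrt (a m m) else 0) else l i j)" for i j
    \<comment> \<open>Each entry of row \<open>m\<close> lies either in a column outside
      \<open>J\<close> or strictly above the diagonal.\<close>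
    have lm: "l m k = 0" for k
    proof (cases "k \<in> J")
      case True
      then show ?thesis using m(2)[of k] J(3) I l(1)[of m k] by blast
    qed (rule l(2))
    have sum_r: "(\<Sum>k\<in>UNIV. r i k * r j k) = a i m * a j m / a m m + (\<Sum>k\<in>UNIV. l i k * l j k)" if "i \<in> I" "j \<in> I" for i j
    proof -
      have "(\<Sum>k\<in>UNIV. r i k * r j k) = (\<Sum>k\<in>UNIV. (if k = m then a i m * a j m / a m m else 0) + l i k * l j k)"
        using that amm l(2)[OF J(3)] by (intro sum.cong) (auto simp: r_def)
      then show ?thesis by (simp add: sum.distrib)
    qed
    show ?thesis
    proof (intro exI[of _ r] conjI allI ballI impI)
      fix i j
      show "r i j = 0" if "lt i j"
        using that l(1)[OF that] m(2)[of i] irrefl trans[of m i m] by (auto simp: r_def)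
      show "r i j = 0" if "j \<notin> I" using that m(1) l(2) J by (auto simp: r_def)
      show "r i i > 0" if "i \<in> I" using that amm l(3)[of i] I by (auto simp: r_def)
      show "(\<Sum>k\<in>UNIV. r i k * r j k) = a i j" if ij: "i \<in> I" "j \<in> I"
        unfolding sum_r[OF ij] using ij amm l(4)[of i j] lm psubset.prems(1)
        by (auto simp: I b_def)
    qed
  qed
qed

lemma cholesky_exists:
  fixes A :: "real^'n^'n"
  assumes "A \<in> spd_mats"
  obtains L where "lower L" "\<And>i. L $ i $ i > 0" "L ** transpose L = A"
proof -
  have "(\<Sum>i\<in>UNIV. \<Sum>j\<in>UNIV. x i * A $ i $ j * x j) > 0" if "\<exists>i\<in>UNIV. x i \<noteq> 0" for x :: "'n \<Rightarrow> real"
  proof -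
    have "(\<chi> i. x i) \<noteq> 0" using that by (auto simp: vec_eq_iff)
    from spd_pos[OF assms this] show ?thesis
      by (simp add: inner_vec_def matrix_vector_mult_def sum_distrib_left mult.assoc)
  qed
  moreover have "A $ i $ j = A $ j $ i" for i j
    using arg_cong[OF spd_sym[OF assms], of "\<lambda>M. M $ j $ i"] by (simp add: transpose_def)
  ultimately obtain l where l: "\<And>i j. lt i j \<Longrightarrow> l i j = 0" "\<And>i. l i i > 0"
    "\<And>i j. (\<Sum>k\<in>UNIV. l i k * l j k) = A $ i $ j"
    using cholesky_exists_on[of "\<lambda>i j. A $ i $ j" UNIV] by auto
  show ?thesis
    by (rule that[of "\<chi> i j. l i j"])
       (use l in \<open>auto simp: lower_triangular_def vec_eq_iff matrix_matrix_mult_def transpose_def\<close>)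
qed

lemma cholesky_eqI:
  assumes "lower L" "\<And>i. L $ i $ i > 0" "L ** transpose L = A"
  shows "cholesky lt A = L"
  unfolding cholesky_def using assms cholesky_unique by (intro the_equality) auto

lemma cholesky_props:
  assumes "A \<in> spd_mats"
  shows "lower (cholesky lt A)" "cholesky lt A $ i $ i > 0" "cholesky lt A ** transpose (cholesky lt A) = A"
proof -
  obtain L where L: "lower L" "\<And>i. L $ i $ i > 0" "L ** transpose L = A" using cholesky_exists[OF assms] by blast
  then have "cholesky lt A = L" by (rule cholesky_eqI)
  with L show "lower (cholesky lt A)" "cholesky lt A $ i $ i > 0" "cholesky lt A ** transpose (cholesky lt A) = A"
    by auto
qed

lemma cholesky_invertible: "A \<in> spd_mats \<Longrightarrow> invertible (cholesky lt A)"
  by (rule lower_invertible[OF cholesky_props(1)]) (use cholesky_props(2) in \<open>auto simp: less_le\<close>)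

end

section \<open>Kronecker products and partial traces\<close>

lemma sum_UNIV_prod: "(\<Sum>p\<in>(UNIV :: ('b::finite \<times> 'a::finite) set). f p) = (\<Sum>i\<in>UNIV. \<Sum>k\<in>UNIV. f (i, k))"
  by (simp add: UNIV_Times_UNIV[symmetric] sum.cartesian_product del: UNIV_Times_UNIV)

lemma kron_nth: "kron A B $ i $ j = A $ fst i $ fst j * B $ snd i $ snd j"
  by (simp add: kron_def)

lemma bounded_bilinear_kron:
  "bounded_bilinear (kron :: real^'b^'b \<Rightarrow> real^'a^'a \<Rightarrow> real^('b::finite \<times> 'a::finite)^('b \<times> 'a))"
  unfolding bilinear_conv_bounded_bilinear[symmetric] bilinear_def
  by (intro conjI allI linearI) (simp_all add: kron_nth vec_eq_iff algebra_simps)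

interpretation kron: bounded_bilinear
  "kron :: real^'b^'b \<Rightarrow> real^'a^'a \<Rightarrow> real^('b::finite \<times> 'a::finite)^('b \<times> 'a)"
  by (rule bounded_bilinear_kron)

lemma kron_mult: "kron A B ** kron C D = kron (A ** C) (B ** D)"
proof -
  have "(kron A B ** kron C D) $ i $ j = kron (A ** C) (B ** D) $ i $ j" for i j
    by (simp add: matrix_matrix_mult_def sum_UNIV_prod kron_nth sum_product mult_ac)
  then show ?thesis by (simp add: vec_eq_iff)
qed

lemma transpose_kron: "transpose (kron A B) = kron (transpose A) (transpose B)"
  by (simp add: vec_eq_iff transpose_def kron_nth)

lemma kron_mat_1: "kron (mat 1) (mat 1) = mat 1"
  by (auto simp: vec_eq_iff mat_def kron_nth prod_eq_iff)

lemma trace_kron: "trace (kron A B) = trace A * trace B"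
  by (simp add: trace_def sum_UNIV_prod kron_nth sum_product)

lemma kron_diag_mat: "kron (diag_mat d) (diag_mat e) = diag_mat (\<lambda>p. d (fst p) * e (snd p))"
  by (auto simp: vec_eq_iff kron_nth diag_mat_nth prod_eq_iff)

lemma kron_inverse:
  assumes "invertible (A :: real^'b^'b)" "invertible (B :: real^'a^'a)"
  shows "kron A B ** kron (matrix_inv A) (matrix_inv B) = mat 1"
  by (simp add: assms kron_mult matrix_inv_right kron_mat_1)

lemma invertible_kron:
  assumes "invertible (A :: real^'b^'b)" "invertible (B :: real^'a^'a)"
  shows "invertible (kron A B)"
  using kron_inverse[OF assms] invertible_right_inverse by blast

lemma matrix_inv_kron:
  assumes "invertible (A :: real^'b^'b)" "invertible (B :: real^'a^'a)"
  shows "matrix_inv (kron A B) = kron (matrix_inv A) (matrix_inv B)"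
  by (rule matrix_inv_eqI[OF kron_inverse[OF assms]])

lemma kron_conj:
  "kron (A ** X ** transpose A) (B ** Y ** transpose B) = kron A B ** kron X Y ** transpose (kron A B)"
  by (simp add: kron_mult transpose_kron)

lemma kron_gram:
  "kron (A ** transpose A) (B ** transpose B) = kron A B ** transpose (kron A B)"
  by (simp add: kron_mult transpose_kron)

lemma spd_kron:
  assumes "A \<in> spd_mats" "B \<in> spd_mats"
  shows "kron A B \<in> spd_mats"
proof -
  have s: "sym_sqrt A ** transpose (sym_sqrt A) = A" "sym_sqrt B ** transpose (sym_sqrt B) = B"
    using assms by (simp_all add: spd_sym[OF sym_sqrt_spd] sym_sqrt_square)
  have "kron (sym_sqrt A) (sym_sqrt B) ** transpose (kron (sym_sqrt A) (sym_sqrt B)) \<in> spd_mats"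
    by (intro spd_gram invertible_kron spd_invertible sym_sqrt_spd assms)
  then show ?thesis by (simp add: kron_gram[symmetric] s)
qed

lemma sym_sqrt_kron:
  assumes "A \<in> spd_mats" "B \<in> spd_mats"
  shows "sym_sqrt (kron A B) = kron (sym_sqrt A) (sym_sqrt B)"
  using assms by (intro sym_sqrt_eqI) (simp_all add: spd_kron sym_sqrt_spd kron_mult sym_sqrt_square)

lemma kron_nonzero: "A \<noteq> 0 \<Longrightarrow> B \<noteq> 0 \<Longrightarrow> kron A B \<noteq> 0"
  by (force simp: vec_eq_iff kron_nth)

lemma orthogonal_matrix_kron:
  fixes Q2 :: "real^'b^'b" and Q1 :: "real^'a^'a"
  shows "orthogonal_matrix Q2 \<Longrightarrow> orthogonal_matrix Q1 \<Longrightarrow> orthogonal_matrix (kron Q2 Q1)"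
  by (simp add: orthogonal_matrix transpose_kron kron_mult kron_mat_1)

text \<open>The matrix \<open>M1\<close> of \<open>R_op\<close>. The swapped indices in
  \<open>block C j i\<close> make its trace pairing with \<open>Y\<close> equal to the pairing of
  \<open>C\<close> with \<open>kron X Y\<close>. At \<open>X = mat 1\<close> it is the partial trace
  \<open>tr1\<close>.\<close>

definition contract2 :: "real^('b::finite \<times> 'a::finite)^('b \<times> 'a) \<Rightarrow> real^'b^'b \<Rightarrow> real^'a^'a"
  where "contract2 C X = (\<Sum>i\<in>UNIV. \<Sum>j\<in>UNIV. (X $ i $ j) *\<^sub>R block C j i)"

text \<open>The matrix \<open>M2\<close> of \<open>R_op\<close>, the corresponding adjoint in the
  other factor; at \<open>Y = mat 1\<close> it is \<open>tr2\<close>.\<close>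

definition contract1 :: "real^('b::finite \<times> 'a::finite)^('b \<times> 'a) \<Rightarrow> real^'a^'a \<Rightarrow> real^'b^'b"
  where "contract1 C Y = (\<chi> i j. trace (block C i j ** Y))"

lemma trace_mult_kron:
  "trace (C ** kron X Y) = (\<Sum>i\<in>UNIV. \<Sum>k\<in>UNIV. \<Sum>j\<in>UNIV. \<Sum>l\<in>UNIV. C $ (i, k) $ (j, l) * (X $ j $ i * Y $ l $ k))"
  by (simp add: trace_mult_eq sum_UNIV_prod kron_nth)

lemma contract2_nth: "contract2 C X $ k $ l = (\<Sum>j\<in>UNIV. \<Sum>i\<in>UNIV. X $ j $ i * C $ (i, k) $ (j, l))"
  by (simp add: contract2_def block_def)

lemma trace_contract2: "trace (contract2 C X ** Y) = trace (C ** kron X Y)"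
proof -
  have "trace (contract2 C X ** Y) = (\<Sum>k\<in>UNIV. \<Sum>l\<in>UNIV. \<Sum>j\<in>UNIV. \<Sum>i\<in>UNIV. C $ (i, k) $ (j, l) * (X $ j $ i * Y $ l $ k))"
    by (simp add: trace_mult_eq contract2_nth sum_distrib_left sum_distrib_right mult_ac)
  also have "\<dots> = (\<Sum>k\<in>UNIV. \<Sum>i\<in>UNIV. \<Sum>l\<in>UNIV. \<Sum>j\<in>UNIV. C $ (i, k) $ (j, l) * (X $ j $ i * Y $ l $ k))"
  proof (rule sum.cong[OF refl])
    fix k
    have "(\<Sum>l\<in>UNIV. \<Sum>j\<in>UNIV. \<Sum>i\<in>UNIV. C $ (i, k) $ (j, l) * (X $ j $ i * Y $ l $ k))
      = (\<Sum>l\<in>UNIV. \<Sum>i\<in>UNIV. \<Sum>j\<in>UNIV. C $ (i, k) $ (j, l) * (X $ j $ i * Y $ l $ k))"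
      by (rule sum.cong[OF refl], rule sum.swap)
    also have "\<dots> = (\<Sum>i\<in>UNIV. \<Sum>l\<in>UNIV. \<Sum>j\<in>UNIV. C $ (i, k) $ (j, l) * (X $ j $ i * Y $ l $ k))"
      by (rule sum.swap)
    finally show "(\<Sum>l\<in>UNIV. \<Sum>j\<in>UNIV. \<Sum>i\<in>UNIV. C $ (i, k) $ (j, l) * (X $ j $ i * Y $ l $ k))
      = (\<Sum>i\<in>UNIV. \<Sum>l\<in>UNIV. \<Sum>j\<in>UNIV. C $ (i, k) $ (j, l) * (X $ j $ i * Y $ l $ k))" .
  qed
  also have "\<dots> = (\<Sum>i\<in>UNIV. \<Sum>k\<in>UNIV. \<Sum>l\<in>UNIV. \<Sum>j\<in>UNIV. C $ (i, k) $ (j, l) * (X $ j $ i * Y $ l $ k))"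
    by (rule sum.swap)
  also have "\<dots> = trace (C ** kron X Y)" unfolding trace_mult_kron
    by (intro sum.cong refl) (rule sum.swap)
  finally show ?thesis .
qed

lemma trace_contract1: "trace (contract1 C Y ** X) = trace (C ** kron X Y)"
proof -
  have "trace (contract1 C Y ** X) = (\<Sum>i\<in>UNIV. \<Sum>j\<in>UNIV. \<Sum>k\<in>UNIV. \<Sum>l\<in>UNIV. C $ (i, k) $ (j, l) * (X $ j $ i * Y $ l $ k))"
    by (simp add: trace_mult_eq contract1_def block_def sum_distrib_left sum_distrib_right mult_ac)
  also have "\<dots> = trace (C ** kron X Y)" unfolding trace_mult_kron
    by (intro sum.cong refl) (rule sum.swap)
  finally show ?thesis .
qed

lemma contract2_eqI: "(\<And>Y. trace (C ** kron X Y) = trace (M ** Y)) \<Longrightarrow> contract2 C X = M"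
  by (rule trace_form_nondegenerate) (simp add: trace_contract2)

lemma contract1_eqI: "(\<And>X. trace (C ** kron X Y) = trace (M ** X)) \<Longrightarrow> contract1 C Y = M"
  by (rule trace_form_nondegenerate) (simp add: trace_contract1)

lemma contract2_mat_1: "contract2 C (mat 1) = tr1 C"
  by (simp add: contract2_def tr1_def mat_def if_distrib[of "\<lambda>x. x *\<^sub>R _"] cong: if_cong)

lemma contract1_mat_1: "contract1 C (mat 1) = tr2 C"
  by (simp add: contract1_def tr2_def)

lemma bounded_bilinear_contract2:
  "bounded_bilinear (contract2 :: real^('b::finite \<times> 'a::finite)^('b \<times> 'a) \<Rightarrow> _)"
  unfolding bilinear_conv_bounded_bilinear[symmetric] bilinear_def
  by (intro conjI allI linearI)
     (simp_all add: contract2_nth vec_eq_iff algebra_simps sum.distrib sum_distrib_left)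

lemma bounded_bilinear_contract1:
  "bounded_bilinear (contract1 :: real^('b::finite \<times> 'a::finite)^('b \<times> 'a) \<Rightarrow> _)"
  unfolding bilinear_conv_bounded_bilinear[symmetric] bilinear_def
  by (intro conjI allI linearI)
     (simp_all add: contract1_def trace_mult_eq block_def vec_eq_iff algebra_simps sum.distrib sum_distrib_left)

interpretation contract2: bounded_bilinear
  "contract2 :: real^('b::finite \<times> 'a::finite)^('b \<times> 'a) \<Rightarrow> real^'b^'b \<Rightarrow> real^'a^'a"
  by (rule bounded_bilinear_contract2)

interpretation contract1: bounded_bilinear
  "contract1 :: real^('b::finite \<times> 'a::finite)^('b \<times> 'a) \<Rightarrow> real^'a^'a \<Rightarrow> real^'b^'b"
  by (rule bounded_bilinear_contract1)

lemma trace_mult_sym_transpose: "trace (transpose A ** transpose B) = trace (A ** (B::real^'n^'m))"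
  using trace_mul_sym[of A B] trace_transpose[of "B ** A"] by (simp add: matrix_transpose_mul)

lemma transpose_contract2:
  "transpose (contract2 C X) = contract2 (transpose C) (transpose X)"
  by (rule contract2_eqI[symmetric])
     (metis trace_contract2 trace_mult_sym_transpose transpose_kron transpose_transpose)

lemma transpose_contract1:
  "transpose (contract1 C Y) = contract1 (transpose C) (transpose Y)"
  by (rule contract1_eqI[symmetric])
     (metis trace_contract1 trace_mult_sym_transpose transpose_kron transpose_transpose)

section \<open>Minimizers of the Kronecker objective\<close>

text \<open>The stationarity equations of the objective at the identity; for positive definite
  \<open>C\<close> they turn out to describe the core matrices.\<close>

definition balanced :: "real^('b::finite \<times> 'a::finite)^('b \<times> 'a) \<Rightarrow> bool"
  where "balanced C \<longleftrightarrow> tr1 C = real CARD('b) *\<^sub>R mat 1 \<and> tr2 C = real CARD('a) *\<^sub>R mat 1"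

lemma balanced_trace:
  fixes C :: "real^('b::finite \<times> 'a::finite)^('b \<times> 'a)"
  assumes "balanced C"
  shows "trace (C ** kron (mat 1) Y) = real CARD('b) * trace Y"
    "trace (C ** kron X (mat 1)) = real CARD('a) * trace X"
  using trace_contract2[of C "mat 1" Y] trace_contract1[of C "mat 1" X] assms
  by (simp_all add: contract2_mat_1 contract1_mat_1 balanced_def matrix_mult.scaleR_left trace_scaleR)

text \<open>Rotations of the two factors preserve their traces, hence also the balance conditions
  read as pairings with \<open>kron\<close>. This lets \<open>balanced_minimal\<close> diagonalize
  both factors.\<close>

lemma balanced_orthogonal_conj:
  fixes C :: "real^('b::finite \<times> 'a::finite)^('b \<times> 'a)"
  assumes C: "balanced C" and Q: "orthogonal_matrix Q2" "orthogonal_matrix Q1"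
  shows "balanced (transpose (kron Q2 Q1) ** C ** kron Q2 Q1)"
proof -
  have rot: "trace (transpose (kron Q2 Q1) ** C ** kron Q2 Q1 ** kron X Y)
      = trace (C ** kron (Q2 ** X ** transpose Q2) (Q1 ** Y ** transpose Q1))" for X Y
    using trace_mul_sym[of "transpose (kron Q2 Q1)" "C ** kron Q2 Q1 ** kron X Y"]
    by (simp add: kron_conj matrix_mul_assoc)
  have tr: "trace (Q1 ** Y ** transpose Q1) = trace Y" "trace (Q2 ** X ** transpose Q2) = trace X" for X Y
    using trace_mult_rotate[of Q1 Y "transpose Q1"] trace_mult_rotate[of Q2 X "transpose Q2"]
    by (simp_all add: orthogonal_matrix_mult_transpose Q)
  show ?thesis unfolding balanced_def contract2_mat_1[symmetric] contract1_mat_1[symmetric]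
    by (intro conjI contract2_eqI contract1_eqI)
       (simp_all add: rot orthogonal_matrix_mult_transpose Q balanced_trace[OF C] tr
         matrix_mult.scaleR_left trace_scaleR)
qed

text \<open>The congruence cancels inside the trace and multiplies the determinants by squares. The
  objectives thus differ by a constant independent of \<open>K2\<close> and \<open>K1\<close>, and
  minimizers correspond.\<close>

lemma kron_objective_conj:
  fixes \<Sigma> :: "real^('b::finite \<times> 'a::finite)^('b \<times> 'a)"
  assumes A: "invertible A2" "invertible A1" and K: "K2 \<in> spd_mats" "K1 \<in> spd_mats"
  shows "kron_objective (kron A2 A1 ** \<Sigma> ** transpose (kron A2 A1)) (A2 ** K2 ** transpose A2) (A1 ** K1 ** transpose A1)
    = kron_objective \<Sigma> K2 K1 + real CARD('a) * ln ((det A2)\<^sup>2) + real CARD('b) * ln ((det A1)\<^sup>2)"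
proof -
  let ?A = "kron A2 A1" and ?K = "kron K2 K1"
  have iA: "invertible ?A" and iK: "invertible ?K"
    using A K by (simp_all add: invertible_kron spd_invertible)
  have "matrix_inv (?A ** ?K ** transpose ?A) = transpose (matrix_inv ?A) ** matrix_inv ?K ** matrix_inv ?A"
    by (simp add: matrix_inv_mult invertible_mult iA iK transpose_invertible matrix_inv_transpose matrix_mul_assoc)
  then have "trace (?A ** \<Sigma> ** transpose ?A ** matrix_inv (?A ** ?K ** transpose ?A))
      = trace (?A ** (\<Sigma> ** transpose (matrix_inv ?A ** ?A) ** matrix_inv ?K ** matrix_inv ?A))"
    by (simp add: matrix_mul_assoc matrix_transpose_mul)
  also have "\<dots> = trace (\<Sigma> ** matrix_inv ?K ** (matrix_inv ?A ** ?A))"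
    by (subst trace_mul_sym) (simp add: matrix_mul_assoc matrix_inv_right_cancel[OF iA] matrix_inv_left[OF iA])
  finally have tr: "trace (?A ** \<Sigma> ** transpose ?A ** matrix_inv (?A ** ?K ** transpose ?A)) = trace (\<Sigma> ** matrix_inv ?K)"
    by (simp add: matrix_inv_left[OF iA])
  have ld: "ln (det (B ** M ** transpose B)) = ln ((det B)\<^sup>2) + ln (det M)"
    if "invertible B" "M \<in> spd_mats" for B M :: "real^'n^'n"
  proof -
    have "(det B)\<^sup>2 > 0" using that(1) by (simp add: invertible_det_nz)
    from ln_mult_pos[OF this spd_det_pos[OF that(2)]] show ?thesis
      by (simp add: det_mul power2_eq_square mult_ac)
  qed
  show ?thesis unfolding kron_objective_def kron_conj tr ld[OF A(1) K(1)] ld[OF A(2) K(2)]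
    by (simp add: algebra_simps)
qed

lemma ln_prod_pos:
  fixes f :: "'n::finite \<Rightarrow> real"
  assumes "\<And>i. f i > 0"
  shows "ln (\<Prod>i\<in>UNIV. f i) = (\<Sum>i\<in>UNIV. ln (f i))"
  using assms by (intro ln_prod) (auto simp: less_imp_neq[symmetric])

lemma exp_eq_one_plus_imp_zero: "exp (x::real) \<le> 1 + x \<Longrightarrow> x = 0"
  using ln_eq_minus_one[of "exp x"] exp_ge_add_one_self[of x] by (metis add_diff_cancel_left' antisym exp_eq_one_iff exp_gt_zero ln_exp)

text \<open>
  In eigenbases of \<open>K2\<close> and \<open>K1\<close> the objective is a positive combination of exponentials minus
  its linearization, so that \<open>exp x \<ge> 1 + x\<close> gives minimality and uniqueness at once.
\<close>

lemma balanced_minimal: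
  fixes C :: "real^('b::finite \<times> 'a::finite)^('b \<times> 'a)"
  assumes C: "C \<in> spd_mats" "balanced C" and K: "K2 \<in> spd_mats" "K1 \<in> spd_mats"
  shows "kron_objective C (mat 1) (mat 1) \<le> kron_objective C K2 K1"
    "kron_objective C K2 K1 \<le> kron_objective C (mat 1) (mat 1) \<Longrightarrow> kron K2 K1 = mat 1"
proof -
  obtain Q2 d2 where Q2: "orthogonal_matrix Q2" "\<And>i. d2 i > 0" "K2 = Q2 ** diag_mat d2 ** transpose Q2"
    by (rule spd_spectral[OF K(1)]) blast
  obtain Q1 d1 where Q1: "orthogonal_matrix Q1" "\<And>i. d1 i > 0" "K1 = Q1 ** diag_mat d1 ** transpose Q1"
    by (rule spd_spectral[OF K(2)]) blast
  define Q where "Q = kron Q2 Q1"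
  have Q: "orthogonal_matrix Q" unfolding Q_def by (rule orthogonal_matrix_kron[OF Q2(1) Q1(1)])
  define e where "e p = d2 (fst p) * d1 (snd p)" for p
  have e: "e p > 0" for p by (simp add: e_def Q2 Q1)
  have K_eq: "kron K2 K1 = Q ** diag_mat e ** transpose Q"
    by (simp add: Q2(3) Q1(3) kron_conj Q_def kron_diag_mat e_def[abs_def])
  have "diag_mat e ** diag_mat (\<lambda>p. inverse (e p)) = mat 1"
    using e by (simp add: diag_mat_mult diag_mat_1 less_imp_neq[symmetric])
  then have iK: "matrix_inv (kron K2 K1) = Q ** diag_mat (\<lambda>p. inverse (e p)) ** transpose Q"
    unfolding K_eq by (intro matrix_inv_eqI) (simp add: orthogonal_conj_mult[OF Q] orthogonal_matrix_mult_transpose[OF Q])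
  \<comment> \<open>In the joint eigenbasis only the diagonal of the rotated \<open>C\<close> enters
    the objective.\<close>
  define c where "c = transpose Q ** C ** Q"
  have bal: "balanced c" unfolding c_def Q_def by (rule balanced_orthogonal_conj[OF C(2) Q2(1) Q1(1)])
  have "transpose Q ** C ** transpose (transpose Q) \<in> spd_mats"
    by (intro spd_congruence C transpose_invertible orthogonal_matrix_invertible Q)
  then have c: "c $ p $ p > 0" for p using spd_diag_pos unfolding c_def by simp
  have tr: "trace (C ** matrix_inv (kron K2 K1)) = (\<Sum>p\<in>UNIV. c $ p $ p * exp (- ln (e p)))"
  proof -
    have "trace (C ** matrix_inv (kron K2 K1)) = trace (c ** diag_mat (\<lambda>p. inverse (e p)))"
      using trace_mult_rotate[of "C ** Q" "diag_mat (\<lambda>p. inverse (e p))" "transpose Q"]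
      by (simp add: iK c_def matrix_mul_assoc)
    also have "\<dots> = (\<Sum>p\<in>UNIV. c $ p $ p * exp (- ln (e p)))"
      using e by (simp add: trace_def mult_diag_mat_nth exp_minus)
    finally show ?thesis .
  qed
  have trC: "trace C = (\<Sum>p\<in>UNIV. c $ p $ p)"
    using trace_mult_rotate[of C Q "transpose Q"]
    by (simp add: c_def trace_def[symmetric] matrix_mul_assoc[symmetric] orthogonal_matrix_mult_transpose[OF Q])
  have row: "(\<Sum>k\<in>UNIV. c $ (i, k) $ (i, k)) = real CARD('a)" for i
    using arg_cong[OF conjunct2[OF bal[unfolded balanced_def]], of "\<lambda>M. M $ i $ i"]
    by (simp add: tr2_def trace_def block_def mat_def)
  have col: "(\<Sum>i\<in>UNIV. c $ (i, k) $ (i, k)) = real CARD('b)" for k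
    using arg_cong[OF conjunct1[OF bal[unfolded balanced_def]], of "\<lambda>M. M $ k $ k"]
    by (simp add: tr1_def block_def mat_def)
  \<comment> \<open>Balance fixes the sums of the diagonal of \<open>c\<close> within each block and
    across the blocks. This turns the two log-determinants into one sum with the same weights as the
    trace term.\<close>
  have "(\<Sum>p\<in>UNIV. c $ p $ p * ln (e p)) =
      (\<Sum>i\<in>UNIV. \<Sum>k\<in>UNIV. ln (d2 i) * c $ (i, k) $ (i, k)) + (\<Sum>i\<in>UNIV. \<Sum>k\<in>UNIV. ln (d1 k) * c $ (i, k) $ (i, k))"
    using Q1(2) Q2(2) by (simp add: sum_UNIV_prod e_def ln_mult_pos distrib_left sum.distrib mult.commute)
  also have "(\<Sum>i\<in>UNIV. \<Sum>k\<in>UNIV. ln (d1 k) * c $ (i, k) $ (i, k)) = (\<Sum>k\<in>UNIV. \<Sum>i\<in>UNIV. ln (d1 k) * c $ (i, k) $ (i, k))"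
    by (rule sum.swap)
  finally have lin: "(\<Sum>p\<in>UNIV. c $ p $ p * ln (e p)) = real CARD('a) * ln (det K2) + real CARD('b) * ln (det K1)"
    using Q1(2) Q2(2)
    by (simp add: sum_distrib_left[symmetric] row col Q2(3) Q1(3) det_orthogonal_conj Q2(1) Q1(1) det_diag_mat ln_prod_pos
        sum_distrib_right[symmetric] mult.commute)
  have diff: "kron_objective C K2 K1 - kron_objective C (mat 1) (mat 1) =
      (\<Sum>p\<in>UNIV. c $ p $ p * (exp (- ln (e p)) - (1 + - ln (e p))))"
    unfolding kron_objective_def tr
    by (simp add: kron_mat_1 matrix_inv_mat_1 trC lin[symmetric] algebra_simps sum.distrib sum_subtractf)
  have nn: "c $ p $ p * (exp (- ln (e p)) - (1 + - ln (e p))) \<ge> 0" for p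
    using c[of p] exp_ge_add_one_self[of "- ln (e p)"] by (intro mult_nonneg_nonneg) auto
  show "kron_objective C (mat 1) (mat 1) \<le> kron_objective C K2 K1"
    using diff sum_nonneg[of UNIV "\<lambda>p. c $ p $ p * (exp (- ln (e p)) - (1 + - ln (e p)))"] nn by simp
  assume "kron_objective C K2 K1 \<le> kron_objective C (mat 1) (mat 1)"
  then have le: "(\<Sum>p\<in>UNIV. c $ p $ p * (exp (- ln (e p)) - (1 + - ln (e p)))) \<le> 0" using diff by simp
  have "e p = 1" for p
  proof -
    have "c $ p $ p * (exp (- ln (e p)) - (1 + - ln (e p))) \<le> (\<Sum>p\<in>UNIV. c $ p $ p * (exp (- ln (e p)) - (1 + - ln (e p))))"
      using nn by (intro member_le_sum) auto
    then have "c $ p $ p * (exp (- ln (e p)) - (1 + - ln (e p))) \<le> 0" using le by linarith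
    then have "exp (- ln (e p)) \<le> 1 + - ln (e p)" using c[of p] by (simp add: mult_le_0_iff)
    then have "- ln (e p) = 0" by (rule exp_eq_one_plus_imp_zero)
    then show ?thesis using e[of p] by simp
  qed
  then have "e = (\<lambda>p. 1)" by (rule ext)
  then have "diag_mat e = mat 1" by (simp add: diag_mat_1)
  then show "kron K2 K1 = mat 1" by (simp add: K_eq orthogonal_matrix_mult_transpose[OF Q])
qed

text \<open>The test matrix \<open>K = S / n\<close> is the actual minimizer of the right-hand side,
  and the left-hand side is its value at the identity. The comparison bounds a sum of terms
  \<open>y - 1 - ln y\<close>, all nonnegative, by 0, where \<open>y\<close> runs through the
  eigenvalues of \<open>S / n\<close>.\<close>

lemma log_det_minimizer_scalar:
  fixes S :: "real^'n^'n"
  assumes S: "S \<in> spd_mats" and n: "n > 0"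
    and min: "\<And>K. K \<in> spd_mats \<Longrightarrow> trace S \<le> trace (S ** matrix_inv K) + n * ln (det K)"
  shows "S = n *\<^sub>R mat 1"
proof -
  obtain Q d where Q: "orthogonal_matrix Q" "\<And>i. d i > 0" "S = Q ** diag_mat d ** transpose Q"
    by (rule spd_spectral[OF S]) blast
  define y where "y i = d i / n" for i
  have y: "y i > 0" for i using Q(2) n by (simp add: y_def)
  have Sy: "S = n *\<^sub>R (Q ** diag_mat y ** transpose Q)"
  proof -
    have "diag_mat d = n *\<^sub>R diag_mat y" using n by (simp add: vec_eq_iff diag_mat_nth y_def)
    then show ?thesis by (simp add: Q(3) matrix_mult.scaleR_left matrix_mult.scaleR_right)
  qed
  define K where "K = Q ** diag_mat y ** transpose Q"
  have K: "K \<in> spd_mats" unfolding K_def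
    by (intro spd_congruence orthogonal_matrix_invertible Q) (simp add: diag_mat_spd_iff y)
  have SK: "S = n *\<^sub>R K" by (simp add: Sy K_def)
  have "trace (S ** matrix_inv K) = n * real CARD('n)"
    by (simp add: SK matrix_mult.scaleR_left trace_scaleR matrix_inv_right[OF spd_invertible[OF K]] trace_I)
  moreover have "ln (det K) = (\<Sum>i\<in>UNIV. ln (y i))"
    using y by (simp add: K_def det_orthogonal_conj[OF Q(1)] det_diag_mat ln_prod_pos)
  moreover have "trace S = n * (\<Sum>i\<in>UNIV. y i)"
  proof -
    have "trace K = trace (diag_mat y)"
      using trace_mult_rotate[of Q "diag_mat y" "transpose Q"] by (simp add: K_def orthogonal_matrix_mult_transpose Q)
    then show ?thesis by (simp add: SK trace_scaleR) (simp add: trace_def diag_mat_nth)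
  qed
  ultimately have "n * (\<Sum>i\<in>UNIV. y i) \<le> n * (real CARD('n) + (\<Sum>i\<in>UNIV. ln (y i)))"
    using min[OF K] by (simp add: distrib_left)
  then have le: "(\<Sum>i\<in>UNIV. y i - 1 - ln (y i)) \<le> 0"
    using n by (simp add: sum_subtractf)
  have nn: "y i - 1 - ln (y i) \<ge> 0" for i using ln_le_minus_one[OF y[of i]] by simp
  have "y i = 1" for i
  proof -
    have "y i - 1 - ln (y i) \<le> (\<Sum>i\<in>UNIV. y i - 1 - ln (y i))" using nn by (intro member_le_sum) auto
    then have "ln (y i) = y i - 1" using le nn[of i] by linarith
    then show ?thesis by (rule ln_eq_minus_one[OF y])
  qed
  then have "y = (\<lambda>i. 1)" by (rule ext)
  then have "diag_mat y = mat 1" by (simp add: diag_mat_1)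
  then have "K = mat 1" by (simp add: K_def orthogonal_matrix_mult_transpose Q)
  then show ?thesis by (simp add: SK)
qed

lemma spd_nonzero: "A \<in> spd_mats \<Longrightarrow> A \<noteq> 0"
  using spd_diag_pos[of A] by fastforce

text \<open>Matrices \<open>X\<close> with a single nonzero column \<open>x\<close> suffice, as
  \<open>X ** transpose X\<close> is then the outer product of \<open>x\<close> with itself. Partial
  traces are accessible through trace pairings, so their positivity is checked in this form.\<close>

lemma spdI_trace:
  fixes S :: "real^'n^'n"
  assumes "transpose S = S" and pos: "\<And>X :: real^'n^'n. X \<noteq> 0 \<Longrightarrow> trace (S ** (X ** transpose X)) > 0"
  shows "S \<in> spd_mats"
proof -
  have "x \<bullet> (S *v x) > 0" if x: "x \<noteq> 0" for x
  proof -
    obtain k0 :: 'n where "x $ k0 \<noteq> 0" using x by (auto simp: vec_eq_iff)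
    define X where "X = (\<chi> i j. if j = k0 then x $ i else 0)"
    have "X $ k0 $ k0 \<noteq> 0" using \<open>x $ k0 \<noteq> 0\<close> by (simp add: X_def)
    then have "X \<noteq> 0" by auto
    moreover have "(X ** transpose X) $ i $ j = x $ i * x $ j" for i j
      by (simp add: X_def matrix_matrix_mult_def transpose_def if_distrib[of "\<lambda>y. y * _"] cong: if_cong)
    then have "trace (S ** (X ** transpose X)) = x \<bullet> (S *v x)"
      by (simp add: trace_mult_eq inner_vec_def matrix_vector_mult_def sum_distrib_left mult_ac)
    ultimately show ?thesis using pos[of X] by simp
  qed
  then show ?thesis using assms(1) by (simp add: spd_mats_def)
qed

lemma trace_kron_gram_pos:
  fixes X :: "real^'b^'b" and Y :: "real^'a^'a"
  assumes "C \<in> spd_mats" "X \<noteq> 0" "Y \<noteq> 0"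
  shows "trace (C ** kron (X ** transpose X) (Y ** transpose Y)) > 0"
  using trace_congruence_pos[OF assms(1) kron_nonzero[OF assms(2,3)]]
    trace_mult_rotate[of C "kron X Y" "transpose (kron X Y)"]
  by (simp add: kron_gram matrix_mul_assoc)

lemma mat_1_nonzero: "(mat 1 :: real^'n^'n) \<noteq> 0"
proof
  assume "(mat 1 :: real^'n^'n) = 0"
  then have "(mat 1 :: real^'n^'n) $ i $ i = 0" for i by simp
  then show False by (simp add: mat_def)
qed

lemma spd_tr1: "C \<in> spd_mats \<Longrightarrow> tr1 C \<in> spd_mats"
  using trace_kron_gram_pos[of C "mat 1"]
  by (intro spdI_trace)
     (simp_all add: contract2_mat_1[symmetric] transpose_contract2 spd_sym trace_contract2 mat_1_nonzero)

lemma spd_tr2: "C \<in> spd_mats \<Longrightarrow> tr2 C \<in> spd_mats"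
  using trace_kron_gram_pos[of C _ "mat 1"]
  by (intro spdI_trace)
     (simp_all add: contract1_mat_1[symmetric] transpose_contract1 spd_sym trace_contract1 mat_1_nonzero)

text \<open>Varying one factor while the other stays at the identity reduces each of the two
  equations to a log-determinant problem for one partial trace.\<close>

lemma minimal_balanced:
  fixes C :: "real^('b::finite \<times> 'a::finite)^('b \<times> 'a)"
  assumes C: "C \<in> spd_mats"
    and min: "\<And>K2 K1. K2 \<in> spd_mats \<Longrightarrow> K1 \<in> spd_mats \<Longrightarrow>
      kron_objective C (mat 1) (mat 1) \<le> kron_objective C K2 K1"
  shows "balanced C"
proof -
  have tr: "trace (C ** kron (mat 1) Y) = trace (tr1 C ** Y)" "trace (C ** kron X (mat 1)) = trace (tr2 C ** X)" for X Y
    using trace_contract2[of C "mat 1" Y] trace_contract1[of C "mat 1" X]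
    by (simp_all add: contract2_mat_1 contract1_mat_1)
  have tr': "trace (tr1 C) = trace C" "trace (tr2 C) = trace C"
    using tr(1)[of "mat 1"] tr(2)[of "mat 1"] by (simp_all add: kron_mat_1)
  have "tr1 C = real CARD('b) *\<^sub>R mat 1"
  proof (rule log_det_minimizer_scalar[OF spd_tr1[OF C]])
    fix K :: "real^'a^'a" assume K: "K \<in> spd_mats"
    show "trace (tr1 C) \<le> trace (tr1 C ** matrix_inv K) + real CARD('b) * ln (det K)"
      using min[OF spd_mat_1 K] K unfolding kron_objective_def
      by (simp add: kron_mat_1 matrix_inv_mat_1 matrix_inv_kron spd_invertible spd_mat_1 tr tr')
  qed simp
  moreover have "tr2 C = real CARD('a) *\<^sub>R mat 1"
  proof (rule log_det_minimizer_scalar[OF spd_tr2[OF C]])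
    fix K :: "real^'b^'b" assume K: "K \<in> spd_mats"
    show "trace (tr2 C) \<le> trace (tr2 C ** matrix_inv K) + real CARD('a) * ln (det K)"
      using min[OF K spd_mat_1] K unfolding kron_objective_def
      by (simp add: kron_mat_1 matrix_inv_mat_1 matrix_inv_kron spd_invertible spd_mat_1 tr tr')
  qed simp
  ultimately show ?thesis by (simp add: balanced_def)
qed

section \<open>Existence of a minimizer\<close>

lemma det_scaleR: "det (c *\<^sub>R (A :: real^'n^'n)) = c ^ CARD('n) * det A"
proof -
  have "c *\<^sub>R A = diag_mat (\<lambda>i. c) ** A" by (simp add: vec_eq_iff diag_mat_mult_nth)
  then show ?thesis by (simp add: det_mul det_diag_mat)
qed

lemma continuous_on_det: "continuous_on S (det :: real^'n^'n \<Rightarrow> real)"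
  unfolding det_def[abs_def] by (intro continuous_intros)

text \<open>Writing the inverses of the factors as Gram matrices makes the trace term and the
  argument of the logarithm polynomial in \<open>B2\<close> and \<open>B1\<close>. Both stay
  continuous at singular matrices, which the compactness argument has to include.\<close>

lemma kron_objective_gram:
  fixes \<Sigma> :: "real^('b::finite \<times> 'a::finite)^('b \<times> 'a)"
  assumes B: "invertible (B2 :: real^'b^'b)" "invertible (B1 :: real^'a^'a)"
  shows "kron_objective \<Sigma> (matrix_inv (B2 ** transpose B2)) (matrix_inv (B1 ** transpose B1)) =
    trace (transpose (kron B2 B1) ** \<Sigma> ** kron B2 B1)
      - ln (det B2 ^ (2 * CARD('a)) * det B1 ^ (2 * CARD('b)))"
proof -
  have inv: "invertible (B2 ** transpose B2)" "invertible (B1 ** transpose B1)"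
    using B by (simp_all add: spd_invertible spd_gram)
  have d: "det B2 \<noteq> 0" "det B1 \<noteq> 0" using B by (simp_all add: invertible_det_nz)
  have ld: "ln (det (matrix_inv (B ** transpose B))) = - ln ((det B)\<^sup>2)" if "invertible B" for B :: "real^'n^'n"
  proof -
    have "invertible (B ** transpose B)" using that by (simp add: spd_invertible spd_gram)
    from arg_cong[OF matrix_inv_right[OF this], of det]
    have "(det B)\<^sup>2 * det (matrix_inv (B ** transpose B)) = 1" by (simp add: det_mul power2_eq_square)
    then have "det (matrix_inv (B ** transpose B)) = inverse ((det B)\<^sup>2)"
      using that by (simp add: invertible_det_nz field_simps)
    then show ?thesis by (simp add: ln_inverse)
  qed
  have "trace (\<Sigma> ** matrix_inv (kron (matrix_inv (B2 ** transpose B2)) (matrix_inv (B1 ** transpose B1))))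
      = trace (transpose (kron B2 B1) ** \<Sigma> ** kron B2 B1)"
    using trace_mult_rotate[of \<Sigma> "kron B2 B1" "transpose (kron B2 B1)"]
    by (simp add: matrix_inv_kron inv invertible_matrix_inv matrix_inv_matrix_inv kron_gram matrix_mul_assoc)
  moreover have "ln (det B2 ^ (2 * CARD('a)) * det B1 ^ (2 * CARD('b)))
      = real CARD('a) * ln ((det B2)\<^sup>2) + real CARD('b) * ln ((det B1)\<^sup>2)"
    using d by (simp add: power_mult ln_mult_pos ln_realpow)
  ultimately show ?thesis unfolding kron_objective_def ld[OF B(1)] ld[OF B(2)] by simp
qed

text \<open>Optimization over the overall scale: by \<open>ln x \<le> x - 1\<close> the best value
  is \<open>s = p\<close>.\<close>

lemma sub_mult_ln_ge:
  assumes "(s::real) > 0" "p > 0"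
  shows "p - p * ln p \<le> s - p * ln s"
proof -
  have "ln (s / p) \<le> s / p - 1" using assms by (intro ln_le_minus_one) simp
  then have "p * (ln s - ln p) \<le> p * (s / p - 1)" using assms by (simp add: ln_div)
  then show ?thesis using assms by (simp add: algebra_simps)
qed

text \<open>
  Write the inverses of the factors as \<open>B B\<^sup>T\<close>. Optimizing over the overall scale first leaves
  a scale-invariant quotient, which attains its maximum on a product of two unit spheres.
\<close>

lemma kron_objective_has_minimizer:
  fixes \<Sigma> :: "real^('b::finite \<times> 'a::finite)^('b \<times> 'a)"
  assumes \<Sigma>: "\<Sigma> \<in> spd_mats"
  obtains K2 K1 where "K2 \<in> spd_mats" "K1 \<in> spd_mats"
    "\<And>K2' K1'. K2' \<in> spd_mats \<Longrightarrow> K1' \<in> spd_mats \<Longrightarrow> kron_objective \<Sigma> K2 K1 \<le> kron_objective \<Sigma> K2' K1'"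
proof -
  let ?p = "CARD('a) * CARD('b)"
  define F where "F B2 B1 = trace (transpose (kron B2 B1) ** \<Sigma> ** kron B2 B1)" for B2 :: "real^'b^'b" and B1 :: "real^'a^'a"
  define D where "D B2 B1 = det B2 ^ (2 * CARD('a)) * det B1 ^ (2 * CARD('b))" for B2 :: "real^'b^'b" and B1 :: "real^'a^'a"
  \<comment> \<open>Scaling the factors by \<open>c\<close> and \<open>d\<close> multiplies
    \<open>F\<close> by \<open>c\<^sup>2 * d\<^sup>2\<close> and \<open>D\<close> by the
    \<open>?p\<close>-th power of that, so this exponent makes the quotient invariant in each factor
    separately.\<close>
  define r where "r B2 B1 = D B2 B1 / F B2 B1 ^ ?p" for B2 B1
  have Fpos: "F B2 B1 > 0" if "B2 \<noteq> 0" "B1 \<noteq> 0" for B2 B1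
    unfolding F_def by (rule trace_congruence_pos[OF \<Sigma> kron_nonzero[OF that]])
  have Fs: "F (c *\<^sub>R B2) (d *\<^sub>R B1) = c\<^sup>2 * d\<^sup>2 * F B2 B1" for c d B2 B1
    by (simp add: F_def kron.scaleR_left kron.scaleR_right transpose_scalar matrix_mult.scaleR_left
        matrix_mult.scaleR_right trace_scaleR power2_eq_square mult_ac)
  have Ds: "D (c *\<^sub>R B2) (d *\<^sub>R B1) = (c\<^sup>2 * d\<^sup>2) ^ ?p * D B2 B1" for c d B2 B1
    by (simp add: D_def det_scaleR power_mult_distrib mult_ac flip: power_mult)
  have rs: "r (c *\<^sub>R B2) (d *\<^sub>R B1) = r B2 B1" if "c \<noteq> 0" "d \<noteq> 0" for c d B2 B1
    using that by (simp add: r_def Fs Ds power_mult_distrib)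
  have Dpos: "D B2 B1 > 0" if "invertible B2" "invertible B1" for B2 B1
    using that by (simp add: D_def invertible_det_nz power_mult)
  let ?S = "sphere (0::real^'b^'b) 1 \<times> sphere (0::real^'a^'a) 1"
  have "compact ?S" by (intro compact_Times compact_sphere)
  moreover have "(mat 1 /\<^sub>R norm (mat 1 :: real^'b^'b), mat 1 /\<^sub>R norm (mat 1 :: real^'a^'a)) \<in> ?S"
    by (simp add: mat_1_nonzero)
  then have "?S \<noteq> {}" by blast
  moreover have "continuous_on ?S (\<lambda>B. r (fst B) (snd B))"
  proof -
    have k: "continuous_on ?S (\<lambda>B. kron (fst B) (snd B))"
      by (intro kron.continuous_on continuous_intros)
    have d: "continuous_on ?S (\<lambda>B. det (fst B))" "continuous_on ?S (\<lambda>B. det (snd B))"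
      by (intro continuous_on_compose2[OF continuous_on_det[of UNIV]] continuous_intros subset_UNIV)+
    have "continuous_on ?S (\<lambda>B. F (fst B) (snd B))"
      unfolding F_def
      by (intro bounded_linear.continuous_on[OF bounded_linear_trace] matrix_mult.continuous_on
          bounded_linear.continuous_on[OF bounded_linear_transpose] k continuous_on_const)
    moreover have "F (fst B) (snd B) ^ ?p \<noteq> 0" if "B \<in> ?S" for B
    proof -
      have "fst B \<noteq> 0" "snd B \<noteq> 0" using that by (cases B, force)+
      then show ?thesis using Fpos[of "fst B" "snd B"] by simp
    qed
    ultimately show ?thesis unfolding r_def D_def by (intro continuous_intros d) auto
  qed
  ultimately obtain B where B: "B \<in> ?S" and mx: "\<And>B'. B' \<in> ?S \<Longrightarrow> r (fst B') (snd B') \<le> r (fst B) (snd B)"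
    using continuous_attains_sup[of ?S "\<lambda>B. r (fst B) (snd B)"] by blast
  define B2 B1 where "B2 = fst B" and "B1 = snd B"
  have B0: "B2 \<noteq> 0" "B1 \<noteq> 0" using B by (auto simp: B2_def B1_def)
  have max: "r C2 C1 \<le> r B2 B1" if "C2 \<noteq> 0" "C1 \<noteq> 0" for C2 C1
    using mx[of "(C2 /\<^sub>R norm C2, C1 /\<^sub>R norm C1)"] that rs[of "inverse (norm C2)" "inverse (norm C1)" C2 C1]
    by (simp add: B2_def B1_def)
  \<comment> \<open>A positive maximum rules out singular maximizers, at which \<open>D\<close>
    vanishes.\<close>
  have "0 < r (mat 1) (mat 1)"
    using Fpos[OF mat_1_nonzero mat_1_nonzero] by (simp add: r_def D_def)
  also have "\<dots> \<le> r B2 B1" by (rule max[OF mat_1_nonzero mat_1_nonzero])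
  finally have rpos: "0 < r B2 B1" .
  then have "det B2 \<noteq> 0" "det B1 \<noteq> 0" by (auto simp: r_def D_def power_0_left)
  then have iB: "invertible B2" "invertible B1" by (simp_all add: invertible_det_nz)
  \<comment> \<open>The scaling that brings \<open>F\<close> to \<open>?p\<close>, the optimal value
    in \<open>sub_mult_ln_ge\<close>.\<close>
  define s where "s = sqrt (real ?p / F B2 B1)"
  have s: "s > 0" "s\<^sup>2 * F B2 B1 = real ?p" using Fpos[OF B0] by (simp_all add: s_def)
  have iB': "invertible (s *\<^sub>R B2)" using iB(1) s(1) by (simp add: invertible_det_nz det_scaleR)
  define K2 where "K2 = matrix_inv ((s *\<^sub>R B2) ** transpose (s *\<^sub>R B2))"
  define K1 where "K1 = matrix_inv (B1 ** transpose B1)"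
  have Fq: "F (s *\<^sub>R B2) B1 = real ?p" using Fs[of s B2 1 B1] s(2) by simp
  have rq: "r (s *\<^sub>R B2) B1 = r B2 B1" using rs[of s 1 B2 B1] s(1) by simp
  have ln_D: "ln (D C2 C1) = ln (r C2 C1) + real ?p * ln (F C2 C1)" if "invertible C2" "invertible C1" "F C2 C1 > 0" for C2 C1
    using that Dpos[OF that(1,2)] by (simp add: r_def ln_div ln_realpow)
  have obj: "kron_objective \<Sigma> (matrix_inv (C2 ** transpose C2)) (matrix_inv (C1 ** transpose C1))
     = F C2 C1 - real ?p * ln (F C2 C1) - ln (r C2 C1)" if "invertible C2" "invertible C1" "F C2 C1 > 0" for C2 C1
    using kron_objective_gram[OF that(1,2), of \<Sigma>] ln_D[OF that] by (simp add: F_def D_def)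
  have min: "kron_objective \<Sigma> K2 K1 \<le> kron_objective \<Sigma> K2' K1'" if K: "K2' \<in> spd_mats" "K1' \<in> spd_mats" for K2' K1'
  proof -
    \<comment> \<open>Every competitor comes from Gram factors, for instance from the square roots
      of its inverses.\<close>
    define C2 C1 where "C2 = sym_sqrt (matrix_inv K2')" and "C1 = sym_sqrt (matrix_inv K1')"
    have spd: "C2 \<in> spd_mats" "C1 \<in> spd_mats" using K by (simp_all add: C2_def C1_def sym_sqrt_spd spd_matrix_inv)
    note iC = spd[THEN spd_invertible]
    have C0: "C2 \<noteq> 0" "C1 \<noteq> 0" using spd by (simp_all add: spd_nonzero)
    have "C2 ** transpose C2 = matrix_inv K2'" "C1 ** transpose C1 = matrix_inv K1'"
      unfolding spd_sym[OF spd(1)] spd_sym[OF spd(2)] using K by (simp_all add: C2_def C1_def sym_sqrt_square spd_matrix_inv)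
    then have K': "K2' = matrix_inv (C2 ** transpose C2)" "K1' = matrix_inv (C1 ** transpose C1)"
      using K by (simp_all add: matrix_inv_matrix_inv spd_invertible)
    have "r C2 C1 > 0" using Dpos[OF iC] Fpos[OF C0] by (simp add: r_def)
    then have "ln (r C2 C1) \<le> ln (r B2 B1)" using max[OF C0] by simp
    moreover have "real ?p - real ?p * ln (real ?p) \<le> F C2 C1 - real ?p * ln (F C2 C1)"
      by (rule sub_mult_ln_ge[OF Fpos[OF C0]]) simp
    moreover have "kron_objective \<Sigma> K2 K1 = real ?p - real ?p * ln (real ?p) - ln (r B2 B1)"
      unfolding K2_def K1_def by (subst obj[OF iB' iB(2)]) (simp_all only: Fq rq, simp)
    ultimately show ?thesis unfolding K' obj[OF iC Fpos[OF C0]] by linarith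
  qed
  have "K2 \<in> spd_mats" "K1 \<in> spd_mats"
    unfolding K2_def K1_def by (intro spd_matrix_inv spd_gram iB' iB)+
  then show ?thesis using that min by blast
qed

lemma kron_map_eqI:
  fixes C :: "real^('b::finite \<times> 'a::finite)^('b \<times> 'a)"
  assumes A: "invertible A2" "invertible A1" and C: "C \<in> spd_mats" "balanced C"
  shows "kron_map (kron A2 A1 ** C ** transpose (kron A2 A1)) = kron A2 A1 ** transpose (kron A2 A1)"
proof -
  let ?A = "kron A2 A1" let ?S = "?A ** C ** transpose ?A"
  let ?c = "real CARD('a) * ln ((det A2)\<^sup>2) + real CARD('b) * ln ((det A1)\<^sup>2)"
  have conj: "\<exists>K'\<in>spd_mats. K = B ** K' ** transpose B" if "invertible B" "K \<in> spd_mats" for B K :: "real^'n^'n"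
  proof
    show "matrix_inv B ** K ** transpose (matrix_inv B) \<in> spd_mats"
      by (intro spd_congruence invertible_matrix_inv that)
    have "B ** (matrix_inv B ** K ** transpose (matrix_inv B)) ** transpose B
        = (B ** matrix_inv B) ** K ** transpose (B ** matrix_inv B)"
      by (simp add: matrix_mul_assoc matrix_transpose_mul)
    then show "K = B ** (matrix_inv B ** K ** transpose (matrix_inv B)) ** transpose B"
      by (simp add: matrix_inv_right[OF that(1)])
  qed
  have obj: "kron_objective ?S (A2 ** K2 ** transpose A2) (A1 ** K1 ** transpose A1) = kron_objective C K2 K1 + ?c"
    if "K2 \<in> spd_mats" "K1 \<in> spd_mats" for K2 K1
    using kron_objective_conj[OF A that, of C] by simp
  have obj1: "kron_objective ?S (A2 ** transpose A2) (A1 ** transpose A1) = kron_objective C (mat 1) (mat 1) + ?c"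
    using obj[OF spd_mat_1 spd_mat_1] by simp
  have min: "kron_objective ?S (A2 ** transpose A2) (A1 ** transpose A1) \<le> kron_objective ?S K2 K1"
    if K: "K2 \<in> spd_mats" "K1 \<in> spd_mats" for K2 K1
  proof -
    obtain K2' K1' where "K2' \<in> spd_mats" "K2 = A2 ** K2' ** transpose A2" "K1' \<in> spd_mats" "K1 = A1 ** K1' ** transpose A1"
      using conj[OF A(1) K(1)] conj[OF A(2) K(2)] by blast
    then show ?thesis using balanced_minimal(1)[OF C, of K2' K1'] by (simp add: obj obj1)
  qed
  show ?thesis unfolding kron_map_def
  proof (rule the_equality)
    show "\<exists>K2\<in>spd_mats. \<exists>K1\<in>spd_mats. ?A ** transpose ?A = kron K2 K1 \<and>
       (\<forall>K2'\<in>spd_mats. \<forall>K1'\<in>spd_mats. kron_objective ?S K2 K1 \<le> kron_objective ?S K2' K1')"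
      by (intro bexI[of _ "A2 ** transpose A2"] bexI[of _ "A1 ** transpose A1"] conjI ballI min)
         (simp_all add: A spd_gram kron_gram)
  next
    fix K
    assume "\<exists>K2\<in>spd_mats. \<exists>K1\<in>spd_mats. K = kron K2 K1 \<and>
       (\<forall>K2'\<in>spd_mats. \<forall>K1'\<in>spd_mats. kron_objective ?S K2 K1 \<le> kron_objective ?S K2' K1')"
    then obtain K2 K1 where K: "K2 \<in> spd_mats" "K1 \<in> spd_mats" "K = kron K2 K1"
      "\<And>K2' K1'. K2' \<in> spd_mats \<Longrightarrow> K1' \<in> spd_mats \<Longrightarrow> kron_objective ?S K2 K1 \<le> kron_objective ?S K2' K1'"
      by blast
    obtain K2' K1' where K': "K2' \<in> spd_mats" "K2 = A2 ** K2' ** transpose A2" "K1' \<in> spd_mats" "K1 = A1 ** K1' ** transpose A1"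
      using conj[OF A(1) K(1)] conj[OF A(2) K(2)] by blast
    have "kron_objective C K2' K1' \<le> kron_objective C (mat 1) (mat 1)"
      using K(4)[OF spd_gram[OF A(1)] spd_gram[OF A(2)]] K' by (simp add: obj obj1)
    then have "kron K2' K1' = mat 1" using balanced_minimal(2)[OF C K'(1,3)] by blast
    then show "K = ?A ** transpose ?A" by (simp add: K(3) K' kron_conj)
  qed
qed

text \<open>Whitening by the square roots of a minimizer moves the minimizer to the identity, where
  minimality forces balance.\<close>

lemma kron_map_decomposition:
  fixes \<Sigma> :: "real^('b::finite \<times> 'a::finite)^('b \<times> 'a)"
  assumes \<Sigma>: "\<Sigma> \<in> spd_mats"
  obtains A2 A1 C where "A2 \<in> spd_mats" "A1 \<in> spd_mats" "C \<in> spd_mats" "balanced C"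
    "\<Sigma> = kron A2 A1 ** C ** kron A2 A1" "kron_map \<Sigma> = kron A2 A1 ** kron A2 A1"
proof -
  obtain K2 K1 where K: "K2 \<in> spd_mats" "K1 \<in> spd_mats"
    "\<And>K2' K1'. K2' \<in> spd_mats \<Longrightarrow> K1' \<in> spd_mats \<Longrightarrow> kron_objective \<Sigma> K2 K1 \<le> kron_objective \<Sigma> K2' K1'"
    using kron_objective_has_minimizer[OF \<Sigma>] by blast
  define A2 A1 where "A2 = sym_sqrt K2" and "A1 = sym_sqrt K1"
  have A: "A2 \<in> spd_mats" "A1 \<in> spd_mats" using K by (simp_all add: A2_def A1_def sym_sqrt_spd)
  note iA = A[THEN spd_invertible] and tA = A[THEN spd_sym]
  let ?A = "kron A2 A1"
  have ikA: "invertible ?A" by (rule invertible_kron[OF iA])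
  have tkA: "transpose ?A = ?A" by (simp add: transpose_kron tA)
  have AA: "A2 ** transpose A2 = K2" "A1 ** transpose A1 = K1"
    unfolding tA using K by (simp_all add: A2_def A1_def sym_sqrt_square)
  define C where "C = matrix_inv ?A ** \<Sigma> ** transpose (matrix_inv ?A)"
  have C: "C \<in> spd_mats" unfolding C_def by (intro spd_congruence \<Sigma> invertible_matrix_inv ikA)
  have "?A ** C ** transpose ?A = (?A ** matrix_inv ?A) ** \<Sigma> ** transpose (?A ** matrix_inv ?A)"
    by (simp add: C_def matrix_mul_assoc matrix_transpose_mul)
  then have \<Sigma>C: "?A ** C ** transpose ?A = \<Sigma>" by (simp add: matrix_inv_right[OF ikA])
  have "balanced C"
  proof (rule minimal_balanced[OF C])
    fix L2 :: "real^'b^'b" and L1 :: "real^'a^'a" assume L: "L2 \<in> spd_mats" "L1 \<in> spd_mats"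
    have "kron_objective \<Sigma> (A2 ** mat 1 ** transpose A2) (A1 ** mat 1 ** transpose A1) \<le>
        kron_objective \<Sigma> (A2 ** L2 ** transpose A2) (A1 ** L1 ** transpose A1)"
      unfolding matrix_mul_rid AA by (intro K spd_congruence L iA)
    then show "kron_objective C (mat 1) (mat 1) \<le> kron_objective C L2 L1"
      using kron_objective_conj[OF iA spd_mat_1 spd_mat_1, of C] kron_objective_conj[OF iA L, of C] \<Sigma>C by simp
  qed
  then show ?thesis using that[OF A C] kron_map_eqI[OF iA C] \<Sigma>C tkA by simp
qed

lemma kron_map_balanced: "C \<in> spd_mats \<Longrightarrow> balanced C \<Longrightarrow> kron_map C = mat 1"
  using kron_map_eqI[of "mat 1" "mat 1" C] by (simp add: kron_mat_1 spd_invertible spd_mat_1)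

text \<open>If the Kronecker part is the identity, the root \<open>kron A2 A1\<close> of the
  decomposition is a positive definite square root of \<open>mat 1\<close>, hence
  \<open>mat 1\<close> itself, and \<open>C\<close> coincides with its balanced core.\<close>

lemma core_mats_iff_balanced: "C \<in> core_mats \<longleftrightarrow> C \<in> spd_mats \<and> balanced C"
proof -
  have "balanced C" if C: "C \<in> spd_mats" "kron_map C = mat 1"
  proof -
    obtain A2 A1 D where D: "A2 \<in> spd_mats" "A1 \<in> spd_mats" "balanced D"
      "C = kron A2 A1 ** D ** kron A2 A1" "kron_map C = kron A2 A1 ** kron A2 A1"
      using kron_map_decomposition[OF C(1)] by blast
    then have "kron A2 A1 = mat 1" using C(2)
      by (intro spd_square_unique[OF spd_kron spd_mat_1]) simp_all
    then show ?thesis using D by simp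
  qed
  then show ?thesis using kron_map_balanced by (auto simp: core_mats_def)
qed

text \<open>The factors \<open>B2\<close>, \<open>B1\<close> are absorbed into the root from the
  decomposition of \<open>\<Sigma>\<close>: \<open>kron_map_eqI\<close> applies to
  \<open>B2 ** A2\<close> and \<open>B1 ** A1\<close> with the same core.\<close>

lemma kron_map_conj:
  fixes \<Sigma> :: "real^('b::finite \<times> 'a::finite)^('b \<times> 'a)"
  assumes \<Sigma>: "\<Sigma> \<in> spd_mats" and B: "invertible (B2 :: real^'b^'b)" "invertible (B1 :: real^'a^'a)"
  shows "kron_map (kron B2 B1 ** \<Sigma> ** transpose (kron B2 B1)) = kron B2 B1 ** kron_map \<Sigma> ** transpose (kron B2 B1)"
proof -
  obtain A2 A1 C where A: "A2 \<in> spd_mats" "A1 \<in> spd_mats" and C: "C \<in> spd_mats" "balanced C"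
    and \<Sigma>C: "\<Sigma> = kron A2 A1 ** C ** kron A2 A1" "kron_map \<Sigma> = kron A2 A1 ** kron A2 A1"
    using kron_map_decomposition[OF \<Sigma>] by blast
  have tA: "transpose (kron A2 A1) = kron A2 A1" using A by (simp add: transpose_kron spd_sym)
  show ?thesis
    using kron_map_eqI[OF invertible_mult[OF B(1) spd_invertible[OF A(1)]] invertible_mult[OF B(2) spd_invertible[OF A(2)]] C]
    unfolding \<Sigma>C(2) unfolding \<Sigma>C(1)
    by (simp add: kron_mult[symmetric] matrix_transpose_mul tA matrix_mul_assoc)
qed

lemma kron_map_in_kron_spd: "\<Sigma> \<in> spd_mats \<Longrightarrow> kron_map \<Sigma> \<in> kron_spd"
proof -
  assume "\<Sigma> \<in> spd_mats"
  then obtain A2 A1 C where "A2 \<in> spd_mats" "A1 \<in> spd_mats" "kron_map \<Sigma> = kron A2 A1 ** kron A2 A1"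
    using kron_map_decomposition by metis
  then show ?thesis unfolding kron_spd_def
    using spd_gram[OF spd_invertible, of A2] spd_gram[OF spd_invertible, of A1]
    by (auto simp: kron_mult spd_sym)
qed

lemma kron_spd_subset_spd: "kron_spd \<subseteq> spd_mats"
  by (auto simp: kron_spd_def spd_kron)

section \<open>Smooth maps on subsets\<close>

lemma smooth_map_onI:
  assumes "\<And>x. x \<in> M \<Longrightarrow> \<exists>U F. open U \<and> x \<in> U \<and> (\<forall>n. Ck_on n U F) \<and> (\<forall>y\<in>U \<inter> M. F y = f y)"
  shows "smooth_map_on M f"
  using assms by (simp add: smooth_map_on_def)

lemma smooth_map_onE:
  assumes "smooth_map_on M f" "x \<in> M"
  obtains U F where "open U" "x \<in> U" "\<And>n. Ck_on n U F" "\<And>y. y \<in> U \<inter> M \<Longrightarrow> F y = f y"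
proof -
  from bspec[OF assms(1)[unfolded smooth_map_on_def] assms(2)]
  obtain U F where "open U \<and> x \<in> U \<and> (\<forall>n. Ck_on n U F) \<and> (\<forall>y\<in>U \<inter> M. F y = f y)"
    by (elim exE)
  then show ?thesis using that[of U F] by simp
qed

lemma Ck_on_imp_smooth_map_on:
  assumes "open U" "\<And>n. Ck_on n U f" "M \<subseteq> U"
  shows "smooth_map_on M f"
  using assms by (intro smooth_map_onI exI[of _ U] exI[of _ f]) auto

lemma smooth_map_on_bounded_linear: "bounded_linear f \<Longrightarrow> smooth_map_on M f"
  by (rule Ck_on_imp_smooth_map_on[of UNIV]) (auto intro: Ck_on_bounded_linear)

lemma smooth_map_on_subset:
  assumes "smooth_map_on N f" "M \<subseteq> N"
  shows "smooth_map_on M f"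
proof (rule smooth_map_onI)
  fix x assume "x \<in> M"
  then have "x \<in> N" using assms(2) by blast
  then obtain U F where "open U" "x \<in> U" "\<And>n. Ck_on n U F" "\<And>y. y \<in> U \<inter> N \<Longrightarrow> F y = f y"
    by (rule smooth_map_onE[OF assms(1)]) blast
  then show "\<exists>U F. open U \<and> x \<in> U \<and> (\<forall>n. Ck_on n U F) \<and> (\<forall>y\<in>U \<inter> M. F y = f y)"
    using assms(2) by (intro exI[of _ U] exI[of _ F]) auto
qed

lemma smooth_map_on_compose:
  assumes f: "smooth_map_on M f" and g: "smooth_map_on N g" and fM: "f ` M \<subseteq> N"
  shows "smooth_map_on M (\<lambda>x. g (f x))"
proof (rule smooth_map_onI)
  fix x assume x: "x \<in> M"
  obtain U F where U: "open U" "x \<in> U" "\<And>n. Ck_on n U F" "\<And>y. y \<in> U \<inter> M \<Longrightarrow> F y = f y"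
    by (rule smooth_map_onE[OF f x]) blast
  have "f x \<in> N" using fM x by blast
  then obtain W G where W: "open W" "f x \<in> W" "\<And>n. Ck_on n W G" "\<And>y. y \<in> W \<inter> N \<Longrightarrow> G y = g y"
    by (rule smooth_map_onE[OF g]) blast
  \<comment> \<open>Off \<open>M\<close> the values of the extension \<open>F\<close> are
    unrestricted, so the domain is shrunk until they land in the domain of \<open>G\<close>.\<close>
  define U' where "U' = U \<inter> F -` W"
  have U': "open U'" unfolding U'_def
    using Ck_on_continuous_on[OF U(3)] U(1) W(1) by (simp add: continuous_on_open_vimage Int_commute)
  have "Ck_on n U' (\<lambda>x. G (F x))" for n
    by (rule Ck_on_compose[OF U' W(1) Ck_on_subset[OF U(3)] W(3)]) (auto simp: U'_def)
  moreover have "G (F y) = g (f y)" if "y \<in> U' \<inter> M" for y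
    using that U(4)[of y] W(4)[of "f y"] fM by (auto simp: U'_def)
  moreover have "x \<in> U'" using U W x by (auto simp: U'_def)
  ultimately show "\<exists>U F. open U \<and> x \<in> U \<and> (\<forall>n. Ck_on n U F) \<and> (\<forall>y\<in>U \<inter> M. F y = g (f y))"
    using U' by (intro exI[of _ U'] exI[of _ "\<lambda>x. G (F x)"]) simp
qed

lemma smooth_map_on_Pair:
  assumes f: "smooth_map_on M f" and g: "smooth_map_on M g"
  shows "smooth_map_on M (\<lambda>x. (f x, g x))"
proof (rule smooth_map_onI)
  fix x assume x: "x \<in> M"
  obtain U F where U: "open U" "x \<in> U" "\<And>n. Ck_on n U F" "\<And>y. y \<in> U \<inter> M \<Longrightarrow> F y = f y"
    by (rule smooth_map_onE[OF f x]) blast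
  obtain W G where W: "open W" "x \<in> W" "\<And>n. Ck_on n W G" "\<And>y. y \<in> W \<inter> M \<Longrightarrow> G y = g y"
    by (rule smooth_map_onE[OF g x]) blast
  have o: "open (U \<inter> W)" using U W by blast
  have "Ck_on n (U \<inter> W) (\<lambda>x. (F x, G x))" for n
    by (intro Ck_on_Pair o Ck_on_subset[OF U(3)] Ck_on_subset[OF W(3)]) auto
  then show "\<exists>U F. open U \<and> x \<in> U \<and> (\<forall>n. Ck_on n U F) \<and> (\<forall>y\<in>U \<inter> M. F y = (f y, g y))"
    using U W o by (intro exI[of _ "U \<inter> W"] exI[of _ "\<lambda>x. (F x, G x)"]) auto
qed

lemma smooth_map_on_bilinear:
  assumes "bounded_bilinear prd" "smooth_map_on M f" "smooth_map_on M g"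
  shows "smooth_map_on M (\<lambda>x. prd (f x) (g x))"
proof -
  have "Ck_on n UNIV (\<lambda>p. prd (fst p) (snd p))" for n
    by (intro Ck_on_bilinear[OF _ assms(1)] Ck_on_bounded_linear bounded_linear_fst bounded_linear_snd open_UNIV)
  then have "smooth_map_on UNIV (\<lambda>p. prd (fst p) (snd p))" by (intro Ck_on_imp_smooth_map_on[OF open_UNIV]) auto
  from smooth_map_on_compose[OF smooth_map_on_Pair[OF assms(2,3)] this] show ?thesis by simp
qed

lemma smooth_map_on_linear_comp:
  "bounded_linear L \<Longrightarrow> smooth_map_on M f \<Longrightarrow> smooth_map_on M (\<lambda>x. L (f x))"
  using smooth_map_on_compose[OF _ smooth_map_on_bounded_linear[of L UNIV]] by simp

lemma smooth_map_on_differentiable: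
  assumes "smooth_map_on M f" "x \<in> M"
  shows "f differentiable (at x within M)"
proof -
  obtain U F where U: "open U" "x \<in> U" "\<And>n. Ck_on n U F" "\<And>y. y \<in> U \<inter> M \<Longrightarrow> F y = f y"
    by (rule smooth_map_onE[OF assms]) blast
  obtain D where "(F has_derivative D) (at x)"
    using U(2) U(3)[of "Suc 0"] unfolding Ck_on_Suc_iff[OF U(1)] by blast
  then have F: "(F has_derivative D) (at x within M)" by (rule has_derivative_at_withinI)
  obtain d where d: "d > 0" "ball x d \<subseteq> U" using U(1,2) open_contains_ball by blast
  have "(f has_derivative D) (at x within M)"
  proof (rule has_derivative_transform_within[OF F d(1) assms(2)])
    fix y assume "y \<in> M" "dist y x < d"
    then have "y \<in> U \<inter> M" using d(2) by (auto simp: dist_commute)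
    then show "F y = f y" by (rule U(4))
  qed
  then show ?thesis by (auto simp: differentiable_def)
qed

lemma has_derivative_differential:
  assumes "f differentiable (at x within M)"
  shows "(f has_derivative differential M f x) (at x within M)"
  using assms by (simp add: differential_def[abs_def] frechet_derivative_works)

text \<open>
  Derivatives within a set are not unique, but they agree on velocities of curves in the set.
\<close>

lemma has_derivative_within_unique_along:
  fixes f :: "'v::real_normed_vector \<Rightarrow> 'w::real_normed_vector"
  assumes D: "(f has_derivative D1) (at x within M)" "(f has_derivative D2) (at x within M)"
    and c: "(c has_vector_derivative v) (at 0)" "c 0 = x"
    and T: "open T" "(0::real) \<in> T" "\<And>t. t \<in> T \<Longrightarrow> c t \<in> M"
  shows "D1 v = D2 v"
proof -
  have c': "(c has_derivative (\<lambda>t. t *\<^sub>R v)) (at 0 within T)"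
    using c(1) unfolding has_vector_derivative_def by (rule has_derivative_at_withinI)
  have "((f \<circ> c) has_derivative (D \<circ> (\<lambda>t. t *\<^sub>R v))) (at 0)"
    if "(f has_derivative D) (at x within M)" for D
  proof -
    have "(f has_derivative D) (at (c 0) within c ` T)"
      unfolding c(2) by (rule has_derivative_subset[OF that]) (use T(3) in auto)
    from diff_chain_within[OF c' this] show ?thesis using at_within_open[OF T(2,1)] by simp
  qed
  from has_derivative_unique[OF this[OF D(1)] this[OF D(2)]]
  have "(D1 \<circ> (\<lambda>t. t *\<^sub>R v)) 1 = (D2 \<circ> (\<lambda>t. t *\<^sub>R v)) 1" by simp
  then show ?thesis by simp
qed

section \<open>Smoothness of matrix operations\<close>

lemma open_invertible: "open {A :: real^'n^'n. invertible A}"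
proof -
  have "{A :: real^'n^'n. invertible A} = det -` (- {0})" by (auto simp: invertible_det_nz)
  then show ?thesis using open_vimage[OF _ continuous_on_det] by (metis open_Compl closed_singleton)
qed

text \<open>The inverse solves \<open>A ** X = mat 1\<close>, a linear equation whose coefficients
  depend linearly on \<open>A\<close>.\<close>

lemma Ck_on_matrix_inv: "Ck_on n {A :: real^'n^'n. invertible A} matrix_inv"
proof (rule Ck_on_linear_solution[OF open_invertible, where A = "(**)" and b = "\<lambda>A. mat 1"])
  show "linear ((**) A)" for A :: "real^'n^'n"
    by (rule bounded_linear.linear[OF matrix_mult.bounded_linear_right])
  show "inj ((**) A)" if "A \<in> {A. invertible A}" for A :: "real^'n^'n"
  proof (rule injI)
    fix X Y assume "A ** X = A ** Y"
    then have "matrix_inv A ** (A ** X) = matrix_inv A ** (A ** Y)" by simp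
    then show "X = Y" using that by (simp add: matrix_mul_assoc matrix_inv_left)
  qed
  show "Ck_on n {A. invertible A} (\<lambda>A :: real^'n^'n. A ** E)" for E
    by (intro Ck_on_bounded_linear open_invertible matrix_mult.bounded_linear_left)
qed (auto intro: Ck_on_const open_invertible matrix_inv_right)

lemma smooth_map_on_matrix_inv: "smooth_map_on {A :: real^'n^'n. invertible A} matrix_inv"
  by (rule Ck_on_imp_smooth_map_on[OF open_invertible Ck_on_matrix_inv]) simp

text \<open>Differentiability is already known from smoothness; the formula comes from
  differentiating \<open>X ** matrix_inv X = mat 1\<close>.\<close>

lemma has_derivative_matrix_inv:
  assumes A: "invertible (A :: real^'n^'n)"
  shows "(matrix_inv has_derivative (\<lambda>H. - (matrix_inv A ** H ** matrix_inv A))) (at A)"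
proof -
  obtain D where D: "(matrix_inv has_derivative D) (at A)"
    using A Ck_on_matrix_inv[of "Suc 0", where 'n = 'n] unfolding Ck_on_Suc_iff[OF open_invertible] by blast
  have "((\<lambda>X. X ** matrix_inv X) has_derivative (\<lambda>H. A ** D H + H ** matrix_inv A)) (at A)"
    by (rule matrix_mult.FDERIV[OF has_derivative_ident D])
  then have "((\<lambda>X. mat 1) has_derivative (\<lambda>H. A ** D H + H ** matrix_inv A)) (at A)"
    by (rule has_derivative_transform_within_open[OF _ open_invertible]) (use A in \<open>auto simp: matrix_inv_right\<close>)
  then have "(\<lambda>H. A ** D H + H ** matrix_inv A) = (\<lambda>H. 0)"
    using has_derivative_const has_derivative_unique by blast
  then have "A ** D H = - (H ** matrix_inv A)" for H by (meson eq_neg_iff_add_eq_0)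
  then have "matrix_inv A ** (A ** D H) = - (matrix_inv A ** H ** matrix_inv A)" for H
    by (simp add: matrix_mult.minus_right matrix_mul_assoc)
  then have "D H = - (matrix_inv A ** H ** matrix_inv A)" for H
    by (simp add: matrix_mul_assoc matrix_inv_left[OF A])
  then have "D = (\<lambda>H. - (matrix_inv A ** H ** matrix_inv A))" by (rule ext)
  then show ?thesis using D by simp
qed

section \<open>Symmetric part and the square root\<close>

lemma bounded_bilinear_matrix_vector_mult:
  "bounded_bilinear ((*v) :: real^'m^'n \<Rightarrow> real^'m \<Rightarrow> real^'n)"
  unfolding bilinear_conv_bounded_bilinear[symmetric] bilinear_def
  by (intro conjI allI linearI)
     (simp_all add: matrix_vector_mult_def vec_eq_iff algebra_simps sum.distrib sum_distrib_left)

text \<open>The projection through which maps on symmetric matrices are extended to open sets of the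
  full matrix space.\<close>

definition sym_part :: "real^'n^'n \<Rightarrow> real^'n^'n"
  where "sym_part A = (1/2) *\<^sub>R (A + transpose A)"

lemma bounded_linear_sym_part: "bounded_linear sym_part"
  unfolding sym_part_def[abs_def]
  by (intro bounded_linear_intros bounded_linear_transpose)

lemma transpose_sym_part: "transpose (sym_part A) = sym_part A"
  by (simp add: sym_part_def transpose_scalar transpose_add add.commute)

lemma sym_part_eq: "transpose A = A \<Longrightarrow> sym_part A = A"
  by (simp add: sym_part_def scaleR_2[symmetric])

text \<open>Transposing the equation flips the sign of the skew part only. So an equation on all
  matrices separates into its symmetric component and the constraint that the unknown
  \<open>B\<close> be symmetric.\<close>

lemma sym_skew_zero:
  fixes A B :: "real^'n^'n"
  assumes "A + (B - transpose B) = 0" "transpose A = A"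
  shows "A = 0" "transpose B = B"
proof -
  have "A - (B - transpose B) = 0"
    using arg_cong[OF assms(1), of transpose] assms(2)
    by (simp add: transpose_add transpose_diff transpose_zero algebra_simps)
  moreover have "2 *\<^sub>R A = (A + (B - transpose B)) + (A - (B - transpose B))" by (simp add: scaleR_2)
  ultimately have "2 *\<^sub>R A = 0" using assms(1) by simp
  then show "A = 0" by simp
  with assms(1) show "transpose B = B" by simp
qed

text \<open>The quadratic form has a positive minimum \<open>m0\<close> on the unit sphere, and a
  perturbation of norm below \<open>m0 / (k + 1)\<close> changes it there by less than
  \<open>m0\<close>. Here \<open>k\<close> bounds matrix-vector multiplication, and adding 1 covers
  the case \<open>k = 0\<close>.\<close>

lemma open_sym_part_spd: "open {A :: real^'n^'n. sym_part A \<in> spd_mats}"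
proof -
  obtain k where k: "k \<ge> 0" "\<And>(E :: real^'n^'n) x. norm (E *v x) \<le> norm E * norm x * k"
    using bounded_bilinear.nonneg_bounded[OF bounded_bilinear_matrix_vector_mult] by blast
  have near: "\<exists>e>0. \<forall>B. transpose B = B \<longrightarrow> dist B A < e \<longrightarrow> B \<in> spd_mats" if A: "A \<in> spd_mats" for A :: "real^'n^'n"
  proof -
    let ?S = "sphere (0 :: real^'n) 1"
    have "axis undefined 1 \<in> ?S" by (simp add: norm_axis_1)
    then have "?S \<noteq> {}" by blast
    moreover have "continuous_on ?S (\<lambda>x. x \<bullet> (A *v x))"
      by (intro continuous_intros matrix_vector_mult_linear_continuous_on)
    ultimately obtain x0 where x0: "x0 \<in> ?S" and m: "\<And>x. x \<in> ?S \<Longrightarrow> x0 \<bullet> (A *v x0) \<le> x \<bullet> (A *v x)"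
      using continuous_attains_inf[OF compact_sphere, of 0 1 "\<lambda>x. x \<bullet> (A *v x)"] by blast
    define m0 where "m0 = x0 \<bullet> (A *v x0)"
    have "x0 \<noteq> 0" using x0 by auto
    then have m0: "m0 > 0" unfolding m0_def by (rule spd_pos[OF A])
    define e where "e = m0 / (k + 1)"
    have "B \<in> spd_mats" if B: "transpose B = B" "dist B A < e" for B
    proof -
      have "x \<bullet> (B *v x) > 0" if x: "x \<noteq> 0" for x
      proof -
        define u where "u = x /\<^sub>R norm x"
        have u: "u \<in> ?S" "norm u = 1" using x by (simp_all add: u_def)
        have "\<bar>u \<bullet> ((B - A) *v u)\<bar> \<le> norm u * norm ((B - A) *v u)" by (rule Cauchy_Schwarz_ineq2)
        also have "\<dots> \<le> norm (B - A) * k" using k(2)[of "B - A" u] u by simp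
        also have "\<dots> \<le> norm (B - A) * (k + 1)" by (intro mult_left_mono) auto
        also have "\<dots> < e * (k + 1)" using B(2) k(1) by (intro mult_strict_right_mono) (auto simp: dist_norm)
        also have "\<dots> = m0" using k(1) by (simp add: e_def)
        finally have "\<bar>u \<bullet> ((B - A) *v u)\<bar> < m0" .
        moreover have "u \<bullet> (B *v u) = u \<bullet> (A *v u) + u \<bullet> ((B - A) *v u)"
          by (simp add: matrix_vector_mult_diff_rdistrib inner_diff_right)
        ultimately have "u \<bullet> (B *v u) > 0" using m[OF u(1)] unfolding m0_def by linarith
        moreover have "x = norm x *\<^sub>R u" using x by (simp add: u_def)
        then have "x \<bullet> (B *v x) = (norm x)\<^sup>2 * (u \<bullet> (B *v u))"
          by (metis inner_scaleR_left inner_scaleR_right matrix_vector_mult_scaleR mult.assoc power2_eq_square)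
        ultimately show ?thesis using x by simp
      qed
      then show ?thesis using B(1) by (simp add: spd_mats_def)
    qed
    moreover have "e > 0" using m0 k(1) by (simp add: e_def)
    ultimately show ?thesis by blast
  qed
  show ?thesis unfolding open_dist
  proof
    fix A :: "real^'n^'n" assume "A \<in> {A. sym_part A \<in> spd_mats}"
    then obtain e where e: "e > 0" "\<And>B. transpose B = B \<Longrightarrow> dist B (sym_part A) < e \<Longrightarrow> B \<in> spd_mats"
      using near by blast
    have "isCont sym_part A" by (rule linear_continuous_at[OF bounded_linear_sym_part])
    then obtain d where "d > 0" "\<And>B. dist B A < d \<Longrightarrow> dist (sym_part B) (sym_part A) < e"
      using e(1) unfolding continuous_at_eps_delta by (metis dist_commute)
    then show "\<exists>d>0. \<forall>B. dist B A < d \<longrightarrow> B \<in> {A. sym_part A \<in> spd_mats}"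
      using e(2)[OF transpose_sym_part] by blast
  qed
qed

lemma spd_sym_part: "A \<in> spd_mats \<Longrightarrow> sym_part A \<in> spd_mats"
  by (simp add: sym_part_eq spd_sym)

lemma spd_line:
  assumes "A \<in> spd_mats" "V \<in> sym_mats"
  obtains T where "open T" "(0::real) \<in> T" "\<And>t. t \<in> T \<Longrightarrow> A + t *\<^sub>R V \<in> spd_mats"
proof -
  let ?T = "(\<lambda>t. A + t *\<^sub>R V) -` {B. sym_part B \<in> spd_mats}"
  have "open ?T" by (intro open_vimage[OF open_sym_part_spd] continuous_intros)
  moreover have "0 \<in> ?T" using assms(1) by (simp add: spd_sym_part)
  moreover have "A + t *\<^sub>R V \<in> spd_mats" if "t \<in> ?T" for t
  proof -
    have "transpose (A + t *\<^sub>R V) = A + t *\<^sub>R V"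
      using assms by (simp add: spd_sym sym_mats_def transpose_add transpose_scalar)
    from sym_part_eq[OF this] that show ?thesis by simp
  qed
  ultimately show ?thesis using that by blast
qed

lemma smooth_map_on_sym_sqrt: "smooth_map_on spd_mats (sym_sqrt :: real^'n^'n \<Rightarrow> real^'n^'n)"
proof (rule smooth_map_onI)
  fix A :: "real^'n^'n" assume A: "A \<in> spd_mats"
  define R where "R = sym_sqrt A"
  have R: "R \<in> spd_mats" "R ** R = A" using A by (simp_all add: R_def sym_sqrt_spd sym_sqrt_square)
  \<comment> \<open>Squaring constrains only the symmetric part; adding the skew part of
    \<open>B\<close> makes \<open>f\<close> a map of the full matrix space to itself with injective
    derivative at \<open>R\<close>.\<close>
  define f where "f B = sym_part B ** sym_part B + (B - transpose B)" for B :: "real^'n^'n"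
  have bl: "bounded_linear (\<lambda>B. B - transpose B :: real^'n^'n)"
    by (intro bounded_linear_sub bounded_linear_ident bounded_linear_transpose)
  have Cf: "Ck_on n {B. sym_part B \<in> spd_mats} f" for n
    unfolding f_def
    by (intro Ck_on_add Ck_on_bilinear[OF _ bounded_bilinear_matrix_mult] Ck_on_bounded_linear
        bounded_linear_sym_part bl open_sym_part_spd)
  have df: "(f has_derivative (\<lambda>E. (R ** sym_part E + sym_part E ** R) + (E - transpose E))) (at R)"
    unfolding f_def using sym_part_eq[OF spd_sym[OF R(1)]]
    by (intro has_derivative_add bounded_linear_imp_has_derivative[OF bl])
       (use matrix_mult.FDERIV[OF bounded_linear_imp_has_derivative[OF bounded_linear_sym_part]
          bounded_linear_imp_has_derivative[OF bounded_linear_sym_part], of R UNIV] in simp)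
  obtain V g where V: "open V" "f R \<in> V" "g ` V \<subseteq> {B. sym_part B \<in> spd_mats}" "\<And>y. y \<in> V \<Longrightarrow> f (g y) = y"
    "\<And>n. Ck_on n V g"
  proof (rule inverse_function_smooth[OF open_sym_part_spd _ Cf, of R])
    fix E assume "frechet_derivative f (at R) E = 0"
    then have z: "(R ** sym_part E + sym_part E ** R) + (E - transpose E) = 0"
      by (simp add: frechet_derivative_at[OF df, symmetric])
    have s: "transpose (R ** sym_part E + sym_part E ** R) = R ** sym_part E + sym_part E ** R"
      by (simp add: transpose_add matrix_transpose_mul transpose_sym_part spd_sym[OF R(1)] add.commute)
    note zz = sym_skew_zero[OF z s]
    have "sym_part E = 0" by (rule sylvester_injective[OF R(1) R(1) zz(1)])
    then show "E = 0" using sym_part_eq[OF zz(2)] by simp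
  qed (auto simp: spd_sym_part R)
  have fR: "f R = A" by (simp add: f_def sym_part_eq spd_sym R)
  \<comment> \<open>For symmetric \<open>X\<close> the skew part of \<open>f (g X) = X\<close>
    forces \<open>g X\<close> to be symmetric. It is positive definite because \<open>g\<close>
    takes values in the open set above, so uniqueness of square roots applies.\<close>
  have "g X = sym_sqrt X" if X: "X \<in> V" "X \<in> spd_mats" for X
  proof -
    have z: "(sym_part (g X) ** sym_part (g X) - X) + (g X - transpose (g X)) = 0"
      using V(4)[OF X(1)] by (simp add: f_def algebra_simps)
    have s: "transpose (sym_part (g X) ** sym_part (g X) - X) = sym_part (g X) ** sym_part (g X) - X"
      by (simp add: transpose_diff matrix_transpose_mul transpose_sym_part spd_sym[OF X(2)])
    note zz = sym_skew_zero[OF z s]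
    have "sym_part (g X) = g X" by (rule sym_part_eq[OF zz(2)])
    then show ?thesis using zz(1) V(3) X(1) by (intro sym_sqrt_eqI[symmetric]) auto
  qed
  then show "\<exists>U F. open U \<and> A \<in> U \<and> (\<forall>n. Ck_on n U F) \<and> (\<forall>y\<in>U \<inter> spd_mats. F y = sym_sqrt y)"
    using V fR by (intro exI[of _ V] exI[of _ g]) auto
qed

section \<open>Smoothness of the Cholesky factor\<close>

context strict_total_order
begin

text \<open>Has the role for triangular factors that \<open>sym_part\<close> has for square
  roots.\<close>

definition lower_part :: "real^'n^'n \<Rightarrow> real^'n^'n"
  where "lower_part A = (\<chi> i j. if lt i j then 0 else A $ i $ j)"

lemma bounded_linear_lower_part: "bounded_linear lower_part"
  unfolding linear_conv_bounded_linear[symmetric]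
  by (intro linearI) (simp_all add: lower_part_def vec_eq_iff)

lemma lower_part_eq: "lower A \<Longrightarrow> lower_part A = A"
  by (simp add: lower_triangular_def lower_part_def vec_eq_iff)

lemma lower_part_add_strict_upper_zero:
  assumes "lower_part A + (B - lower_part B) = 0"
  shows "lower_part A = 0" "lower B"
proof -
  have *: "(if lt i j then 0 else A $ i $ j) + (B $ i $ j - (if lt i j then 0 else B $ i $ j)) = 0" for i j
    using arg_cong[OF assms, of "\<lambda>M. M $ i $ j"] by (simp add: lower_part_def)
  have "lower_part A $ i $ j = 0" for i j using *[of i j] by (simp add: lower_part_def split: if_splits)
  then show "lower_part A = 0" by (simp add: vec_eq_iff)
  have "B $ i $ j = 0" if "lt i j" for i j using *[of i j] that by simp
  then show "lower B" by (simp add: lower_triangular_def)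
qed

lemma lower_part_zero_sym:
  assumes "lower_part A = 0" "transpose A = A"
  shows "A = 0"
proof -
  have "A $ i $ j = 0" if "\<not> lt i j" for i j
    using arg_cong[OF assms(1), of "\<lambda>M. M $ i $ j"] that by (simp add: lower_part_def)
  moreover have "A $ i $ j = A $ j $ i" for i j
    using arg_cong[OF assms(2), of "\<lambda>M. M $ j $ i"] by (simp add: transpose_def)
  ultimately have "A $ i $ j = 0" for i j using trans[of i j i] irrefl by metis
  then show ?thesis by (simp add: vec_eq_iff)
qed

text \<open>Multiplied by \<open>L^{-1}\<close> on the left and by its transpose on the right, the
  equation says that \<open>P = L^{-1} E\<close> is skew; being lower triangular as well,
  \<open>P\<close> vanishes.\<close>

lemma cholesky_derivative_injective:
  assumes L: "lower L" "\<And>i. L $ i $ i > 0" and E: "lower E" and z: "E ** transpose L + L ** transpose E = 0"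
  shows "E = 0"
proof -
  have L0: "L $ i $ i \<noteq> 0" for i using L(2)[of i] by simp
  note iL = lower_invertible[OF L(1) L0]
  define P where "P = matrix_inv L ** E"
  have "P + transpose P = matrix_inv L ** E ** transpose (matrix_inv L ** L)
      + (matrix_inv L ** L) ** transpose E ** transpose (matrix_inv L)"
    by (simp add: P_def matrix_inv_left[OF iL] matrix_transpose_mul)
  also have "\<dots> = matrix_inv L ** (E ** transpose L + L ** transpose E) ** transpose (matrix_inv L)"
    by (simp add: matrix_transpose_mul matrix_add_ldistrib matrix_mult.add_left matrix_mul_assoc)
  finally have "P + transpose P = 0" by (simp add: z)
  moreover have "lower P" unfolding P_def by (rule lower_mult(1)[OF lower_matrix_inv(1)[OF L(1) L0] E])
  ultimately have "P = 0" by (rule lower_skew_zero[rotated])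
  then have "L ** (matrix_inv L ** E) = 0" by (simp add: P_def)
  then show ?thesis by (simp add: matrix_mul_assoc matrix_inv_right[OF iL])
qed

lemma smooth_map_on_cholesky: "smooth_map_on spd_mats (cholesky lt)"
proof (rule smooth_map_onI)
  fix A :: "real^'n^'n" assume A: "A \<in> spd_mats"
  define L where "L = cholesky lt A"
  note L = cholesky_props[OF A, folded L_def]
  define W where "W = {L :: real^'n^'n. \<forall>i. L $ i $ i > 0}"
  have "W = (\<Inter>i\<in>UNIV. {L. L $ i $ i > 0})" by (auto simp: W_def)
  then have W: "open W" by (auto intro!: open_INT open_Collect_less continuous_intros)
  \<comment> \<open>A symmetric product is determined by its lower part, so only that part is kept;
    the strictly upper part of \<open>B\<close> supplies the remaining equations.\<close>
  define f where "f B = lower_part (lower_part B ** transpose (lower_part B)) + (B - lower_part B)" for B :: "real^'n^'n"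
  have bl: "bounded_linear (\<lambda>B. B - lower_part B)"
    by (intro bounded_linear_sub bounded_linear_ident bounded_linear_lower_part)
  have blt: "bounded_linear (\<lambda>B. transpose (lower_part B))"
    using bounded_linear_compose[OF bounded_linear_transpose bounded_linear_lower_part] .
  have Cf: "Ck_on n W f" for n
    unfolding f_def
    by (intro Ck_on_add Ck_on_linear_comp[OF W bounded_linear_lower_part]
        Ck_on_bilinear[OF _ bounded_bilinear_matrix_mult] Ck_on_bounded_linear bounded_linear_lower_part bl blt W)
  have df: "(f has_derivative (\<lambda>E. lower_part (lower_part L ** transpose (lower_part E) + lower_part E ** transpose (lower_part L))
      + (E - lower_part E))) (at L)"
    unfolding f_def
    by (intro has_derivative_add bounded_linear_imp_has_derivative[OF bl]
        bounded_linear.has_derivative[OF bounded_linear_lower_part] matrix_mult.FDERIV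
        bounded_linear_imp_has_derivative[OF bounded_linear_lower_part] bounded_linear_imp_has_derivative[OF blt])
  obtain V g where V: "open V" "f L \<in> V" "g ` V \<subseteq> W" "\<And>y. y \<in> V \<Longrightarrow> f (g y) = y" "\<And>n. Ck_on n V g"
  proof (rule inverse_function_smooth[OF W _ Cf, of L])
    fix E assume "frechet_derivative f (at L) E = 0"
    then have z: "lower_part (L ** transpose (lower_part E) + lower_part E ** transpose L) + (E - lower_part E) = 0"
      by (simp add: frechet_derivative_at[OF df, symmetric] lower_part_eq[OF L(1)])
    note zz = lower_part_add_strict_upper_zero[OF z]
    have "lower_part (E ** transpose L + L ** transpose E) = 0"
      using zz by (simp add: lower_part_eq add.commute)
    then have "E ** transpose L + L ** transpose E = 0"
      by (rule lower_part_zero_sym) (simp add: transpose_add matrix_transpose_mul add.commute)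
    then show "E = 0" by (rule cholesky_derivative_injective[OF L(1,2) zz(2)])
  qed (auto simp: W_def L)
  have fL: "f L = lower_part A" by (simp add: f_def lower_part_eq L)
  define U where "U = lower_part -` V"
  have U: "open U" unfolding U_def
    by (intro open_vimage[OF V(1)] linear_continuous_on bounded_linear_lower_part)
  have "Ck_on n U (\<lambda>X. g (lower_part X))" for n
    by (rule Ck_on_compose[OF U V(1) Ck_on_bounded_linear[OF U bounded_linear_lower_part] V(5)]) (auto simp: U_def)
  moreover have "g (lower_part X) = cholesky lt X" if X: "X \<in> U" "X \<in> spd_mats" for X
  proof -
    define B where "B = g (lower_part X)"
    have "B \<in> W" "f B = lower_part X" using V X by (auto simp: B_def U_def)
    note BW = this
    have z: "lower_part (lower_part B ** transpose (lower_part B) - X) + (B - lower_part B) = 0"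
      using BW(2) by (simp add: f_def linear_diff[OF bounded_linear.linear[OF bounded_linear_lower_part]] algebra_simps)
    note zz = lower_part_add_strict_upper_zero[OF z]
    have "lower_part B ** transpose (lower_part B) - X = 0"
      by (rule lower_part_zero_sym[OF zz(1)])
         (simp add: transpose_diff matrix_transpose_mul spd_sym[OF X(2)])
    then have "B ** transpose B = X" by (simp add: lower_part_eq[OF zz(2)])
    then show ?thesis unfolding B_def[symmetric] using zz(2) BW(1)
      by (intro cholesky_eqI[symmetric]) (auto simp: W_def)
  qed
  moreover have "A \<in> U" using V(2) fL by (simp add: U_def)
  ultimately show "\<exists>U F. open U \<and> A \<in> U \<and> (\<forall>n. Ck_on n U F) \<and> (\<forall>y\<in>U \<inter> spd_mats. F y = cholesky lt y)"
    using U by (intro exI[of _ U] exI[of _ "\<lambda>X. g (lower_part X)"]) auto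
qed

end

lemma strict_total_order_less: "strict_total_order ((<) :: 'a::{finite,linorder} \<Rightarrow> 'a \<Rightarrow> bool)"
  by unfold_locales auto

lemma strict_total_order_lex_less:
  "strict_total_order (lex_less :: 'b::{finite,linorder} \<times> 'a::{finite,linorder} \<Rightarrow> _)"
  by unfold_locales (auto simp: lex_less_def prod_eq_iff)

text \<open>Under the lexicographic order a Kronecker product of lower triangular matrices is lower
  triangular; uniqueness of the factor does the rest.\<close>

lemma cholesky_kron:
  fixes A :: "real^('b::{finite,linorder})^('b::{finite,linorder})"
    and B :: "real^('a::{finite,linorder})^('a::{finite,linorder})"
  assumes "A \<in> spd_mats" "B \<in> spd_mats"
  shows "cholesky lex_less (kron A B) = kron (cholesky (<) A) (cholesky (<) B)"
proof -
  interpret la: strict_total_order "(<) :: 'a \<Rightarrow> _" by (rule strict_total_order_less)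
  interpret lb: strict_total_order "(<) :: 'b \<Rightarrow> _" by (rule strict_total_order_less)
  interpret l: strict_total_order "lex_less :: 'b \<times> 'a \<Rightarrow> _" by (rule strict_total_order_lex_less)
  note a = la.cholesky_props[OF assms(2)] and b = lb.cholesky_props[OF assms(1)]
  show ?thesis
  proof (rule l.cholesky_eqI)
    show "l.lower (kron (cholesky (<) A) (cholesky (<) B))"
      using a(1) b(1) by (auto simp: lower_triangular_def kron_nth lex_less_def)
    show "kron (cholesky (<) A) (cholesky (<) B) $ i $ i > 0" for i using a(2) b(2) by (simp add: kron_nth)
    show "kron (cholesky (<) A) (cholesky (<) B) ** transpose (kron (cholesky (<) A) (cholesky (<) B)) = kron A B"
      using a(3) b(3) by (simp add: kron_gram[symmetric])
  qed
qed

section \<open>The linearized score equations\<close>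

text \<open>In the traced equations everything cancels except the contribution of the multiple
  \<open>trace E1\<close> of the identity, so both traces vanish. Pairing the equations with
  \<open>E1\<close> and \<open>E2\<close> then produces the same cross term
  \<open>trace (C ** kron E2 E1)\<close> twice.\<close>

lemma core_score_injective:
  fixes C :: "real^('b::finite \<times> 'a::finite)^('b \<times> 'a)"
  assumes C: "C \<in> spd_mats" "balanced C" and E: "transpose E1 = E1" "transpose E2 = E2"
    and e1: "E1 + (1 / real CARD('b)) *\<^sub>R contract2 C E2 + trace E1 *\<^sub>R mat 1 = 0"
    and e2: "E2 + (1 / real CARD('a)) *\<^sub>R contract1 C E1 = 0"
  shows "E1 = 0" "E2 = 0"
proof -
  let ?a = "real CARD('a)" and ?b = "real CARD('b)"
  have t1: "trace (contract2 C E2) = ?a * trace E2"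
    using trace_contract2[of C E2 "mat 1"] balanced_trace(2)[OF C(2)] by simp
  have t2: "trace (contract1 C E1) = ?b * trace E1"
    using trace_contract1[of C E1 "mat 1"] balanced_trace(1)[OF C(2)] by simp
  have "trace E1 + (1 / ?b) * (?a * trace E2) + trace E1 * ?a = 0"
    using arg_cong[OF e1, of trace] by (simp add: trace_add trace_scaleR t1 trace_I trace_zero)
  moreover have s2: "trace E2 + (1 / ?a) * (?b * trace E1) = 0"
    using arg_cong[OF e2, of trace] by (simp add: trace_add trace_scaleR t2 trace_zero)
  then have "trace E2 = - (?b / ?a) * trace E1" by simp
  ultimately have "trace E1 * ?a = 0" by simp
  then have tE1: "trace E1 = 0" by simp
  then have tE2: "trace E2 = 0" using s2 by simp
  let ?c = "trace (C ** kron E2 E1)"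
  have "trace ((E1 + (1 / ?b) *\<^sub>R contract2 C E2 + trace E1 *\<^sub>R mat 1) ** E1) = 0"
    by (simp add: e1 trace_zero)
  then have "trace (E1 ** E1) + (1 / ?b) * ?c = 0"
    by (simp add: tE1 matrix_mult.add_left trace_add matrix_mult.scaleR_left trace_scaleR trace_contract2)
  then have q1: "?b * trace (E1 ** E1) = - ?c" by (simp add: field_simps)
  have "trace ((E2 + (1 / ?a) *\<^sub>R contract1 C E1) ** E2) = 0" by (simp add: e2 trace_zero)
  then have "trace (E2 ** E2) + (1 / ?a) * ?c = 0"
    by (simp add: matrix_mult.add_left trace_add matrix_mult.scaleR_left trace_scaleR trace_contract1)
  then have q2: "?a * trace (E2 ** E2) = - ?c" by (simp add: field_simps)
  \<comment> \<open>By balance, \<open>trace (C ** (X ** X))\<close> consists of the two left-hand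
    sides of \<open>q1\<close> and \<open>q2\<close> and twice the cross term, which sum to
    \<open>- ?c + 2 * ?c - ?c\<close>.\<close>
  define X where "X = kron E2 (mat 1) + kron (mat 1 :: real^'b^'b) E1"
  have "X ** X = kron (E2 ** E2) (mat 1) + 2 *\<^sub>R kron E2 E1 + kron (mat 1) (E1 ** E1)"
    by (simp add: X_def matrix_add_ldistrib matrix_mult.add_left kron_mult scaleR_2 add.assoc)
  then have "trace (C ** (X ** X)) = 0"
    by (simp add: matrix_add_ldistrib trace_add matrix_mult.scaleR_right trace_scaleR
        balanced_trace[OF C(2)] q1 q2)
  moreover have "transpose X = X" by (simp add: X_def transpose_add transpose_kron E)
  ultimately have "trace (transpose X ** C ** X) = 0"
    using trace_mult_rotate[of C X X] by (simp add: matrix_mul_assoc)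
  then have X0: "X = 0" using trace_congruence_pos[OF C(1), of X] by force
  \<comment> \<open>Pairing \<open>X = 0\<close> with \<open>kron (mat 1) Y\<close> isolates
    \<open>E1\<close>, because \<open>trace E2 = 0\<close> removes the other summand.\<close>
  have "trace (E1 ** Y) = trace (0 ** Y)" for Y
  proof -
    have "trace (X ** kron (mat 1) Y) = 0" by (simp add: X0 trace_zero)
    then show ?thesis
      by (simp add: X_def matrix_mult.add_left kron_mult trace_add trace_kron tE2 trace_I trace_zero)
  qed
  then show "E1 = 0" by (rule trace_form_nondegenerate)
  then show "E2 = 0" using e2 by (simp add: contract1.zero_right)
qed

text \<open>By cyclicity of the trace the congruence passes from \<open>X\<close> to the test matrix
  \<open>kron S Y\<close>, where it acts on the factors separately.\<close>

lemma contract2_conj: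
  "contract2 (kron P2 P1 ** X ** transpose (kron P2 P1)) S = P1 ** contract2 X (transpose P2 ** S ** P2) ** transpose P1"
proof (rule contract2_eqI)
  fix Y
  have "trace (kron P2 P1 ** X ** transpose (kron P2 P1) ** kron S Y)
      = trace (X ** (transpose (kron P2 P1) ** kron S Y ** kron P2 P1))"
    using trace_mul_sym[of "kron P2 P1" "X ** transpose (kron P2 P1) ** kron S Y"] by (simp add: matrix_mul_assoc)
  also have "\<dots> = trace (contract2 X (transpose P2 ** S ** P2) ** (transpose P1 ** Y ** P1))"
    by (simp add: transpose_kron kron_mult trace_contract2)
  also have "\<dots> = trace (P1 ** contract2 X (transpose P2 ** S ** P2) ** transpose P1 ** Y)"
    using trace_mul_sym[of "contract2 X (transpose P2 ** S ** P2) ** transpose P1 ** Y" P1] by (simp add: matrix_mul_assoc)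
  finally show "trace (kron P2 P1 ** X ** transpose (kron P2 P1) ** kron S Y)
      = trace (P1 ** contract2 X (transpose P2 ** S ** P2) ** transpose P1 ** Y)" .
qed

lemma contract1_conj:
  "contract1 (kron P2 P1 ** X ** transpose (kron P2 P1)) S = P2 ** contract1 X (transpose P1 ** S ** P1) ** transpose P2"
proof (rule contract1_eqI)
  fix Y
  have "trace (kron P2 P1 ** X ** transpose (kron P2 P1) ** kron Y S)
      = trace (X ** (transpose (kron P2 P1) ** kron Y S ** kron P2 P1))"
    using trace_mul_sym[of "kron P2 P1" "X ** transpose (kron P2 P1) ** kron Y S"] by (simp add: matrix_mul_assoc)
  also have "\<dots> = trace (contract1 X (transpose P1 ** S ** P1) ** (transpose P2 ** Y ** P2))"
    by (simp add: transpose_kron kron_mult trace_contract1)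
  also have "\<dots> = trace (P2 ** contract1 X (transpose P1 ** S ** P1) ** transpose P2 ** Y)"
    using trace_mul_sym[of "contract1 X (transpose P1 ** S ** P1) ** transpose P2 ** Y" P2] by (simp add: matrix_mul_assoc)
  finally show "trace (kron P2 P1 ** X ** transpose (kron P2 P1) ** kron Y S)
      = trace (P2 ** contract1 X (transpose P1 ** S ** P1) ** transpose P2 ** Y)" .
qed

lemma sym_sqrt_inverse:
  assumes "S \<in> spd_mats"
  shows "invertible (sym_sqrt S)" "transpose (sym_sqrt S) = sym_sqrt S"
    "transpose (matrix_inv (sym_sqrt S)) = matrix_inv (sym_sqrt S)"
    "matrix_inv (sym_sqrt S) ** matrix_inv (sym_sqrt S) = matrix_inv S"
    "matrix_inv (sym_sqrt S) ** S ** matrix_inv (sym_sqrt S) = mat 1"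
proof -
  note H = sym_sqrt_spd[OF assms]
  show i: "invertible (sym_sqrt S)" and t: "transpose (sym_sqrt S) = sym_sqrt S"
    using H by (simp_all add: spd_invertible spd_sym)
  show "transpose (matrix_inv (sym_sqrt S)) = matrix_inv (sym_sqrt S)"
    by (rule transpose_matrix_inv_sym[OF i t])
  show "matrix_inv (sym_sqrt S) ** matrix_inv (sym_sqrt S) = matrix_inv S"
    using matrix_inv_mult[OF i i] by (simp add: sym_sqrt_square[OF assms])
  have "matrix_inv (sym_sqrt S) ** S ** matrix_inv (sym_sqrt S)
      = (matrix_inv (sym_sqrt S) ** sym_sqrt S) ** (sym_sqrt S ** matrix_inv (sym_sqrt S))"
    using sym_sqrt_square[OF assms] by (metis matrix_mul_assoc)
  then show "matrix_inv (sym_sqrt S) ** S ** matrix_inv (sym_sqrt S) = mat 1"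
    by (simp add: matrix_inv_left[OF i] matrix_inv_right[OF i])
qed

text \<open>Whitening by the square roots of \<open>Y2\<close> and \<open>Y1\<close> turns the score
  equations into the balance conditions, so a stationary point is recognized as the minimizer
  without any second-order argument.\<close>

lemma score_equations_imp_kron_map:
  fixes X :: "real^('b::finite \<times> 'a::finite)^('b \<times> 'a)"
  assumes X: "X \<in> spd_mats" and Y: "Y2 \<in> spd_mats" "Y1 \<in> spd_mats"
    and s: "contract2 X (matrix_inv Y2) = real CARD('b) *\<^sub>R Y1" "contract1 X (matrix_inv Y1) = real CARD('a) *\<^sub>R Y2"
  shows "kron_map X = kron Y2 Y1"
proof -
  let ?H2 = "sym_sqrt Y2" and ?H1 = "sym_sqrt Y1"
  let ?H = "kron ?H2 ?H1" and ?P = "kron (matrix_inv ?H2) (matrix_inv ?H1)"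
  note h2 = sym_sqrt_inverse[OF Y(1)] and h1 = sym_sqrt_inverse[OF Y(2)]
  define C where "C = ?P ** X ** transpose ?P"
  have HP: "?H ** ?P = mat 1" by (rule kron_inverse[OF h2(1) h1(1)])
  have C: "C \<in> spd_mats" unfolding C_def
    by (intro spd_congruence X invertible_kron invertible_matrix_inv h2 h1)
  have "tr1 C = real CARD('b) *\<^sub>R mat 1"
    unfolding contract2_mat_1[symmetric] C_def contract2_conj
    by (simp add: h2 h1 s matrix_mult.scaleR_left matrix_mult.scaleR_right)
  moreover have "tr2 C = real CARD('a) *\<^sub>R mat 1"
    unfolding contract1_mat_1[symmetric] C_def contract1_conj
    by (simp add: h2 h1 s matrix_mult.scaleR_left matrix_mult.scaleR_right)
  ultimately have bal: "balanced C" by (simp add: balanced_def)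
  have "?H ** C ** transpose ?H = (?H ** ?P) ** X ** transpose (?H ** ?P)"
    by (simp add: C_def matrix_mul_assoc matrix_transpose_mul)
  then have "?H ** C ** transpose ?H = X" by (simp add: HP)
  then show ?thesis using kron_map_eqI[OF h2(1) h1(1) C bal]
    by (simp add: kron_gram[symmetric] h2(2) h1(2) sym_sqrt_square Y)
qed

section \<open>Smoothness and derivative of the Kronecker map\<close>

text \<open>
  The score equations are solved for the factors by the implicit function theorem. They are
  redundant and leave the relative scale of the factors free; the multiple \<open>trace Y1 - p1\<close> of the
  identity removes both defects, since it vanishes on every solution.
\<close>

lemma kron_map_smooth_at_core:
  fixes C :: "real^('b::finite \<times> 'a::finite)^('b \<times> 'a)"
  assumes C: "C \<in> spd_mats" "balanced C"
  obtains U F F' where "open U" "C \<in> U" "\<And>n. Ck_on n U F" "\<And>X. X \<in> U \<Longrightarrow> X \<in> spd_mats \<Longrightarrow> F X = kron_map X"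
    "(F has_derivative F') (at C)"
    "\<And>V A1 A2. transpose V = V \<Longrightarrow> transpose A1 = A1 \<Longrightarrow> transpose A2 = A2 \<Longrightarrow> trace A1 = 0 \<Longrightarrow>
      A1 + (1 / real CARD('b)) *\<^sub>R contract2 C A2 = (1 / real CARD('b)) *\<^sub>R tr1 V \<Longrightarrow>
      A2 + (1 / real CARD('a)) *\<^sub>R contract1 C A1 = (1 / real CARD('a)) *\<^sub>R tr2 V \<Longrightarrow>
      F' V = kron A2 (mat 1) + kron (mat 1) A1"
proof -
  let ?a = "real CARD('a)" and ?b = "real CARD('b)"
  \<comment> \<open>\<open>L1\<close> and \<open>L2\<close> collect the terms linear in the two
    unknown factors. The skew parts in them extend the equations to all matrices and force solutions
    to be symmetric.\<close>
  define L1 where "L1 p = sym_part (fst (snd p)) + trace (fst (snd p)) *\<^sub>R mat 1 + (fst (snd p) - transpose (fst (snd p)))"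
    for p :: "(real^('b \<times> 'a)^('b \<times> 'a)) \<times> (real^'a^'a) \<times> (real^'b^'b)"
  define L2 where "L2 p = sym_part (snd (snd p)) + (snd (snd p) - transpose (snd (snd p)))"
    for p :: "(real^('b \<times> 'a)^('b \<times> 'a)) \<times> (real^'a^'a) \<times> (real^'b^'b)"
  define G1 where "G1 p = L1 p + (- (1 / ?b)) *\<^sub>R contract2 (sym_part (fst p)) (matrix_inv (sym_part (snd (snd p)))) + (- ?a) *\<^sub>R mat 1"
    for p :: "(real^('b \<times> 'a)^('b \<times> 'a)) \<times> (real^'a^'a) \<times> (real^'b^'b)"
  define G2 where "G2 p = L2 p + (- (1 / ?a)) *\<^sub>R contract1 (sym_part (fst p)) (matrix_inv (sym_part (fst (snd p))))"
    for p :: "(real^('b \<times> 'a)^('b \<times> 'a)) \<times> (real^'a^'a) \<times> (real^'b^'b)"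
  define G where "G p = (G1 p, G2 p)" for p
  define W where "W = {p :: (real^('b \<times> 'a)^('b \<times> 'a)) \<times> (real^'a^'a) \<times> (real^'b^'b).
    sym_part (fst (snd p)) \<in> spd_mats \<and> sym_part (snd (snd p)) \<in> spd_mats}"
  let ?p0 = "(C, mat 1 :: real^'a^'a, mat 1 :: real^'b^'b)"
  have bl1: "bounded_linear (\<lambda>p. fst (snd p))" and bl2: "bounded_linear (\<lambda>p. snd (snd p))"
    by (intro bounded_linear_compose[OF bounded_linear_fst bounded_linear_snd]
        bounded_linear_compose[OF bounded_linear_snd bounded_linear_snd])+
  note bl = bounded_linear_fst bl1 bl2
  note bls = bl[THEN bounded_linear_compose[OF bounded_linear_sym_part]]
  have blL1: "bounded_linear L1" unfolding L1_def[abs_def]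
    by (intro bounded_linear_add bounded_linear_sub bls bl bounded_linear_scaleR_const
        bounded_linear_compose[OF bounded_linear_transpose bl1] bounded_linear_compose[OF bounded_linear_trace bl1])
  have blL2: "bounded_linear L2" unfolding L2_def[abs_def]
    by (intro bounded_linear_add bounded_linear_sub bls bl bounded_linear_compose[OF bounded_linear_transpose bl2])
  have W: "open W"
  proof -
    have "W = (\<lambda>p. fst (snd p)) -` {A. sym_part A \<in> spd_mats} \<inter> (\<lambda>p. snd (snd p)) -` {A. sym_part A \<in> spd_mats}"
      by (auto simp: W_def)
    then show ?thesis
      by (simp only:) (intro open_Int open_vimage[OF open_sym_part_spd] linear_continuous_on bl1 bl2)
  qed
  have s1: "sym_part (mat 1 :: real^'n^'n) = mat 1" by (simp add: sym_part_eq)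
  have sC: "sym_part C = C" using C(1) by (simp add: sym_part_eq spd_sym)
  have p0: "?p0 \<in> W" by (simp add: W_def s1 spd_mat_1)
  have inv: "Ck_on n W (\<lambda>p. matrix_inv (sym_part (fst (snd p))))"
     "Ck_on n W (\<lambda>p. matrix_inv (sym_part (snd (snd p))))" for n
    by (intro Ck_on_compose[OF W open_invertible Ck_on_bounded_linear[OF W] Ck_on_matrix_inv] bls;
        auto simp: W_def spd_invertible)+
  have CG: "Ck_on n W G" for n
    unfolding G_def G1_def G2_def
    by (intro Ck_on_Pair Ck_on_add Ck_on_const Ck_on_bounded_linear[OF W] blL1 blL2 bls W inv
        Ck_on_bilinear[OF _ bounded_bilinear_scaleR] Ck_on_bilinear[OF _ bounded_bilinear_contract2]
        Ck_on_bilinear[OF _ bounded_bilinear_contract1])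
  \<comment> \<open>The trace of the identity is cancelled by the constant in \<open>G1\<close>;
    what remains is the balance of \<open>C\<close>.\<close>
  have G0: "G ?p0 = 0"
    using C(2) by (simp add: G_def G1_def G2_def L1_def L2_def s1 sC matrix_inv_mat_1 contract2_mat_1 contract1_mat_1
        balanced_def trace_I zero_prod_def)
  define G1' where "G1' q = L1 q + (- (1 / ?b)) *\<^sub>R (tr1 (sym_part (fst q)) - contract2 C (sym_part (snd (snd q))))"
    for q :: "(real^('b \<times> 'a)^('b \<times> 'a)) \<times> (real^'a^'a) \<times> (real^'b^'b)"
  define G2' where "G2' q = L2 q + (- (1 / ?a)) *\<^sub>R (tr2 (sym_part (fst q)) - contract1 C (sym_part (fst (snd q))))"
    for q :: "(real^('b \<times> 'a)^('b \<times> 'a)) \<times> (real^'a^'a) \<times> (real^'b^'b)"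
  have dinv: "((\<lambda>p. matrix_inv (sym_part (fst (snd p)))) has_derivative (\<lambda>q. - sym_part (fst (snd q)))) (at ?p0)"
    "((\<lambda>p. matrix_inv (sym_part (snd (snd p)))) has_derivative (\<lambda>q. - sym_part (snd (snd q)))) (at ?p0)"
    using has_derivative_compose[OF bounded_linear_imp_has_derivative[OF bls(2)] has_derivative_matrix_inv, of ?p0 UNIV]
      has_derivative_compose[OF bounded_linear_imp_has_derivative[OF bls(3)] has_derivative_matrix_inv, of ?p0 UNIV]
    by (simp_all add: s1 matrix_inv_mat_1 spd_invertible[OF spd_mat_1])
  have dG1: "(G1 has_derivative G1') (at ?p0)"
  proof -
    have "(G1 has_derivative (\<lambda>q. L1 q + (- (1 / ?b)) *\<^sub>R (contract2 (sym_part (fst ?p0)) (- sym_part (snd (snd q)))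
        + contract2 (sym_part (fst q)) (matrix_inv (sym_part (snd (snd ?p0))))) + 0)) (at ?p0)"
      unfolding G1_def[abs_def]
      by (intro has_derivative_add has_derivative_const bounded_linear_imp_has_derivative[OF blL1]
          has_derivative_scaleR_right contract2.FDERIV bounded_linear_imp_has_derivative[OF bls(1)] dinv)
    then show ?thesis
      by (simp add: G1'_def[abs_def] sC s1 matrix_inv_mat_1 contract2_mat_1 contract2.minus_right)
  qed
  have dG2: "(G2 has_derivative G2') (at ?p0)"
  proof -
    have "(G2 has_derivative (\<lambda>q. L2 q + (- (1 / ?a)) *\<^sub>R (contract1 (sym_part (fst ?p0)) (- sym_part (fst (snd q)))
        + contract1 (sym_part (fst q)) (matrix_inv (sym_part (fst (snd ?p0))))))) (at ?p0)"
      unfolding G2_def[abs_def]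
      by (intro has_derivative_add has_derivative_const bounded_linear_imp_has_derivative[OF blL2]
          has_derivative_scaleR_right contract1.FDERIV bounded_linear_imp_has_derivative[OF bls(1)] dinv)
    then show ?thesis
      by (simp add: G2'_def[abs_def] sC s1 matrix_inv_mat_1 contract1_mat_1 contract1.minus_right)
  qed
  have dG: "(G has_derivative (\<lambda>q. (G1' q, G2' q))) (at ?p0)"
    unfolding G_def[abs_def] by (intro has_derivative_Pair dG1 dG2)
  have tr_sym: "transpose (tr1 (sym_part V)) = tr1 (sym_part V)" "transpose (tr2 (sym_part V)) = tr2 (sym_part V)"
    for V :: "real^('b \<times> 'a)^('b \<times> 'a)"
    by (simp_all add: contract2_mat_1[symmetric] contract1_mat_1[symmetric] transpose_contract2 transpose_contract1
        transpose_sym_part)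
  have ct_sym: "transpose (contract2 C E) = contract2 C E" "transpose (contract1 C E') = contract1 C E'"
    if "transpose E = E" "transpose E' = E'" for E E'
    using that C(1) by (simp_all add: transpose_contract2 transpose_contract1 spd_sym)
  \<comment> \<open>At a zero of the derivative the components are symmetric, so the projections
    disappear from them and the linearized score equations are left.\<close>
  have lin: "transpose E1 = E1 \<and> transpose E2 = E2 \<and>
      E1 + (1 / ?b) *\<^sub>R contract2 C E2 + trace E1 *\<^sub>R mat 1 = (1 / ?b) *\<^sub>R tr1 (sym_part V) \<and>
      E2 + (1 / ?a) *\<^sub>R contract1 C E1 = (1 / ?a) *\<^sub>R tr2 (sym_part V)"
    if "G1' (V, E1, E2) = 0" "G2' (V, E1, E2) = 0" for V E1 E2
  proof -
    let ?A1 = "sym_part E1 + trace E1 *\<^sub>R mat 1 + (- (1 / ?b)) *\<^sub>R (tr1 (sym_part V) - contract2 C (sym_part E2))"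
    let ?A2 = "sym_part E2 + (- (1 / ?a)) *\<^sub>R (tr2 (sym_part V) - contract1 C (sym_part E1))"
    have z: "?A1 + (E1 - transpose E1) = 0" "?A2 + (E2 - transpose E2) = 0"
      using that by (simp_all add: G1'_def G2'_def L1_def L2_def algebra_simps)
    have s: "transpose ?A1 = ?A1" "transpose ?A2 = ?A2"
      by (simp_all only: transpose_add transpose_diff transpose_scalar transpose_sym_part tr_sym transpose_mat
          ct_sym[OF transpose_sym_part transpose_sym_part])
    note zz1 = sym_skew_zero[OF z(1) s(1)] and zz2 = sym_skew_zero[OF z(2) s(2)]
    then show ?thesis by (simp add: sym_part_eq algebra_simps)
  qed
  have inj: "e = 0" if "frechet_derivative G (at ?p0) (0, e) = 0" for e
  proof -
    obtain E1 E2 where e: "e = (E1, E2)" by (cases e)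
    have z: "G1' (0, E1, E2) = 0" "G2' (0, E1, E2) = 0"
      using that by (simp_all add: frechet_derivative_at[OF dG, symmetric] e zero_prod_def)
    have "sym_part (0 :: real^('b \<times> 'a)^('b \<times> 'a)) = 0" by (simp add: sym_part_def transpose_zero)
    moreover have "tr1 (0 :: real^('b \<times> 'a)^('b \<times> 'a)) = 0" "tr2 (0 :: real^('b \<times> 'a)^('b \<times> 'a)) = 0"
      by (simp_all add: contract2_mat_1[symmetric] contract1_mat_1[symmetric] contract2.zero_left contract1.zero_left)
    ultimately show ?thesis using lin[OF z] core_score_injective[OF C, of E1 E2] by (simp add: e zero_prod_def)
  qed
  obtain U g where U: "open U" "C \<in> U" "g C = (mat 1, mat 1)" "\<And>n. Ck_on n U g"
    "\<And>X. X \<in> U \<Longrightarrow> (X, g X) \<in> W \<and> G (X, g X) = 0"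
    by (rule implicit_function_smooth[OF W p0 CG G0]) (erule inj, rule that)
  define F where "F X = kron (sym_part (snd (g X))) (sym_part (fst (g X)))" for X
  have CF: "Ck_on n U F" for n
    unfolding F_def
    by (intro Ck_on_bilinear[OF U(1) bounded_bilinear_kron] Ck_on_linear_comp[OF U(1) _ U(4)]
        bounded_linear_compose[OF bounded_linear_sym_part] bounded_linear_fst bounded_linear_snd)
  have F_eq: "F X = kron_map X" if X: "X \<in> U" "X \<in> spd_mats" for X
  proof -
    obtain Y1 Y2 where g: "g X = (Y1, Y2)" by (cases "g X")
    have sp: "sym_part Y1 \<in> spd_mats" "sym_part Y2 \<in> spd_mats" and z: "G1 (X, Y1, Y2) = 0" "G2 (X, Y1, Y2) = 0"
      using U(5)[OF X(1)] by (auto simp: g W_def G_def zero_prod_def)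
    let ?A1 = "sym_part Y1 + trace Y1 *\<^sub>R mat 1 + (- (1 / ?b)) *\<^sub>R contract2 (sym_part X) (matrix_inv (sym_part Y2)) + (- ?a) *\<^sub>R mat 1"
    let ?A2 = "sym_part Y2 + (- (1 / ?a)) *\<^sub>R contract1 (sym_part X) (matrix_inv (sym_part Y1))"
    have z': "?A1 + (Y1 - transpose Y1) = 0" "?A2 + (Y2 - transpose Y2) = 0"
      using z by (simp_all add: G1_def G2_def L1_def L2_def algebra_simps)
    have s: "transpose ?A1 = ?A1" "transpose ?A2 = ?A2"
      by (simp_all only: transpose_add transpose_scalar transpose_sym_part transpose_contract2 transpose_contract1
          transpose_mat transpose_matrix_inv_sym[OF spd_invertible[OF sp(1)]] transpose_matrix_inv_sym[OF spd_invertible[OF sp(2)]])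
    note zz1 = sym_skew_zero[OF z'(1) s(1)] and zz2 = sym_skew_zero[OF z'(2) s(2)]
    have sY: "sym_part Y1 = Y1" "sym_part Y2 = Y2" using zz1(2) zz2(2) by (simp_all add: sym_part_eq)
    have sX: "sym_part X = X" by (rule sym_part_eq[OF spd_sym[OF X(2)]])
    note spY = sp[unfolded sY]
    define \<tau> where "\<tau> = trace Y1 - ?a"
    have q1: "contract2 X (matrix_inv Y2) = ?b *\<^sub>R Y1 + (?b * \<tau>) *\<^sub>R mat 1"
    proof -
      have "(1 / ?b) *\<^sub>R contract2 X (matrix_inv Y2) = Y1 + \<tau> *\<^sub>R mat 1"
        using zz1(1) by (simp add: sY sX \<tau>_def algebra_simps)
      from arg_cong[OF this, of "\<lambda>M. ?b *\<^sub>R M"] show ?thesis by (simp add: scaleR_add_right)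
    qed
    have q2: "contract1 X (matrix_inv Y1) = ?a *\<^sub>R Y2"
    proof -
      have "(1 / ?a) *\<^sub>R contract1 X (matrix_inv Y1) = Y2" using zz2(1) by (simp add: sY sX)
      from arg_cong[OF this, of "\<lambda>M. ?a *\<^sub>R M"] show ?thesis by simp
    qed
    \<comment> \<open>Pairing each equation with the inverse of the other factor's partner evaluates
      the same trace \<open>?t\<close> twice. The results differ by
      \<open>?b * \<tau> * trace (matrix_inv Y1)\<close>, whose last factor is positive, so
      \<open>\<tau> = 0\<close>.\<close>
    let ?t = "trace (X ** kron (matrix_inv Y2) (matrix_inv Y1))"
    have "?t = ?b * ?a + ?b * \<tau> * trace (matrix_inv Y1)"
      using trace_contract2[of X "matrix_inv Y2" "matrix_inv Y1"]
      by (simp add: q1 matrix_mult.add_left matrix_mult.scaleR_left trace_add trace_scaleR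
          matrix_inv_right spd_invertible[OF spY(1)] trace_I)
    moreover have "?t = ?a * ?b"
      using trace_contract1[of X "matrix_inv Y1" "matrix_inv Y2"]
      by (simp add: q2 matrix_mult.scaleR_left trace_scaleR matrix_inv_right spd_invertible[OF spY(2)] trace_I)
    moreover have "trace (matrix_inv Y1) > 0"
      unfolding trace_def by (intro sum_pos spd_diag_pos spd_matrix_inv spY) auto
    ultimately have "\<tau> = 0" by simp
    then have "kron_map X = kron Y2 Y1"
      using q1 q2 by (intro score_equations_imp_kron_map X spY) simp_all
    then show ?thesis by (simp add: F_def g sY)
  qed
  obtain g' where g': "(g has_derivative g') (at C)"
    using U(2) U(4)[of "Suc 0"] unfolding Ck_on_Suc_iff[OF U(1)] by blast
  define F' where "F' V = kron (mat 1) (sym_part (fst (g' V))) + kron (sym_part (snd (g' V))) (mat 1)" for V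
  have dF: "(F has_derivative F') (at C)"
  proof -
    have "(F has_derivative (\<lambda>V. kron (sym_part (snd (g C))) (sym_part (fst (g' V)))
        + kron (sym_part (snd (g' V))) (sym_part (fst (g C))))) (at C)"
      unfolding F_def[abs_def]
      by (intro kron.FDERIV bounded_linear.has_derivative[OF bounded_linear_sym_part] has_derivative_fst has_derivative_snd g')
    then show ?thesis by (simp add: F'_def[abs_def] U(3) s1)
  qed
  \<comment> \<open>Obtained by differentiating \<open>G (X, g X) = 0\<close> at
    \<open>C\<close>.\<close>
  have dGg: "G1' (V, g' V) = 0 \<and> G2' (V, g' V) = 0" for V
  proof -
    have "((\<lambda>X. (X, g X)) has_derivative (\<lambda>V. (V, g' V))) (at C)"
      by (intro has_derivative_Pair has_derivative_ident g')
    from has_derivative_compose[OF this, of G "\<lambda>q. (G1' q, G2' q)"] dG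
    have "((\<lambda>X. G (X, g X)) has_derivative (\<lambda>V. (G1' (V, g' V), G2' (V, g' V)))) (at C)" by (simp add: U(3))
    then have "((\<lambda>X. 0) has_derivative (\<lambda>V. (G1' (V, g' V), G2' (V, g' V)))) (at C)"
      by (rule has_derivative_transform_within_open[OF _ U(1,2)]) (use U(5) in blast)
    then have "(\<lambda>V. (G1' (V, g' V), G2' (V, g' V))) = (\<lambda>V. 0)"
      using has_derivative_const has_derivative_unique by blast
    from fun_cong[OF this, of V] show ?thesis by (simp add: zero_prod_def)
  qed
  \<comment> \<open>As \<open>trace A1 = 0\<close>, the given pair satisfies the equations of
    \<open>g' V\<close> including their trace term; the difference of the two solutions falls under
    \<open>core_score_injective\<close>.\<close>
  have F'_eq: "F' V = kron A2 (mat 1) + kron (mat 1) A1"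
    if V: "transpose V = V" and A: "transpose A1 = A1" "transpose A2 = A2" "trace A1 = 0"
      and e1: "A1 + (1 / ?b) *\<^sub>R contract2 C A2 = (1 / ?b) *\<^sub>R tr1 V"
      and e2: "A2 + (1 / ?a) *\<^sub>R contract1 C A1 = (1 / ?a) *\<^sub>R tr2 V" for V A1 A2
  proof -
    obtain U1 U2 where g: "g' V = (U1, U2)" by (cases "g' V")
    have l: "transpose U1 = U1" "transpose U2 = U2"
      "U1 + (1 / ?b) *\<^sub>R contract2 C U2 + trace U1 *\<^sub>R mat 1 = (1 / ?b) *\<^sub>R tr1 V"
      "U2 + (1 / ?a) *\<^sub>R contract1 C U1 = (1 / ?a) *\<^sub>R tr2 V"
      using lin[of V U1 U2] dGg[of V] by (simp_all add: g sym_part_eq[OF V])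
    have "(U1 - A1) + (1 / ?b) *\<^sub>R contract2 C (U2 - A2) + trace (U1 - A1) *\<^sub>R mat 1 = 0"
      using l(3) e1 by (simp add: contract2.diff_right trace_sub A(3) algebra_simps)
    moreover have "(U2 - A2) + (1 / ?a) *\<^sub>R contract1 C (U1 - A1) = 0"
      using l(4) e2 by (simp add: contract1.diff_right algebra_simps)
    moreover have "transpose (U1 - A1) = U1 - A1" "transpose (U2 - A2) = U2 - A2"
      using l(1,2) A by (simp_all add: transpose_diff)
    ultimately have "U1 - A1 = 0" "U2 - A2 = 0" using core_score_injective[OF C] by blast+
    then show ?thesis using A by (simp add: F'_def g sym_part_eq)
  qed
  show ?thesis by (rule that[OF U(1,2) CF F_eq dF F'_eq])
qed

lemma kron_map_congruence:
  fixes \<Sigma> :: "real^('b::finite \<times> 'a::finite)^('b \<times> 'a)"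
  assumes \<Sigma>: "\<Sigma> \<in> spd_mats" and H: "invertible (H2 :: real^'b^'b)" "invertible (H1 :: real^'a^'a)"
    and K: "kron_map \<Sigma> = kron H2 H1 ** transpose (kron H2 H1)"
  shows "matrix_inv (kron H2 H1) ** \<Sigma> ** transpose (matrix_inv (kron H2 H1)) \<in> core_mats"
proof -
  note iH = invertible_kron[OF H]
  have P: "matrix_inv (kron H2 H1) = kron (matrix_inv H2) (matrix_inv H1)" by (rule matrix_inv_kron[OF H])
  have "kron_map (matrix_inv (kron H2 H1) ** \<Sigma> ** transpose (matrix_inv (kron H2 H1)))
      = (matrix_inv (kron H2 H1) ** kron H2 H1) ** transpose (matrix_inv (kron H2 H1) ** kron H2 H1)"
    unfolding P using kron_map_conj[OF \<Sigma> invertible_matrix_inv[OF H(1)] invertible_matrix_inv[OF H(2)]]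
    by (simp add: K matrix_mul_assoc matrix_transpose_mul)
  then show ?thesis
    using spd_congruence[OF \<Sigma> invertible_matrix_inv[OF iH]] by (simp add: core_mats_def matrix_inv_left[OF iH])
qed

text \<open>Equivariance transports the result from the core: \<open>down\<close> and
  \<open>up\<close> are congruences, hence linear, and pass through derivatives unchanged.\<close>

lemma kron_map_smooth_at:
  fixes \<Sigma> :: "real^('b::finite \<times> 'a::finite)^('b \<times> 'a)"
  defines "P \<equiv> \<lambda>H2 H1. matrix_inv (kron H2 H1)"
  assumes \<Sigma>: "\<Sigma> \<in> spd_mats" and H: "invertible (H2 :: real^'b^'b)" "invertible (H1 :: real^'a^'a)"
    and K: "kron_map \<Sigma> = kron H2 H1 ** transpose (kron H2 H1)"
  obtains U F F' where "open U" "\<Sigma> \<in> U" "\<And>n. Ck_on n U F" "\<And>X. X \<in> U \<Longrightarrow> X \<in> spd_mats \<Longrightarrow> F X = kron_map X"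
    "(F has_derivative F') (at \<Sigma>)"
    "\<And>V A1 A2. transpose V = V \<Longrightarrow> transpose A1 = A1 \<Longrightarrow> transpose A2 = A2 \<Longrightarrow> trace A1 = 0 \<Longrightarrow>
      A1 + (1 / real CARD('b)) *\<^sub>R contract2 (P H2 H1 ** \<Sigma> ** transpose (P H2 H1)) A2
        = (1 / real CARD('b)) *\<^sub>R tr1 (P H2 H1 ** V ** transpose (P H2 H1)) \<Longrightarrow>
      A2 + (1 / real CARD('a)) *\<^sub>R contract1 (P H2 H1 ** \<Sigma> ** transpose (P H2 H1)) A1
        = (1 / real CARD('a)) *\<^sub>R tr2 (P H2 H1 ** V ** transpose (P H2 H1)) \<Longrightarrow>
      F' V = kron H2 H1 ** (kron A2 (mat 1) + kron (mat 1) A1) ** transpose (kron H2 H1)"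
proof -
  let ?H = "kron H2 H1" and ?P = "P H2 H1"
  have iH: "invertible ?H" by (rule invertible_kron[OF H])
  have HP: "?H ** ?P = mat 1" unfolding P_def by (rule matrix_inv_right[OF iH])
  define down where "down X = ?P ** X ** transpose ?P" for X
  define up where "up X = ?H ** X ** transpose ?H" for X
  have bl: "bounded_linear down" "bounded_linear up"
    unfolding down_def[abs_def] up_def[abs_def]
    by (intro bounded_linear_compose[OF matrix_mult.bounded_linear_left] matrix_mult.bounded_linear_right)+
  have down_spd: "down X \<in> spd_mats" if "X \<in> spd_mats" for X
    unfolding down_def P_def by (intro spd_congruence that invertible_matrix_inv iH)
  have up_down: "up (down X) = X" for X
  proof -
    have "up (down X) = (?H ** ?P) ** X ** transpose (?H ** ?P)"
      by (simp add: up_def down_def matrix_mul_assoc matrix_transpose_mul)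
    then show ?thesis by (simp add: HP)
  qed
  define C where "C = down \<Sigma>"
  have "C \<in> core_mats" unfolding C_def down_def P_def by (rule kron_map_congruence[OF \<Sigma> H K])
  then have C: "C \<in> spd_mats" "balanced C" by (simp_all add: core_mats_iff_balanced)
  obtain U F F' where U: "open U" "C \<in> U" "\<And>n. Ck_on n U F" "\<And>X. X \<in> U \<Longrightarrow> X \<in> spd_mats \<Longrightarrow> F X = kron_map X"
    "(F has_derivative F') (at C)"
    and F': "\<And>V A1 A2. transpose V = V \<Longrightarrow> transpose A1 = A1 \<Longrightarrow> transpose A2 = A2 \<Longrightarrow> trace A1 = 0 \<Longrightarrow>
      A1 + (1 / real CARD('b)) *\<^sub>R contract2 C A2 = (1 / real CARD('b)) *\<^sub>R tr1 V \<Longrightarrow>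
      A2 + (1 / real CARD('a)) *\<^sub>R contract1 C A1 = (1 / real CARD('a)) *\<^sub>R tr2 V \<Longrightarrow>
      F' V = kron A2 (mat 1) + kron (mat 1) A1"
    by (rule kron_map_smooth_at_core[OF C], rule that)
  have oU: "open (down -` U)" by (intro open_vimage[OF U(1)] linear_continuous_on bl)
  show ?thesis
  proof (rule that[OF oU])
    show "\<Sigma> \<in> down -` U" using U(2) by (simp add: C_def)
    show "Ck_on n (down -` U) (\<lambda>X. up (F (down X)))" for n
      by (intro Ck_on_linear_comp[OF oU bl(2)] Ck_on_compose[OF oU U(1) Ck_on_bounded_linear[OF oU bl(1)] U(3)]) auto
    show "up (F (down X)) = kron_map X" if "X \<in> down -` U" "X \<in> spd_mats" for X
      using that U(4)[of "down X"] down_spd[OF that(2)] kron_map_conj[OF down_spd[OF that(2)] H] up_down[of X]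
      by (simp add: up_def)
    show "((\<lambda>X. up (F (down X))) has_derivative (\<lambda>V. up (F' (down V)))) (at \<Sigma>)"
      by (intro bounded_linear.has_derivative[OF bl(2)]
          has_derivative_compose[OF bounded_linear_imp_has_derivative[OF bl(1)]]) (use U(5) in \<open>simp add: C_def\<close>)
    fix V A1 A2 assume V: "transpose V = V" and A: "transpose A1 = A1" "transpose A2 = A2" "trace A1 = 0"
      "A1 + (1 / real CARD('b)) *\<^sub>R contract2 (?P ** \<Sigma> ** transpose ?P) A2 = (1 / real CARD('b)) *\<^sub>R tr1 (?P ** V ** transpose ?P)"
      "A2 + (1 / real CARD('a)) *\<^sub>R contract1 (?P ** \<Sigma> ** transpose ?P) A1 = (1 / real CARD('a)) *\<^sub>R tr2 (?P ** V ** transpose ?P)"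
    have "transpose (down V) = down V" by (simp add: down_def matrix_transpose_mul V matrix_mul_assoc)
    from F'[OF this A(1-3)] A(4,5)
    show "up (F' (down V)) = ?H ** (kron A2 (mat 1) + kron (mat 1) A1) ** transpose ?H"
      by (simp add: C_def down_def up_def)
  qed
qed

lemma smooth_map_on_kron_map:
  "smooth_map_on (spd_mats :: (real^('b::finite \<times> 'a::finite)^('b \<times> 'a)) set) kron_map"
proof (rule smooth_map_onI)
  fix \<Sigma> :: "real^('b \<times> 'a)^('b \<times> 'a)" assume \<Sigma>: "\<Sigma> \<in> spd_mats"
  obtain A2 A1 where A: "A2 \<in> spd_mats" "A1 \<in> spd_mats" and K: "kron_map \<Sigma> = kron A2 A1 ** kron A2 A1"
    using kron_map_decomposition[OF \<Sigma>] by metis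
  have K': "kron_map \<Sigma> = kron A2 A1 ** transpose (kron A2 A1)" using A by (simp add: K transpose_kron spd_sym)
  obtain U F where "open U" "\<Sigma> \<in> U" "\<And>n. Ck_on n U F" "\<And>X. X \<in> U \<Longrightarrow> X \<in> spd_mats \<Longrightarrow> F X = kron_map X"
    by (rule kron_map_smooth_at[OF \<Sigma> spd_invertible[OF A(1)] spd_invertible[OF A(2)] K'], rule that)
  then show "\<exists>U F. open U \<and> \<Sigma> \<in> U \<and> (\<forall>n. Ck_on n U F) \<and> (\<forall>y\<in>U \<inter> spd_mats. F y = kron_map y)"
    by (intro exI[of _ U] exI[of _ F]) simp
qed

text \<open>The line through \<open>A\<close> in direction \<open>V\<close> stays in
  \<open>spd_mats\<close> for small parameters, and along it all derivatives within the set agree.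
  So any derivative found by the usual rules computes \<open>differential\<close>.\<close>

lemma differential_spd_eq:
  fixes f :: "real^'n^'n \<Rightarrow> 'w::euclidean_space"
  assumes "A \<in> spd_mats" "V \<in> sym_mats" "(f has_derivative D) (at A within spd_mats)"
  shows "differential spd_mats f A V = D V"
proof -
  obtain T where T: "open T" "(0::real) \<in> T" "\<And>t. t \<in> T \<Longrightarrow> A + t *\<^sub>R V \<in> spd_mats"
    by (rule spd_line[OF assms(1,2)], rule that)
  have "f differentiable (at A within spd_mats)" using assms(3) by (auto simp: differentiable_def)
  moreover have "((\<lambda>t. A + t *\<^sub>R V) has_vector_derivative V) (at 0)"
    by (auto intro!: derivative_eq_intros)
  ultimately show ?thesis
    using has_derivative_within_unique_along[OF has_derivative_differential assms(3) _ _ T] by simp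
qed

section \<open>The operator of the differential\<close>

locale factor_pair =
  fixes \<Sigma>1 :: "real^'a^'a" and \<Sigma>2 :: "real^'b^'b"
  assumes \<Sigma>1: "\<Sigma>1 \<in> spd_mats" and \<Sigma>2: "\<Sigma>2 \<in> spd_mats"
begin

abbreviation "H1 \<equiv> sym_sqrt \<Sigma>1"
abbreviation "H2 \<equiv> sym_sqrt \<Sigma>2"
abbreviation "whiten1 U \<equiv> matrix_inv H1 ** U ** matrix_inv H1"
abbreviation "whiten2 U \<equiv> matrix_inv H2 ** U ** matrix_inv H2"

lemmas root1 = sym_sqrt_inverse[OF \<Sigma>1] and root2 = sym_sqrt_inverse[OF \<Sigma>2]

lemma whiten_inverse:
  "whiten1 (H1 ** X ** H1) = X" "H1 ** whiten1 X ** H1 = X"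
  "whiten2 (H2 ** Y ** H2) = Y" "H2 ** whiten2 Y ** H2 = Y"
  by (simp_all add: matrix_mul_assoc matrix_inv_left matrix_inv_right matrix_inv_right_cancel root1(1) root2(1))

lemma R_op_eq:
  "R_op \<Sigma>1 \<Sigma>2 C (U1, U2) =
    (U1 + (1 / real CARD('b)) *\<^sub>R (H1 ** contract2 C (whiten2 U2) ** H1) - ((1 / real CARD('b)) * trace (whiten2 U2)) *\<^sub>R \<Sigma>1,
     U2 + (1 / real CARD('a)) *\<^sub>R (H2 ** contract1 C (whiten1 U1) ** H2))"
  by (simp add: R_op_def Let_def contract2_def contract1_def)

lemma linear_R_op: "linear (R_op \<Sigma>1 \<Sigma>2 C)"
proof (rule linearI)
  fix U V :: "(real^'a^'a) \<times> (real^'b^'b)" and c :: real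
  obtain U1 U2 V1 V2 where "U = (U1, U2)" "V = (V1, V2)" by (cases U, cases V)
  then show "R_op \<Sigma>1 \<Sigma>2 C (U + V) = R_op \<Sigma>1 \<Sigma>2 C U + R_op \<Sigma>1 \<Sigma>2 C V" "R_op \<Sigma>1 \<Sigma>2 C (c *\<^sub>R U) = c *\<^sub>R R_op \<Sigma>1 \<Sigma>2 C U"
    by (simp_all add: R_op_eq matrix_mult.add_left matrix_add_ldistrib matrix_mult.scaleR_left matrix_mult.scaleR_right
        contract1.add_right contract2.add_right contract1.scaleR_right contract2.scaleR_right trace_add trace_scaleR
        algebra_simps)
qed

lemma whiten_sym:
  "transpose (whiten1 U1) = whiten1 U1 \<longleftrightarrow> transpose U1 = U1"
  "transpose (whiten2 U2) = whiten2 U2 \<longleftrightarrow> transpose U2 = U2"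
proof -
  have "transpose (whiten1 U1) = whiten1 (transpose U1)" "transpose (whiten2 U2) = whiten2 (transpose U2)"
    by (simp_all add: matrix_transpose_mul root1(3) root2(3) matrix_mul_assoc)
  then show "transpose (whiten1 U1) = whiten1 U1 \<longleftrightarrow> transpose U1 = U1"
    "transpose (whiten2 U2) = whiten2 U2 \<longleftrightarrow> transpose U2 = U2"
    using whiten_inverse(2)[of U1] whiten_inverse(2)[of "transpose U1"]
      whiten_inverse(4)[of U2] whiten_inverse(4)[of "transpose U2"] by metis+
qed

lemma trace_whiten1: "trace (whiten1 U) = trace (matrix_inv \<Sigma>1 ** U)"
  using trace_mult_rotate[of "matrix_inv H1" U "matrix_inv H1"] by (simp add: root1(4))

lemma tangent_pairs_iff:
  "(U1, U2) \<in> tangent_pairs \<Sigma>1 \<longleftrightarrow>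
    transpose (whiten1 U1) = whiten1 U1 \<and> transpose (whiten2 U2) = whiten2 U2 \<and> trace (whiten1 U1) = 0"
  by (simp add: tangent_pairs_def sym_mats_def whiten_sym trace_whiten1)

lemma whiten1_\<Sigma>1: "whiten1 \<Sigma>1 = mat 1"
  by (rule root1(5))

text \<open>In whitened coordinates the square roots disappear and the linearized score equations
  are left, except that the trace term now involves the second unknown.\<close>

lemma whiten_R_op:
  assumes "R_op \<Sigma>1 \<Sigma>2 C (U1, U2) = (N1, N2)"
  shows "whiten1 U1 + (1 / real CARD('b)) *\<^sub>R contract2 C (whiten2 U2) - ((1 / real CARD('b)) * trace (whiten2 U2)) *\<^sub>R mat 1 = whiten1 N1"
    "whiten2 U2 + (1 / real CARD('a)) *\<^sub>R contract1 C (whiten1 U1) = whiten2 N2"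
proof -
  have 1: "N1 = U1 + (1 / real CARD('b)) *\<^sub>R (H1 ** contract2 C (whiten2 U2) ** H1) - ((1 / real CARD('b)) * trace (whiten2 U2)) *\<^sub>R \<Sigma>1"
    and 2: "N2 = U2 + (1 / real CARD('a)) *\<^sub>R (H2 ** contract1 C (whiten1 U1) ** H2)"
    using assms by (simp_all add: R_op_eq)
  have w1: "whiten1 (A + a *\<^sub>R B - b *\<^sub>R D) = whiten1 A + a *\<^sub>R whiten1 B - b *\<^sub>R whiten1 D" for A B D a b
    by (simp add: matrix_mult.add_left matrix_mult.diff_left matrix_add_ldistrib matrix_mult.diff_right
        matrix_mult.scaleR_left matrix_mult.scaleR_right)
  have w2: "whiten2 (A + a *\<^sub>R B) = whiten2 A + a *\<^sub>R whiten2 B" for A B a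
    by (simp add: matrix_mult.add_left matrix_add_ldistrib matrix_mult.scaleR_left matrix_mult.scaleR_right)
  show "whiten1 U1 + (1 / real CARD('b)) *\<^sub>R contract2 C (whiten2 U2) - ((1 / real CARD('b)) * trace (whiten2 U2)) *\<^sub>R mat 1 = whiten1 N1"
    unfolding 1 w1 whiten_inverse(1) whiten1_\<Sigma>1 ..
  show "whiten2 U2 + (1 / real CARD('a)) *\<^sub>R contract1 C (whiten1 U1) = whiten2 N2"
    unfolding 2 w2 whiten_inverse(3) ..
qed

lemma subspace_tangent_pairs: "subspace (tangent_pairs \<Sigma>1 :: ((real^'a^'a) \<times> (real^'b^'b)) set)"
  unfolding subspace_def
  by (auto simp: tangent_pairs_def sym_mats_def zero_prod_def transpose_zero transpose_add transpose_scalar trace_zero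
      matrix_add_ldistrib trace_add matrix_mult.scaleR_right trace_scaleR)

text \<open>For a core matrix the trace of \<open>contract2 C X\<close> is \<open>p1\<close> times
  that of \<open>X\<close>, exactly what the subtracted multiple of \<open>\<Sigma>1\<close>
  removes; this keeps the first component in the tangent space.\<close>

lemma R_op_tangent_pairs:
  assumes C: "C \<in> core_mats" and U: "U \<in> tangent_pairs \<Sigma>1"
  shows "R_op \<Sigma>1 \<Sigma>2 C U \<in> tangent_pairs \<Sigma>1"
proof -
  obtain U1 U2 where U': "U = (U1, U2)" by (cases U)
  obtain N1 N2 where N: "R_op \<Sigma>1 \<Sigma>2 C (U1, U2) = (N1, N2)" by (cases "R_op \<Sigma>1 \<Sigma>2 C (U1, U2)")
  have C': "transpose C = C" "balanced C" using C by (simp_all add: core_mats_iff_balanced spd_sym)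
  have u: "transpose (whiten1 U1) = whiten1 U1" "transpose (whiten2 U2) = whiten2 U2" "trace (whiten1 U1) = 0"
    using U unfolding U' tangent_pairs_iff by blast+
  note w = whiten_R_op[OF N, symmetric]
  have "transpose (whiten1 N1) = whiten1 N1" "transpose (whiten2 N2) = whiten2 N2"
    unfolding w by (simp_all only: transpose_add transpose_diff transpose_scalar transpose_contract2 transpose_contract1 C'(1) u transpose_mat)
  moreover have "trace (contract2 C (whiten2 U2)) = real CARD('a) * trace (whiten2 U2)"
    using trace_contract2[of C "whiten2 U2" "mat 1"] balanced_trace(2)[OF C'(2)] by simp
  then have "trace (whiten1 N1) = 0" unfolding w by (simp add: trace_add trace_sub trace_scaleR u(3) trace_I)
  ultimately show ?thesis unfolding U' N tangent_pairs_iff by blast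
qed

text \<open>On the kernel the traced second equation gives \<open>trace (whiten2 U2) = 0\<close>.
  Then the trace terms of \<open>R_op\<close> and of \<open>core_score_injective\<close> both
  vanish, and the two systems coincide.\<close>

lemma R_op_injective:
  assumes C: "C \<in> core_mats" and U: "U \<in> tangent_pairs \<Sigma>1" and z: "R_op \<Sigma>1 \<Sigma>2 C U = 0"
  shows "U = 0"
proof -
  obtain U1 U2 where U': "U = (U1, U2)" by (cases U)
  have C': "C \<in> spd_mats" "balanced C" using C by (simp_all add: core_mats_iff_balanced)
  have u: "transpose (whiten1 U1) = whiten1 U1" "transpose (whiten2 U2) = whiten2 U2" "trace (whiten1 U1) = 0"
    using U unfolding U' tangent_pairs_iff by blast+
  have "R_op \<Sigma>1 \<Sigma>2 C (U1, U2) = (0, 0)" using z by (simp add: U' zero_prod_def)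
  note w = whiten_R_op[OF this, simplified]
  have "trace (contract1 C (whiten1 U1)) = 0"
    using trace_contract1[of C "whiten1 U1" "mat 1"] balanced_trace(1)[OF C'(2)] u(3) by simp
  then have "trace (whiten2 U2) = 0"
    using arg_cong[OF w(2), of trace] by (simp add: trace_add trace_scaleR trace_zero)
  then have "whiten1 U1 = 0" "whiten2 U2 = 0"
    using core_score_injective[OF C' u(1,2)] w by (simp_all add: u(3) trace_zero)
  then show ?thesis using whiten_inverse(2)[of U1] whiten_inverse(4)[of U2] by (simp add: U' zero_prod_def)
qed

text \<open>An injective linear map of a finite-dimensional subspace into itself is onto. Since
  \<open>C\<close> is any core matrix, this covers the Cholesky core as well as the symmetric
  one.\<close>

lemma bij_betw_R_op:
  assumes C: "C \<in> core_mats"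
  shows "bij_betw (R_op \<Sigma>1 \<Sigma>2 C) (tangent_pairs \<Sigma>1) (tangent_pairs \<Sigma>1)"
proof -
  let ?T = "tangent_pairs \<Sigma>1 :: ((real^'a^'a) \<times> (real^'b^'b)) set"
  have inj: "inj_on (R_op \<Sigma>1 \<Sigma>2 C) ?T"
  proof (rule inj_onI)
    fix U V assume UV: "U \<in> ?T" "V \<in> ?T" "R_op \<Sigma>1 \<Sigma>2 C U = R_op \<Sigma>1 \<Sigma>2 C V"
    then have "R_op \<Sigma>1 \<Sigma>2 C (U - V) = 0" by (simp add: linear_diff[OF linear_R_op])
    then have "U - V = 0" by (rule R_op_injective[OF C subspace_diff[OF subspace_tangent_pairs UV(1,2)]])
    then show "U = V" by simp
  qed
  have sp: "span ?T = ?T" using subspace_tangent_pairs span_eq_iff by blast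
  have "dim (R_op \<Sigma>1 \<Sigma>2 C ` ?T) = dim ?T"
    by (rule dim_image_eq[OF linear_R_op]) (simp only: sp inj)
  moreover have "R_op \<Sigma>1 \<Sigma>2 C ` ?T \<subseteq> ?T" using R_op_tangent_pairs[OF C] by blast
  ultimately have "R_op \<Sigma>1 \<Sigma>2 C ` ?T = ?T"
    by (intro subspace_dim_equal linear_subspace_image linear_R_op subspace_tangent_pairs) simp_all
  with inj show ?thesis by (simp add: bij_betw_def)
qed

text \<open>Contracting the identity yields traces times the identity: the one from
  \<open>U2\<close> is cancelled by the trace term of \<open>R_op\<close>, the one from
  \<open>U1\<close> vanishes on the tangent space.\<close>

lemma R_op_mat_1:
  assumes "U \<in> tangent_pairs \<Sigma>1"
  shows "R_op \<Sigma>1 \<Sigma>2 (mat 1) U = U"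
proof -
  obtain U1 U2 where U': "U = (U1, U2)" by (cases U)
  have u: "trace (whiten1 U1) = 0" using assms unfolding U' tangent_pairs_iff by blast
  have 1: "contract2 (mat 1) A = trace A *\<^sub>R mat 1" for A :: "real^'b^'b"
    by (rule contract2_eqI) (simp add: trace_kron matrix_mult.scaleR_left trace_scaleR)
  have 2: "contract1 (mat 1) A = trace A *\<^sub>R mat 1" for A :: "real^'a^'a"
    by (rule contract1_eqI) (simp add: trace_kron matrix_mult.scaleR_left trace_scaleR)
  show ?thesis
    by (simp add: U' R_op_eq 1 2 u matrix_mult.scaleR_left matrix_mult.scaleR_right sym_sqrt_square \<Sigma>1)
qed

end

section \<open>Square roots of Kronecker products and the core map\<close>

text \<open>What the symmetric root and the Cholesky factor have in common. The Kronecker form of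
  \<open>h K\<close> is what allows equivariance of \<open>kron_map\<close> to be applied.\<close>

definition kron_root :: "(real^('b::finite \<times> 'a::finite)^('b \<times> 'a) \<Rightarrow> real^('b \<times> 'a)^('b \<times> 'a)) \<Rightarrow> bool"
  where "kron_root h \<longleftrightarrow> smooth_map_on kron_spd h \<and>
    (\<forall>K\<in>kron_spd. h K ** transpose (h K) = K \<and>
      (\<exists>B2 B1. invertible B2 \<and> invertible B1 \<and> h K = kron B2 B1))"

lemma kron_root_sym_sqrt:
  "kron_root (sym_sqrt :: real^('b::finite \<times> 'a::finite)^('b \<times> 'a) \<Rightarrow> _)"
  unfolding kron_root_def
proof (intro conjI ballI)
  show "smooth_map_on kron_spd (sym_sqrt :: real^('b \<times> 'a)^('b \<times> 'a) \<Rightarrow> _)"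
    by (rule smooth_map_on_subset[OF smooth_map_on_sym_sqrt kron_spd_subset_spd])
  fix K :: "real^('b \<times> 'a)^('b \<times> 'a)" assume K: "K \<in> kron_spd"
  then have "K \<in> spd_mats" using kron_spd_subset_spd by blast
  then show "sym_sqrt K ** transpose (sym_sqrt K) = K" by (simp add: spd_sym[OF sym_sqrt_spd] sym_sqrt_square)
  obtain K2 K1 where K': "K = kron K2 K1" "K2 \<in> spd_mats" "K1 \<in> spd_mats" using K by (auto simp: kron_spd_def)
  then show "\<exists>B2 B1. invertible B2 \<and> invertible B1 \<and> sym_sqrt K = kron B2 B1"
    by (intro exI[of _ "sym_sqrt K2"] exI[of _ "sym_sqrt K1"]) (simp add: sym_sqrt_kron sym_sqrt_inverse)
qed

lemma kron_root_cholesky: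
  "kron_root (cholesky lex_less :: real^('b::{finite,linorder} \<times> 'a::{finite,linorder})^('b \<times> 'a) \<Rightarrow> _)"
  unfolding kron_root_def
proof (intro conjI ballI)
  interpret l: strict_total_order "lex_less :: 'b \<times> 'a \<Rightarrow> _" by (rule strict_total_order_lex_less)
  interpret la: strict_total_order "(<) :: 'a \<Rightarrow> _" by (rule strict_total_order_less)
  interpret lb: strict_total_order "(<) :: 'b \<Rightarrow> _" by (rule strict_total_order_less)
  show "smooth_map_on kron_spd (cholesky lex_less :: real^('b \<times> 'a)^('b \<times> 'a) \<Rightarrow> _)"
    by (rule smooth_map_on_subset[OF l.smooth_map_on_cholesky kron_spd_subset_spd])
  fix K :: "real^('b \<times> 'a)^('b \<times> 'a)" assume K: "K \<in> kron_spd"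
  then have "K \<in> spd_mats" using kron_spd_subset_spd by blast
  then show "cholesky lex_less K ** transpose (cholesky lex_less K) = K" by (rule l.cholesky_props(3))
  obtain K2 K1 where K': "K = kron K2 K1" "K2 \<in> spd_mats" "K1 \<in> spd_mats" using K by (auto simp: kron_spd_def)
  then show "\<exists>B2 B1. invertible B2 \<and> invertible B1 \<and> cholesky lex_less K = kron B2 B1"
    by (intro exI[of _ "cholesky (<) K2"] exI[of _ "cholesky (<) K1"])
       (simp add: cholesky_kron la.cholesky_invertible lb.cholesky_invertible)
qed

lemma congruence_inverse:
  assumes "invertible (B :: real^'n^'n)"
  shows "B ** (matrix_inv B ** X ** transpose (matrix_inv B)) ** transpose B = X"
    "matrix_inv B ** (B ** X ** transpose B) ** transpose (matrix_inv B) = X"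
proof -
  have "B ** (matrix_inv B ** X ** transpose (matrix_inv B)) ** transpose B
      = (B ** matrix_inv B) ** X ** transpose (B ** matrix_inv B)"
    by (simp add: matrix_mul_assoc matrix_transpose_mul)
  then show "B ** (matrix_inv B ** X ** transpose (matrix_inv B)) ** transpose B = X"
    by (simp add: matrix_inv_right[OF assms])
  have "matrix_inv B ** (B ** X ** transpose B) ** transpose (matrix_inv B)
      = (matrix_inv B ** B) ** X ** transpose (matrix_inv B ** B)"
    by (simp add: matrix_mul_assoc matrix_transpose_mul)
  then show "matrix_inv B ** (B ** X ** transpose B) ** transpose (matrix_inv B) = X"
    by (simp add: matrix_inv_left[OF assms])
qed

locale kron_square_root =
  fixes h :: "real^('b::finite \<times> 'a::finite)^('b \<times> 'a) \<Rightarrow> real^('b \<times> 'a)^('b \<times> 'a)"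
  assumes root: "kron_root h"
begin

lemma smooth: "smooth_map_on kron_spd h"
  using root by (simp add: kron_root_def)

lemma square: "K \<in> kron_spd \<Longrightarrow> h K ** transpose (h K) = K"
  using root by (simp add: kron_root_def)

lemma kron_factors:
  assumes "K \<in> kron_spd"
  obtains B2 B1 where "invertible B2" "invertible B1" "h K = kron B2 B1"
  using root assms unfolding kron_root_def by metis

lemma invertible: "K \<in> kron_spd \<Longrightarrow> invertible (h K)"
  by (erule kron_factors) (simp add: invertible_kron)

lemma core_map_in_core_mats:
  assumes "\<Sigma> \<in> spd_mats"
  shows "core_map h \<Sigma> \<in> core_mats"
proof -
  note K = kron_map_in_kron_spd[OF assms]
  obtain B2 B1 where B: "invertible B2" "invertible B1" "h (kron_map \<Sigma>) = kron B2 B1" using kron_factors[OF K] .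
  have "kron_map \<Sigma> = kron B2 B1 ** transpose (kron B2 B1)" using square[OF K] by (simp add: B(3))
  from kron_map_congruence[OF assms B(1,2) this] show ?thesis by (simp add: core_map_def B(3))
qed

lemma kron_map_recompose:
  assumes "K \<in> kron_spd" "C \<in> core_mats"
  shows "h K ** C ** transpose (h K) \<in> spd_mats" "kron_map (h K ** C ** transpose (h K)) = K"
proof -
  have C: "C \<in> spd_mats" "kron_map C = mat 1" using assms(2) by (simp_all add: core_mats_def)
  show "h K ** C ** transpose (h K) \<in> spd_mats" by (intro spd_congruence C invertible assms)
  obtain B2 B1 where B: "invertible B2" "invertible B1" "h K = kron B2 B1" using kron_factors[OF assms(1)] .
  show "kron_map (h K ** C ** transpose (h K)) = K"
    using kron_map_conj[OF C(1) B(1,2)] square[OF assms(1)] by (simp add: B(3) C(2))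
qed

lemma smooth_map_on_core_map: "smooth_map_on spd_mats (core_map h)"
proof -
  have "smooth_map_on spd_mats (\<lambda>\<Sigma>. h (kron_map \<Sigma>))"
    by (rule smooth_map_on_compose[OF smooth_map_on_kron_map smooth]) (auto intro: kron_map_in_kron_spd)
  then have hi: "smooth_map_on spd_mats (\<lambda>\<Sigma>. matrix_inv (h (kron_map \<Sigma>)))"
    by (rule smooth_map_on_compose[OF _ smooth_map_on_matrix_inv]) (auto intro: invertible kron_map_in_kron_spd)
  show ?thesis unfolding core_map_def[abs_def]
    by (intro smooth_map_on_bilinear[OF bounded_bilinear_matrix_mult] hi
        smooth_map_on_linear_comp[OF bounded_linear_transpose] smooth_map_on_bounded_linear bounded_linear_ident)
qed

lemma smooth_decomposition: "smooth_map_on spd_mats (\<lambda>\<Sigma>. (kron_map \<Sigma>, core_map h \<Sigma>))"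
  by (intro smooth_map_on_Pair smooth_map_on_kron_map smooth_map_on_core_map)

lemma diffeomorphism_decomposition:
  "diffeomorphism spd_mats (kron_spd \<times> core_mats) (\<lambda>\<Sigma>. (kron_map \<Sigma>, core_map h \<Sigma>))
    (\<lambda>(K, C). h K ** C ** transpose (h K))"
  unfolding diffeomorphism_def
proof (intro conjI)
  show "(\<lambda>\<Sigma>. (kron_map \<Sigma>, core_map h \<Sigma>)) ` spd_mats \<subseteq> kron_spd \<times> core_mats"
    by (auto intro: kron_map_in_kron_spd core_map_in_core_mats)
  show "(\<lambda>(K, C). h K ** C ** transpose (h K)) ` (kron_spd \<times> core_mats) \<subseteq> spd_mats"
    by (auto intro: kron_map_recompose)
  show "\<forall>x\<in>spd_mats. (case (kron_map x, core_map h x) of (K, C) \<Rightarrow> h K ** C ** transpose (h K)) = x"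
    by (simp add: core_map_def congruence_inverse invertible kron_map_in_kron_spd)
  show "\<forall>y\<in>kron_spd \<times> core_mats. (kron_map (case y of (K, C) \<Rightarrow> h K ** C ** transpose (h K)),
      core_map h (case y of (K, C) \<Rightarrow> h K ** C ** transpose (h K))) = y"
    by (auto simp: core_map_def kron_map_recompose congruence_inverse invertible)
  have hf: "smooth_map_on (kron_spd \<times> core_mats) (\<lambda>y. h (fst y))"
    by (rule smooth_map_on_compose[OF smooth_map_on_bounded_linear[OF bounded_linear_fst] smooth]) auto
  then show "smooth_map_on (kron_spd \<times> core_mats) (\<lambda>(K, C). h K ** C ** transpose (h K))"
    unfolding case_prod_beta'
    by (intro smooth_map_on_bilinear[OF bounded_bilinear_matrix_mult] hf
        smooth_map_on_linear_comp[OF bounded_linear_transpose hf] smooth_map_on_bounded_linear[OF bounded_linear_snd])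
qed (rule smooth_decomposition)

lemma core_map_eq_mat_1_iff:
  assumes "\<Sigma> \<in> spd_mats"
  shows "core_map h \<Sigma> = mat 1 \<longleftrightarrow> \<Sigma> = kron_map \<Sigma>"
proof -
  note K = kron_map_in_kron_spd[OF assms] note iK = invertible[OF K]
  have "h (kron_map \<Sigma>) ** core_map h \<Sigma> ** transpose (h (kron_map \<Sigma>)) = \<Sigma>"
    by (simp add: core_map_def congruence_inverse iK)
  moreover have "matrix_inv (h (kron_map \<Sigma>)) ** kron_map \<Sigma> ** transpose (matrix_inv (h (kron_map \<Sigma>))) = mat 1"
    using congruence_inverse(2)[OF iK, of "mat 1"] square[OF K] by simp
  ultimately show ?thesis using square[OF K] by (metis core_map_def matrix_mul_rid)
qed

section \<open>Differential of the core map\<close>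

context
  fixes \<Sigma> V :: "real^('b \<times> 'a)^('b \<times> 'a)"
  assumes \<Sigma>: "\<Sigma> \<in> spd_mats" and V: "V \<in> sym_mats"
begin

abbreviation "K \<equiv> kron_map \<Sigma>"
abbreviation "hK \<equiv> h K"
abbreviation "dk \<equiv> differential spd_mats kron_map \<Sigma>"
abbreviation "dh \<equiv> differential kron_spd h K"

lemma h_differentiable: "h differentiable (at K within kron_spd)"
  by (rule smooth_map_on_differentiable[OF smooth kron_map_in_kron_spd[OF \<Sigma>]])

lemma has_derivative_kron_map: "(kron_map has_derivative dk) (at \<Sigma> within spd_mats)"
  by (intro has_derivative_differential smooth_map_on_differentiable[OF smooth_map_on_kron_map \<Sigma>])

text \<open>The derivative of \<open>h\<close> is taken within \<open>kron_spd\<close>; it restricts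
  to the image of \<open>spd_mats\<close> under \<open>kron_map\<close>, which is where the chain
  rule needs it.\<close>

lemma has_derivative_h_kron_map: "((\<lambda>X. h (kron_map X)) has_derivative (\<lambda>E. dh (dk E))) (at \<Sigma> within spd_mats)"
proof -
  have "(h has_derivative dh) (at K within kron_map ` spd_mats)"
    by (rule has_derivative_subset[OF has_derivative_differential[OF h_differentiable]])
       (auto intro: kron_map_in_kron_spd)
  from diff_chain_within[OF has_derivative_kron_map this] show ?thesis by (simp add: o_def)
qed

lemma differential_square: "dh (dk V) ** transpose hK + hK ** transpose (dh (dk V)) = dk V"
proof -
  have "((\<lambda>X. h (kron_map X) ** transpose (h (kron_map X))) has_derivative
      (\<lambda>E. hK ** transpose (dh (dk E)) + dh (dk E) ** transpose hK)) (at \<Sigma> within spd_mats)"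
    by (intro matrix_mult.FDERIV bounded_linear.has_derivative[OF bounded_linear_transpose] has_derivative_h_kron_map)
  then have "(kron_map has_derivative (\<lambda>E. hK ** transpose (dh (dk E)) + dh (dk E) ** transpose hK)) (at \<Sigma> within spd_mats)"
    by (rule has_derivative_transform[OF \<Sigma>, rotated]) (simp add: square kron_map_in_kron_spd)
  from differential_spd_eq[OF \<Sigma> V this] show ?thesis by (simp add: add.commute)
qed

text \<open>Product rule together with the derivative of inversion; the terms from the two inverse
  roots regroup around the core itself.\<close>

lemma differential_core_map:
  "differential spd_mats (core_map h) \<Sigma> V = matrix_inv hK ** V ** transpose (matrix_inv hK)
    - matrix_inv hK ** dh (dk V) ** core_map h \<Sigma> - core_map h \<Sigma> ** transpose (dh (dk V)) ** transpose (matrix_inv hK)"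
proof -
  let ?hi = "matrix_inv hK"
  define D where "D E = - (?hi ** dh (dk E) ** ?hi)" for E
  have hi: "((\<lambda>X. matrix_inv (h (kron_map X))) has_derivative D) (at \<Sigma> within spd_mats)"
    unfolding D_def[abs_def]
    by (rule has_derivative_compose[OF has_derivative_h_kron_map
        has_derivative_matrix_inv[OF invertible[OF kron_map_in_kron_spd[OF \<Sigma>]]]])
  have "(core_map h has_derivative (\<lambda>E. (?hi ** \<Sigma>) ** transpose (D E) + (?hi ** E + D E ** \<Sigma>) ** transpose ?hi)) (at \<Sigma> within spd_mats)"
    unfolding core_map_def[abs_def]
    by (intro matrix_mult.FDERIV bounded_linear.has_derivative[OF bounded_linear_transpose] hi has_derivative_ident)
  from differential_spd_eq[OF \<Sigma> V this] show ?thesis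
    by (simp add: D_def core_map_def linear_neg[OF linear_transpose] matrix_transpose_mul matrix_mult.minus_left matrix_mult.minus_right
        matrix_mult.add_left matrix_mult.diff_left matrix_mul_assoc algebra_simps)
qed

lemma differential_decomposition:
  "differential spd_mats (\<lambda>X. (kron_map X, core_map h X)) \<Sigma> V = (dk V, differential spd_mats (core_map h) \<Sigma> V)"
proof -
  have "(core_map h has_derivative differential spd_mats (core_map h) \<Sigma>) (at \<Sigma> within spd_mats)"
    by (intro has_derivative_differential smooth_map_on_differentiable[OF smooth_map_on_core_map \<Sigma>])
  from differential_spd_eq[OF \<Sigma> V has_derivative_Pair[OF has_derivative_kron_map this]] show ?thesis .
qed

text \<open>Any \<open>R\<close> with the right symmetrization may stand in for
  \<open>hK^{-1} dh\<close>. The explicit matrices for the two roots then only have to be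
  symmetrized, not identified with a differential.\<close>

lemma differential_core_map_at_kron:
  assumes C: "core_map h \<Sigma> = mat 1"
    and R: "R + transpose R = matrix_inv hK ** dk V ** transpose (matrix_inv hK)"
  shows "differential spd_mats (core_map h) \<Sigma> V = matrix_inv hK ** V ** transpose (matrix_inv hK) - R - transpose R"
proof -
  let ?hi = "matrix_inv hK"
  note i = invertible[OF kron_map_in_kron_spd[OF \<Sigma>]]
  have "R + transpose R = ?hi ** (dh (dk V) ** transpose hK + hK ** transpose (dh (dk V))) ** transpose ?hi"
    unfolding R differential_square ..
  also have "\<dots> = ?hi ** dh (dk V) ** transpose (?hi ** hK) + (?hi ** hK) ** transpose (dh (dk V)) ** transpose ?hi"
    by (simp add: matrix_add_ldistrib matrix_mult.add_left matrix_transpose_mul matrix_mul_assoc)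
  also have "\<dots> = ?hi ** dh (dk V) + transpose (dh (dk V)) ** transpose ?hi"
    by (simp add: matrix_inv_left[OF i])
  finally have eq: "?hi ** dh (dk V) + transpose (dh (dk V)) ** transpose ?hi = R + transpose R" ..
  show ?thesis unfolding differential_core_map C
    using eq by (simp add: diff_diff_add)
qed

end

end

lemma (in strict_total_order) half_part_add_transpose:
  assumes "transpose M = M"
  shows "half_part lt M + transpose (half_part lt M) = M"
proof -
  have s: "M $ i $ j = M $ j $ i" for i j
    using arg_cong[OF assms, of "\<lambda>M. M $ j $ i"] by (simp add: transpose_def)
  have "(half_part lt M + transpose (half_part lt M)) $ i $ j = M $ i $ j" for i j
  proof -
    consider "i = j" | "lt i j" "\<not> lt j i" "i \<noteq> j" | "lt j i" "\<not> lt i j" "i \<noteq> j" using total irrefl trans by metis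
    then show ?thesis by cases (use irrefl s[of i j] in \<open>simp_all add: half_part_def transpose_def\<close>)
  qed
  then show ?thesis by (simp add: vec_eq_iff)
qed

text \<open>\<open>eigendecomposition\<close> asks only for a diagonal matrix; positivity of its
  entries comes from conjugating \<open>S\<close> back.\<close>

lemma eigendecomposition_spd:
  fixes S :: "real^'n^'n"
  assumes S: "S \<in> spd_mats" and e: "eigendecomposition S Q \<Lambda>"
  obtains d where "orthogonal_matrix Q" "\<And>i. d i > 0" "\<Lambda> = diag_mat d" "S = Q ** diag_mat d ** transpose Q"
proof -
  have Q: "orthogonal_matrix Q" and \<Lambda>: "\<Lambda> = diag_mat (\<lambda>i. \<Lambda> $ i $ i)" and SQ: "S = Q ** \<Lambda> ** transpose Q"
    using e diagonal_eq_diag_mat[of \<Lambda>] by (simp_all add: eigendecomposition_def)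
  have "transpose Q ** S ** transpose (transpose Q) \<in> spd_mats"
    by (intro spd_congruence S transpose_invertible orthogonal_matrix_invertible Q)
  moreover have "transpose Q ** S ** transpose (transpose Q) = (transpose Q ** Q) ** \<Lambda> ** (transpose Q ** Q)"
    by (simp add: SQ matrix_mul_assoc)
  ultimately have "diag_mat (\<lambda>i. \<Lambda> $ i $ i) \<in> spd_mats"
    using \<Lambda> by (simp add: orthogonal_matrix_mult_transpose[OF Q])
  then show ?thesis using that[of "\<lambda>i. \<Lambda> $ i $ i"] Q \<Lambda> SQ unfolding diag_mat_spd_iff by simp
qed

lemma trace_tr1: "trace (tr1 M) = trace M"
  using trace_contract2[of M "mat 1" "mat 1"] by (simp add: contract2_mat_1 kron_mat_1)

lemma trace_tr2: "trace (tr2 M) = trace M"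
  using trace_contract1[of M "mat 1" "mat 1"] by (simp add: contract1_mat_1 kron_mat_1)

lemma transpose_tr1: "transpose (tr1 M) = tr1 (transpose M)"
  by (simp add: contract2_mat_1[symmetric] transpose_contract2)

lemma transpose_tr2: "transpose (tr2 M) = tr2 (transpose M)"
  by (simp add: contract1_mat_1[symmetric] transpose_contract1)

section \<open>The equation for the differential, and the corrections at an identity core\<close>

context factor_pair
begin

abbreviation "Kh \<equiv> kron H2 H1"

definition whiten :: "real^('b \<times> 'a)^('b \<times> 'a) \<Rightarrow> real^('b \<times> 'a)^('b \<times> 'a)"
  where "whiten V = matrix_inv Kh ** V ** matrix_inv Kh"

definition N1 :: "real^('b \<times> 'a)^('b \<times> 'a) \<Rightarrow> real^'a^'a"
  where "N1 V = (1 / real CARD('b)) *\<^sub>R (H1 ** (tr1 (whiten V) - (trace (whiten V) / real CARD('a)) *\<^sub>R mat 1) ** H1)"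

definition N2 :: "real^('b \<times> 'a)^('b \<times> 'a) \<Rightarrow> real^'b^'b"
  where "N2 V = (1 / real CARD('a)) *\<^sub>R (H2 ** tr2 (whiten V) ** H2)"

lemma sym_sqrt_kron_factors: "sym_sqrt (kron \<Sigma>2 \<Sigma>1) = Kh"
  by (rule sym_sqrt_kron[OF \<Sigma>2 \<Sigma>1])

lemma transpose_matrix_inv_Kh: "transpose (matrix_inv Kh) = matrix_inv Kh"
  by (simp add: matrix_inv_kron root1 root2 transpose_kron)

lemma transpose_whiten: "V \<in> sym_mats \<Longrightarrow> transpose (whiten V) = whiten V"
  by (simp add: whiten_def matrix_transpose_mul transpose_matrix_inv_Kh sym_mats_def matrix_mul_assoc)

lemma whiten_N:
  "whiten1 (N1 V) = (1 / real CARD('b)) *\<^sub>R (tr1 (whiten V) - (trace (whiten V) / real CARD('a)) *\<^sub>R mat 1)"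
  "whiten2 (N2 V) = (1 / real CARD('a)) *\<^sub>R tr2 (whiten V)"
  unfolding N1_def N2_def by (simp_all only: matrix_mult.scaleR_left matrix_mult.scaleR_right whiten_inverse)

lemma N_tangent: "V \<in> sym_mats \<Longrightarrow> (N1 V, N2 V) \<in> tangent_pairs \<Sigma>1"
  unfolding tangent_pairs_iff whiten_N
  by (simp add: transpose_scalar transpose_diff transpose_tr1 transpose_tr2 transpose_whiten trace_scaleR trace_sub
      trace_tr1 trace_I)

text \<open>A solution of the \<open>R_op\<close> equation also solves the score equations
  linearized at the symmetric core: tracing the second component shows that the trace terms on the
  two sides of the first one agree, so they cancel.\<close>

lemma differential_kron_map:
  assumes \<Sigma>: "\<Sigma> \<in> spd_mats" and K: "kron_map \<Sigma> = kron \<Sigma>2 \<Sigma>1" and V: "V \<in> sym_mats"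
    and U: "(U1, U2) \<in> tangent_pairs \<Sigma>1" and R: "R_op \<Sigma>1 \<Sigma>2 (core_map sym_sqrt \<Sigma>) (U1, U2) = (N1 V, N2 V)"
  shows "differential spd_mats kron_map \<Sigma> V = kron U2 \<Sigma>1 + kron \<Sigma>2 U1"
proof -
  let ?a = "real CARD('a)" and ?b = "real CARD('b)"
  interpret s: kron_square_root "sym_sqrt :: real^('b \<times> 'a)^('b \<times> 'a) \<Rightarrow> _"
    by unfold_locales (rule kron_root_sym_sqrt)
  let ?C = "core_map sym_sqrt \<Sigma>"
  have C: "balanced ?C" using s.core_map_in_core_mats[OF \<Sigma>] by (simp add: core_mats_iff_balanced)
  have C_eq: "?C = matrix_inv Kh ** \<Sigma> ** transpose (matrix_inv Kh)"
    by (simp add: core_map_def K sym_sqrt_kron_factors)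
  have u: "transpose (whiten1 U1) = whiten1 U1" "transpose (whiten2 U2) = whiten2 U2" "trace (whiten1 U1) = 0"
    using U unfolding tangent_pairs_iff by blast+
  note w = whiten_R_op[OF R, unfolded whiten_N]
  have "trace (contract1 ?C (whiten1 U1)) = 0"
    using trace_contract1[of ?C "whiten1 U1" "mat 1"] balanced_trace(1)[OF C] u(3) by simp
  then have t: "trace (whiten2 U2) = trace (whiten V) / ?a"
    using arg_cong[OF w(2), of trace] by (simp add: trace_add trace_scaleR trace_tr2)
  have w1: "whiten1 U1 + (1 / ?b) *\<^sub>R contract2 ?C (whiten2 U2) = (1 / ?b) *\<^sub>R tr1 (whiten V)"
    using w(1) unfolding t by (simp add: scaleR_diff_right)
  have K': "kron_map \<Sigma> = Kh ** transpose Kh"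
    by (simp add: K transpose_kron kron_mult root1(2) root2(2) sym_sqrt_square \<Sigma>1 \<Sigma>2)
  obtain W F F' where F: "open W" "\<Sigma> \<in> W" "\<And>X. X \<in> W \<Longrightarrow> X \<in> spd_mats \<Longrightarrow> F X = kron_map X"
    "(F has_derivative F') (at \<Sigma>)"
    and F': "\<And>V A1 A2. transpose V = V \<Longrightarrow> transpose A1 = A1 \<Longrightarrow> transpose A2 = A2 \<Longrightarrow> trace A1 = 0 \<Longrightarrow>
      A1 + (1 / ?b) *\<^sub>R contract2 (matrix_inv Kh ** \<Sigma> ** transpose (matrix_inv Kh)) A2
        = (1 / ?b) *\<^sub>R tr1 (matrix_inv Kh ** V ** transpose (matrix_inv Kh)) \<Longrightarrow>
      A2 + (1 / ?a) *\<^sub>R contract1 (matrix_inv Kh ** \<Sigma> ** transpose (matrix_inv Kh)) A1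
        = (1 / ?a) *\<^sub>R tr2 (matrix_inv Kh ** V ** transpose (matrix_inv Kh)) \<Longrightarrow>
      F' V = Kh ** (kron A2 (mat 1) + kron (mat 1) A1) ** transpose Kh"
    by (rule kron_map_smooth_at[OF \<Sigma> root2(1) root1(1) K'], rule that)
  obtain e where e: "e > 0" "ball \<Sigma> e \<subseteq> W" using F(1,2) open_contains_ball by blast
  have "(kron_map has_derivative F') (at \<Sigma> within spd_mats)"
  proof (rule has_derivative_transform_within[OF has_derivative_at_withinI[OF F(4)] e(1) \<Sigma>])
    fix X assume "X \<in> spd_mats" "dist X \<Sigma> < e"
    then have "X \<in> W" using e(2) by (auto simp: dist_commute)
    then show "F X = kron_map X" using \<open>X \<in> spd_mats\<close> by (rule F(3))
  qed
  from differential_spd_eq[OF \<Sigma> V this]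
  have "differential spd_mats kron_map \<Sigma> V = F' V" .
  also have "\<dots> = Kh ** (kron (whiten2 U2) (mat 1) + kron (mat 1) (whiten1 U1)) ** transpose Kh"
    using V w1 w(2) u
    by (intro F') (simp_all add: sym_mats_def C_eq transpose_matrix_inv_Kh whiten_def)
  also have "\<dots> = kron (H2 ** whiten2 U2 ** H2) (H1 ** H1) + kron (H2 ** H2) (H1 ** whiten1 U1 ** H1)"
    by (simp add: transpose_kron root1(2) root2(2) matrix_add_ldistrib matrix_mult.add_left kron_mult del: whiten_inverse)
  finally show ?thesis by (simp only: whiten_inverse sym_sqrt_square[OF \<Sigma>1] sym_sqrt_square[OF \<Sigma>2])
qed

text \<open>In the joint eigenbasis, with \<open>e\<close> the eigenvalues of \<open>Kh\<close>, the
  Hadamard factor divides by \<open>e p + e q\<close>. The identity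
  \<open>1 / e p + 1 / e q = (e p + e q) / (e p * e q)\<close> then turns the symmetrization into
  conjugation by the inverse of \<open>Kh\<close>.\<close>

lemma sym_sqrt_correction:
  fixes Q1 \<Lambda>1 :: "real^'a^'a" and Q2 \<Lambda>2 :: "real^'b^'b"
  assumes e1: "eigendecomposition \<Sigma>1 Q1 \<Lambda>1" and e2: "eigendecomposition \<Sigma>2 Q2 \<Lambda>2"
    and U: "transpose U1 = U1" "transpose U2 = U2"
  defines "l1 \<equiv> diag_vec (sym_sqrt \<Lambda>1)" and "l2 \<equiv> diag_vec (sym_sqrt \<Lambda>2)" and "G \<equiv> kron Q2 Q1"
  defines "\<Lambda> \<equiv> kron (outer 1 l2) (outer 1 l1) + kron (outer l2 1) (outer l1 1)"
  defines "R \<equiv> G ** kron (matrix_inv (sym_sqrt \<Lambda>2)) (matrix_inv (sym_sqrt \<Lambda>1))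
    ** hadamard (entrywise_inverse \<Lambda>) (kron \<Lambda>2 (transpose Q1 ** U1 ** Q1) + kron (transpose Q2 ** U2 ** Q2) \<Lambda>1)
    ** transpose G"
  shows "R + transpose R = matrix_inv Kh ** (kron U2 \<Sigma>1 + kron \<Sigma>2 U1) ** transpose (matrix_inv Kh)"
proof -
  obtain d1 where d1: "orthogonal_matrix Q1" "\<And>i. d1 i > 0" "\<Lambda>1 = diag_mat d1" "\<Sigma>1 = Q1 ** diag_mat d1 ** transpose Q1"
    by (rule eigendecomposition_spd[OF \<Sigma>1 e1], rule that)
  obtain d2 where d2: "orthogonal_matrix Q2" "\<And>i. d2 i > 0" "\<Lambda>2 = diag_mat d2" "\<Sigma>2 = Q2 ** diag_mat d2 ** transpose Q2"
    by (rule eigendecomposition_spd[OF \<Sigma>2 e2], rule that)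
  have G: "orthogonal_matrix G" unfolding G_def by (rule orthogonal_matrix_kron[OF d2(1) d1(1)])
  have r: "sym_sqrt \<Lambda>1 = diag_mat (\<lambda>i. sqrt (d1 i))" "sym_sqrt \<Lambda>2 = diag_mat (\<lambda>i. sqrt (d2 i))"
    by (simp_all add: d1(3) d2(3) sym_sqrt_diag_mat d1(2) d2(2))
  define e where "e p = sqrt (d2 (fst p)) * sqrt (d1 (snd p))" for p
  have e: "e p > 0" for p by (simp add: e_def d1(2) d2(2))
  \<comment> \<open>The outer products with the all-ones vector repeat the eigenvalues along rows
    and along columns, so the entries are pairwise sums.\<close>
  have \<Lambda>_nth: "\<Lambda> $ p $ q = e p + e q" for p q
    by (simp add: \<Lambda>_def kron_nth outer_def l1_def l2_def diag_vec_def r diag_mat_nth e_def)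
  have ne: "sqrt (d1 i) \<noteq> 0" "sqrt (d2 j) \<noteq> 0" for i j using d1(2)[of i] d2(2)[of j] by auto
  have D: "kron (matrix_inv (sym_sqrt \<Lambda>2)) (matrix_inv (sym_sqrt \<Lambda>1)) = diag_mat (\<lambda>p. inverse (e p))"
    unfolding r matrix_inv_diag_mat[of "\<lambda>i. sqrt (d1 i)", OF ne(1)] matrix_inv_diag_mat[of "\<lambda>i. sqrt (d2 i)", OF ne(2)]
    by (simp add: kron_diag_mat e_def)
  let ?D = "diag_mat (\<lambda>p. inverse (e p))"
  have Kh_eq: "Kh = G ** diag_mat e ** transpose G"
    unfolding d1(4) d2(4) sym_sqrt_spectral(2)[OF d1(1,2)] sym_sqrt_spectral(2)[OF d2(1,2)]
    by (simp add: kron_conj G_def kron_diag_mat e_def[abs_def])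
  have "diag_mat e ** ?D = mat 1"
    using e by (simp add: diag_mat_mult diag_mat_1 less_imp_neq[symmetric])
  then have hi: "matrix_inv Kh = G ** ?D ** transpose G"
    unfolding Kh_eq by (intro matrix_inv_eqI) (simp add: orthogonal_conj_mult[OF G] orthogonal_matrix_mult_transpose[OF G])
  define dk where "dk = kron U2 \<Sigma>1 + kron \<Sigma>2 U1"
  define M where "M = kron \<Lambda>2 (transpose Q1 ** U1 ** Q1) + kron (transpose Q2 ** U2 ** Q2) \<Lambda>1"
  have qs: "transpose Q1 ** \<Sigma>1 ** Q1 = \<Lambda>1" "transpose Q2 ** \<Sigma>2 ** Q2 = \<Lambda>2"
  proof -
    have "transpose Q1 ** \<Sigma>1 ** Q1 = (transpose Q1 ** Q1) ** \<Lambda>1 ** (transpose Q1 ** Q1)"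
      unfolding d1(3) by (subst d1(4)) (simp add: matrix_mul_assoc)
    then show "transpose Q1 ** \<Sigma>1 ** Q1 = \<Lambda>1" by (simp add: orthogonal_matrix_mult_transpose[OF d1(1)])
    have "transpose Q2 ** \<Sigma>2 ** Q2 = (transpose Q2 ** Q2) ** \<Lambda>2 ** (transpose Q2 ** Q2)"
      unfolding d2(3) by (subst d2(4)) (simp add: matrix_mul_assoc)
    then show "transpose Q2 ** \<Sigma>2 ** Q2 = \<Lambda>2" by (simp add: orthogonal_matrix_mult_transpose[OF d2(1)])
  qed
  have M_eq: "M = transpose G ** dk ** G"
    by (simp add: M_def dk_def G_def transpose_kron matrix_add_ldistrib matrix_mult.add_left kron_mult qs add.commute)
  have tM: "transpose M = M"
    by (simp add: M_eq dk_def matrix_transpose_mul transpose_add transpose_kron U spd_sym[OF \<Sigma>1] spd_sym[OF \<Sigma>2] matrix_mul_assoc)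
  then have Ms: "M $ p $ q = M $ q $ p" for p q
  proof -
    have "transpose M $ q $ p = M $ q $ p" by (simp only: tM)
    then show ?thesis by (simp add: transpose_def)
  qed
  define X where "X = ?D ** hadamard (entrywise_inverse \<Lambda>) M"
  have "(X + transpose X) $ p $ q = (?D ** M ** ?D) $ p $ q" for p q
  proof -
    have "(X + transpose X) $ p $ q = inverse (e p) * (inverse (e p + e q) * M $ p $ q) + inverse (e q) * (inverse (e q + e p) * M $ p $ q)"
      by (simp add: X_def transpose_def diag_mat_mult_nth hadamard_def entrywise_inverse_def \<Lambda>_nth Ms[of q p])
    also have "\<dots> = inverse (e p) * M $ p $ q * inverse (e q)"
    proof -
      have k: "inverse (e p) + inverse (e q) = (e p + e q) * (inverse (e p) * inverse (e q))"
        using e[of p] e[of q] by (simp add: field_simps)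
      have "inverse (e p) * (inverse (e p + e q) * M $ p $ q) + inverse (e q) * (inverse (e q + e p) * M $ p $ q)
          = (inverse (e p) + inverse (e q)) * inverse (e p + e q) * M $ p $ q"
        by (simp add: algebra_simps)
      then show ?thesis using add_pos_pos[OF e[of p] e[of q]] unfolding k by simp
    qed
    finally show ?thesis by (simp add: mult_diag_mat_nth diag_mat_mult_nth)
  qed
  then have XX: "X + transpose X = ?D ** M ** ?D" by (simp add: vec_eq_iff)
  have "R = G ** X ** transpose G"
    by (simp add: R_def D X_def M_def matrix_mul_assoc)
  then have "R + transpose R = G ** (X + transpose X) ** transpose G"
    by (simp add: matrix_transpose_mul matrix_add_ldistrib matrix_mult.add_left matrix_mul_assoc)
  also have "\<dots> = matrix_inv Kh ** dk ** transpose (matrix_inv Kh)"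
    by (simp add: XX hi M_eq matrix_transpose_mul transpose_diag_mat matrix_mul_assoc)
  finally show ?thesis by (simp add: dk_def)
qed

end

text \<open>As the root of a Kronecker product factors, the congruence by \<open>hi\<close> sends
  each summand to a Kronecker product with an identity factor; a symmetric matrix is its
  \<open>half_part\<close> plus the transpose of that.\<close>

lemma cholesky_correction:
  fixes \<Sigma>1 U1 :: "real^('a::{finite,linorder})^('a::{finite,linorder})"
    and \<Sigma>2 U2 :: "real^('b::{finite,linorder})^('b::{finite,linorder})"
  assumes \<Sigma>: "\<Sigma>1 \<in> spd_mats" "\<Sigma>2 \<in> spd_mats" and U: "transpose U1 = U1" "transpose U2 = U2"
  defines "L1 \<equiv> cholesky (<) \<Sigma>1" and "L2 \<equiv> cholesky (<) \<Sigma>2" and "hi \<equiv> matrix_inv (cholesky lex_less (kron \<Sigma>2 \<Sigma>1))"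
  defines "R \<equiv> half_part lex_less (kron (mat 1) (matrix_inv L1 ** U1 ** transpose (matrix_inv L1))
    + kron (matrix_inv L2 ** U2 ** transpose (matrix_inv L2)) (mat 1))"
  shows "R + transpose R = hi ** (kron U2 \<Sigma>1 + kron \<Sigma>2 U1) ** transpose hi"
proof -
  interpret l: strict_total_order "lex_less :: 'b \<times> 'a \<Rightarrow> _" by (rule strict_total_order_lex_less)
  interpret la: strict_total_order "(<) :: 'a \<Rightarrow> _" by (rule strict_total_order_less)
  interpret lb: strict_total_order "(<) :: 'b \<Rightarrow> _" by (rule strict_total_order_less)
  have i: "invertible L1" "invertible L2"
    unfolding L1_def L2_def by (rule la.cholesky_invertible[OF \<Sigma>(1)], rule lb.cholesky_invertible[OF \<Sigma>(2)])
  have hi: "hi = kron (matrix_inv L2) (matrix_inv L1)"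
    unfolding hi_def cholesky_kron[OF \<Sigma>(2,1)] L1_def[symmetric] L2_def[symmetric] by (rule matrix_inv_kron[OF i(2,1)])
  have s: "matrix_inv L1 ** \<Sigma>1 ** transpose (matrix_inv L1) = mat 1" "matrix_inv L2 ** \<Sigma>2 ** transpose (matrix_inv L2) = mat 1"
    using congruence_inverse(2)[OF i(1), of "mat 1"] congruence_inverse(2)[OF i(2), of "mat 1"]
    by (simp_all add: L1_def L2_def la.cholesky_props(3)[OF \<Sigma>(1)] lb.cholesky_props(3)[OF \<Sigma>(2)])
  have "R + transpose R = kron (mat 1) (matrix_inv L1 ** U1 ** transpose (matrix_inv L1))
    + kron (matrix_inv L2 ** U2 ** transpose (matrix_inv L2)) (mat 1)"
    unfolding R_def
    by (rule l.half_part_add_transpose)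
       (simp add: transpose_add transpose_kron matrix_transpose_mul U matrix_mul_assoc)
  also have "\<dots> = hi ** (kron U2 \<Sigma>1 + kron \<Sigma>2 U1) ** transpose hi"
    by (simp add: hi transpose_kron matrix_add_ldistrib matrix_mult.add_left kron_mult s add.commute)
  finally show ?thesis .
qed

theorem proposition5p3:
  fixes h :: "real^('b::{finite,linorder} \<times> 'a::{finite,linorder})^('b \<times> 'a)
                \<Rightarrow> real^('b \<times> 'a)^('b \<times> 'a)"
  assumes p1: "CARD('a) \<ge> 2" and p2: "CARD('b) \<ge> 2"
    and h: "h = sym_sqrt \<or> h = cholesky lex_less"
  shows
    "\<comment> \<open>(1)\<close>
     (smooth_map_on (spd_mats :: (real^('b \<times> 'a)^('b \<times> 'a)) set) kron_map \<and>
      kron_map ` (spd_mats :: (real^('b \<times> 'a)^('b \<times> 'a)) set) \<subseteq> kron_spd \<and>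
      smooth_map_on spd_mats (\<lambda>\<Sigma>. (kron_map \<Sigma>, core_map h \<Sigma>)) \<and>
      diffeomorphism spd_mats (kron_spd \<times> core_mats)
        (\<lambda>\<Sigma>. (kron_map \<Sigma>, core_map h \<Sigma>))
        (\<lambda>(K, C). h K ** C ** transpose (h K)))
     \<and>
     (\<forall>(\<Sigma> :: real^('b \<times> 'a)^('b \<times> 'a)) \<Sigma>1 \<Sigma>2 V.
        \<Sigma> \<in> spd_mats \<and> \<Sigma>1 \<in> spd_mats \<and> \<Sigma>2 \<in> spd_mats \<and>
        kron_map \<Sigma> = kron \<Sigma>2 \<Sigma>1 \<and> det \<Sigma>1 = 1 \<and> V \<in> sym_mats \<longrightarrow>
        (let C = core_map h \<Sigma>;
             Cs = core_map sym_sqrt \<Sigma>;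
             T = tangent_pairs \<Sigma>1;
             H1 = sym_sqrt \<Sigma>1; H2 = sym_sqrt \<Sigma>2; Kh = kron H2 H1;
             Vt = matrix_inv Kh ** V ** matrix_inv Kh;
             N1 = (1 / real CARD('b)) *\<^sub>R
                    (H1 ** (tr1 Vt - (trace Vt / real CARD('a)) *\<^sub>R mat 1) ** H1);
             N2 = (1 / real CARD('a)) *\<^sub>R (H2 ** tr2 Vt ** H2);
             hK = h (kron_map \<Sigma>); hi = matrix_inv hK;
             dk = differential spd_mats kron_map \<Sigma> V;
             dc = differential spd_mats (core_map h) \<Sigma> V;
             dh = differential kron_spd h (kron_map \<Sigma>) dk
         in
          \<comment> \<open>(2)\<close>
          linear (R_op \<Sigma>1 \<Sigma>2 C) \<and> bij_betw (R_op \<Sigma>1 \<Sigma>2 C) T T \<and>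
          linear (R_op \<Sigma>1 \<Sigma>2 Cs) \<and> bij_betw (R_op \<Sigma>1 \<Sigma>2 Cs) T T \<and>
          (\<exists>!U. U \<in> T \<and> R_op \<Sigma>1 \<Sigma>2 Cs U = (N1, N2)) \<and>
          (\<forall>U1 U2. (U1, U2) \<in> T \<and> R_op \<Sigma>1 \<Sigma>2 Cs (U1, U2) = (N1, N2) \<longrightarrow>
             dk = kron U2 \<Sigma>1 + kron \<Sigma>2 U1) \<and>
          h differentiable (at (kron_map \<Sigma>) within kron_spd) \<and>
          dc = hi ** V ** transpose hi - hi ** dh ** C - C ** transpose dh ** transpose hi \<and>
          differential spd_mats (\<lambda>\<Sigma>. (kron_map \<Sigma>, core_map h \<Sigma>)) \<Sigma> V = (dk, dc) \<and>
          \<comment> \<open>(3)\<close>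
          (C = mat 1 \<longleftrightarrow> \<Sigma> = kron_map \<Sigma>) \<and>
          (C = mat 1 \<longrightarrow>
            (\<forall>U\<in>T. R_op \<Sigma>1 \<Sigma>2 C U = U) \<and> Cs = C \<and>
            dk = (1 / real CARD('a)) *\<^sub>R kron (H2 ** tr2 Vt ** H2) \<Sigma>1
                 + (1 / real CARD('b)) *\<^sub>R kron \<Sigma>2 (H1 ** tr1 Vt ** H1)
                 - (trace Vt / real CARD('b \<times> 'a)) *\<^sub>R \<Sigma> \<and>
            (\<forall>U1 U2. (U1, U2) \<in> T \<and> R_op \<Sigma>1 \<Sigma>2 C (U1, U2) = (N1, N2) \<longrightarrow>
               (U1, U2) = (N1, N2) \<and>
               (h = cholesky lex_less \<longrightarrow>
                 (let L1 = cholesky (<) \<Sigma>1; L2 = cholesky (<) \<Sigma>2;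
                      Rt = half_part lex_less
                             (kron (mat 1) (matrix_inv L1 ** U1 ** transpose (matrix_inv L1))
                              + kron (matrix_inv L2 ** U2 ** transpose (matrix_inv L2)) (mat 1))
                  in dc = hi ** V ** transpose hi - Rt - transpose Rt)) \<and>
               (h = sym_sqrt \<longrightarrow>
                 (\<forall>\<Gamma>1 \<Lambda>1 \<Gamma>2 \<Lambda>2.
                    eigendecomposition \<Sigma>1 \<Gamma>1 \<Lambda>1 \<and> eigendecomposition \<Sigma>2 \<Gamma>2 \<Lambda>2 \<longrightarrow>
                    (let l1 = diag_vec (sym_sqrt \<Lambda>1); l2 = diag_vec (sym_sqrt \<Lambda>2);
                         \<Lambda> = kron (outer 1 l2) (outer 1 l1) + kron (outer l2 1) (outer l1 1);
                         G = kron \<Gamma>2 \<Gamma>1;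
                         Rt = G ** kron (matrix_inv (sym_sqrt \<Lambda>2)) (matrix_inv (sym_sqrt \<Lambda>1))
                              ** hadamard (entrywise_inverse \<Lambda>)
                                   (kron \<Lambda>2 (transpose \<Gamma>1 ** U1 ** \<Gamma>1)
                                    + kron (transpose \<Gamma>2 ** U2 ** \<Gamma>2) \<Lambda>1)
                              ** transpose G
                     in dc = hi ** V ** transpose hi - Rt - transpose Rt)))))))"
proof (intro conjI allI impI, goal_cases)
  case 1
  show ?case by (rule smooth_map_on_kron_map)
next
  case 2
  show ?case by (auto intro: kron_map_in_kron_spd)
next
  case 3
  interpret kron_square_root h
    using h by unfold_locales (auto simp: kron_root_sym_sqrt kron_root_cholesky)
  show ?case by (rule smooth_decomposition)
next
  case 4
  interpret kron_square_root h
    using h by unfold_locales (auto simp: kron_root_sym_sqrt kron_root_cholesky)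
  show ?case by (rule diffeomorphism_decomposition)
next
  case (5 \<Sigma> \<Sigma>1 \<Sigma>2 V)
  then have \<Sigma>: "\<Sigma> \<in> spd_mats" and \<Sigma>1: "\<Sigma>1 \<in> spd_mats" and \<Sigma>2: "\<Sigma>2 \<in> spd_mats"
    and K: "kron_map \<Sigma> = kron \<Sigma>2 \<Sigma>1" and V: "V \<in> sym_mats" by blast+
  interpret kron_square_root h
    using h by unfold_locales (auto simp: kron_root_sym_sqrt kron_root_cholesky)
  \<comment> \<open>The equation for the differential uses the symmetric core whichever
    \<open>h\<close> is given.\<close>
  interpret s: kron_square_root "sym_sqrt :: real^('b \<times> 'a)^('b \<times> 'a) \<Rightarrow> _"
    by unfold_locales (rule kron_root_sym_sqrt)
  interpret factor_pair \<Sigma>1 \<Sigma>2 by unfold_locales (rule \<Sigma>1 \<Sigma>2)+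
  note C = core_map_in_core_mats[OF \<Sigma>] and Cs = s.core_map_in_core_mats[OF \<Sigma>]
  let ?R = "R_op \<Sigma>1 \<Sigma>2" and ?T = "tangent_pairs \<Sigma>1 :: (((real, 'a) vec, 'a) vec \<times> ((real, 'b) vec, 'b) vec) set"
  let ?C = "core_map h \<Sigma>" and ?Cs = "core_map sym_sqrt \<Sigma>" and ?hi = "matrix_inv (h (kron_map \<Sigma>))"
  let ?dk = "differential spd_mats kron_map \<Sigma> V" and ?dc = "differential spd_mats (core_map h) \<Sigma> V"
  have ex1: "\<exists>!U. U \<in> ?T \<and> ?R ?Cs U = (N1 V, N2 V)"
    using bij_betw_R_op[OF Cs] N_tangent[OF V] unfolding bij_betw_iff_bijections bij_betw_def inj_on_def by (metis (no_types, lifting) imageE)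
  have dk: "?dk = kron U2 \<Sigma>1 + kron \<Sigma>2 U1" if "(U1, U2) \<in> ?T \<and> ?R ?Cs (U1, U2) = (N1 V, N2 V)" for U1 U2
    using differential_kron_map[OF \<Sigma> K V] that by blast
  have core1: "?C = mat 1 \<longleftrightarrow> \<Sigma> = kron_map \<Sigma>" by (rule core_map_eq_mat_1_iff[OF \<Sigma>])
  \<comment> \<open>Whether the core is the identity depends on \<open>\<Sigma>\<close> alone, not
    on the chosen root.\<close>
  have eqC: "?Cs = ?C" if "?C = mat 1" using that core1 s.core_map_eq_mat_1_iff[OF \<Sigma>] by simp
  have id: "?R ?C U = U" if "?C = mat 1" "U \<in> ?T" for U using R_op_mat_1[OF that(2)] that(1) by simp
  \<comment> \<open>With \<open>R_op\<close> the identity on the tangent space, the right-hand side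
    is itself the solution.\<close>
  have dk1: "?dk = kron (N2 V) \<Sigma>1 + kron \<Sigma>2 (N1 V)" if "?C = mat 1"
    using dk id[OF that N_tangent[OF V]] eqC[OF that] N_tangent[OF V] by simp
  have dk1': "?dk = (1 / real CARD('a)) *\<^sub>R kron (H2 ** tr2 (whiten V) ** H2) \<Sigma>1
      + (1 / real CARD('b)) *\<^sub>R kron \<Sigma>2 (H1 ** tr1 (whiten V) ** H1)
      - (trace (whiten V) / real CARD('b \<times> 'a)) *\<^sub>R \<Sigma>" if "?C = mat 1"
  proof -
    \<comment> \<open>The multiple of \<open>mat 1\<close> in \<open>N1 V\<close> becomes a multiple
      of \<open>\<Sigma>1\<close>, and its Kronecker product with \<open>\<Sigma>2\<close> one of
      \<open>\<Sigma>\<close>.\<close>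
    have eq: "kron \<Sigma>2 \<Sigma>1 = \<Sigma>" using core1 that K by simp
    have "?dk = (1 / real CARD('a)) *\<^sub>R kron (H2 ** tr2 (whiten V) ** H2) \<Sigma>1
      + (1 / real CARD('b)) *\<^sub>R kron \<Sigma>2 (H1 ** tr1 (whiten V) ** H1)
      - (trace (whiten V) / real CARD('b \<times> 'a)) *\<^sub>R kron \<Sigma>2 \<Sigma>1"
      unfolding dk1[OF that]
      by (simp add: N1_def N2_def matrix_mult.diff_left matrix_mult.diff_right matrix_mult.scaleR_left
          matrix_mult.scaleR_right sym_sqrt_square \<Sigma>1 kron.scaleR_left kron.scaleR_right kron.diff_right scaleR_diff_right
          mult.commute)
    then show ?thesis unfolding eq .
  qed
  have NN: "(U1, U2) = (N1 V, N2 V)" if "?C = mat 1" "(U1, U2) \<in> ?T \<and> ?R ?C (U1, U2) = (N1 V, N2 V)" for U1 U2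
    using id[OF that(1)] that(2) by metis
  have dc1: "?dc = ?hi ** V ** transpose ?hi - R - transpose R"
    if "?C = mat 1" "(U1, U2) \<in> ?T \<and> ?R ?C (U1, U2) = (N1 V, N2 V)"
      "R + transpose R = ?hi ** (kron U2 \<Sigma>1 + kron \<Sigma>2 U1) ** transpose ?hi" for U1 U2 R
    by (rule differential_core_map_at_kron[OF \<Sigma> V that(1)]) (use that(3) NN[OF that(1,2)] dk1[OF that(1)] in simp)
  note N = N1_def[of V, unfolded whiten_def, symmetric] N2_def[of V, unfolded whiten_def, symmetric]
  show ?case
    unfolding Let_def N
  proof (intro conjI allI impI ballI, goal_cases)
    case 1
    show ?case by (rule linear_R_op)
  next
    case 2
    show ?case by (rule bij_betw_R_op[OF C])
  next
    case 3
    show ?case by (rule linear_R_op)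
  next
    case 4
    show ?case by (rule bij_betw_R_op[OF Cs])
  next
    case 5
    show ?case by (rule ex1)
  next
    case (6 U1 U2)
    then show ?case by (rule dk)
  next
    case 7
    show ?case by (rule h_differentiable[OF \<Sigma> V])
  next
    case 8
    show ?case by (rule differential_core_map[OF \<Sigma> V])
  next
    case 9
    show ?case by (rule differential_decomposition[OF \<Sigma> V])
  next
    case 10
    show ?case by (rule core1)
  next
    case (11 U)
    then show ?case by (rule id)
  next
    case 12
    then show ?case by (rule eqC)
  next
    case 13
    then show ?case by (rule dk1'[unfolded whiten_def])
  next
    case (14 U1 U2)
    then show ?case by (rule NN)
  next
    case (15 U1 U2)
    then have "U1 \<in> sym_mats" "U2 \<in> sym_mats" by (simp_all add: tangent_pairs_def)
    then have U: "transpose U1 = U1" "transpose U2 = U2" by (simp_all add: sym_mats_def)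
    show ?case
      by (rule dc1[OF 15(1,2)]) (use cholesky_correction[OF \<Sigma>1 \<Sigma>2 U] in \<open>simp only: 15(3) K\<close>)
  next
    case (16 U1 U2 \<Gamma>1 \<Lambda>1 \<Gamma>2 \<Lambda>2)
    then have "U1 \<in> sym_mats" "U2 \<in> sym_mats" by (simp_all add: tangent_pairs_def)
    then have U: "transpose U1 = U1" "transpose U2 = U2" by (simp_all add: sym_mats_def)
    have e: "eigendecomposition \<Sigma>1 \<Gamma>1 \<Lambda>1" "eigendecomposition \<Sigma>2 \<Gamma>2 \<Lambda>2" using 16 by blast+
    show ?case
      by (rule dc1[OF 16(1,2)])
        (use sym_sqrt_correction[OF e U] in \<open>simp only: 16(3) K sym_sqrt_kron_factors\<close>)
  qed
qed

end
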